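(* There exists a universal constant $C>0$ such that for every prime galaxy $H$ with $|H|\ge 2$ there is an algorithm which, given any $n$-vertex $H$-free tournament $T$, runs in time quasipolynomial in $n$ (i.e. at most $\exp(K(\log n)^{K})$ for some constant $K$ depending only on $H$) and outputs a partition of $V(T)$ into transitive subsets, the number of parts being $O\!\left(n^{1-\frac{C}{|H|^{5}\log(|H|)}}\log(n)\right)$ (the implied constant may depend on $H$).
   Context: A tournament is a directed graph in which every pair of distinct vertices is joined by exactly one of the two possible arcs; a vertex set is transitive if it induces a subtournament with no directed cycle. A tournament $T$ is $H$-free if no induced subtournament of $T$ is isomorphic to $H$. A set $S\subseteq V(H)$ is homogeneous if every vertex of $V(H)\setminus S$ is either adjacent to all vertices of $S$ or adjacent from all vertices of $S$; it is nontrivial if $1<|S|<|V(H)|$; $H$ is prime if it has no nontrivial homogeneous set. Given an ordering $\theta=(v_1,\dots,v_m)$ of $V(H)$, an arc $(v_i,v_j)$ is backward if $j<i$; the backward-edge graph $B(H,\theta)$ is the undirected graph on $V(H)$ with $v_iv_j$ an edge iff the arc between them is backward. A star is $K_{1,t}$ ($t\ge1$) with a center and leaves. An induced subgraph of $B(H,\theta)$ is a right (resp. left) star if it is a star whose center has the largest (resp. smallest) index among its vertices. $\theta$ is a star ordering if every connected component of $B(H,\theta)$ is a left star, a right star, or a single vertex. $H$ is a galaxy if it has a star ordering in which no center of a star lies strictly between two leaves of another star. Logarithms are natural. *)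

theory Defs
  imports Complex_Main "HOL-Library.Disjoint_Sets"
begin

section \<open>Tournaments\<close>

definition tournament :: "'a set \<Rightarrow> 'a rel \<Rightarrow> bool" where
  "tournament V A \<longleftrightarrow> finite V \<and> A \<subseteq> V \<times> V \<and> irrefl A \<and>
     (\<forall>u\<in>V. \<forall>v\<in>V. u \<noteq> v \<longrightarrow> ((u, v) \<in> A \<longleftrightarrow> (v, u) \<notin> A))"

definition transitive_set :: "'a rel \<Rightarrow> 'a set \<Rightarrow> bool" where
  "transitive_set A S \<longleftrightarrow> acyclic (A \<inter> S \<times> S)"

definition isomorphic :: "'a set \<Rightarrow> 'a rel \<Rightarrow> 'b set \<Rightarrow> 'b rel \<Rightarrow> bool" where
  "isomorphic V A W B \<longleftrightarrow>
     (\<exists>f. bij_betw f V W \<and> (\<forall>u\<in>V. \<forall>v\<in>V. (u, v) \<in> A \<longleftrightarrow> (f u, f v) \<in> B))"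

definition free_of :: "'b set \<Rightarrow> 'b rel \<Rightarrow> 'a set \<Rightarrow> 'a rel \<Rightarrow> bool" where
  "free_of VH AH V A \<longleftrightarrow> \<not> (\<exists>S\<subseteq>V. isomorphic S (A \<inter> S \<times> S) VH AH)"

definition homogeneous :: "'a set \<Rightarrow> 'a rel \<Rightarrow> 'a set \<Rightarrow> bool" where
  "homogeneous V A S \<longleftrightarrow> S \<subseteq> V \<and>
     (\<forall>v\<in>V - S. (\<forall>s\<in>S. (v, s) \<in> A) \<or> (\<forall>s\<in>S. (s, v) \<in> A))"

definition prime_tournament :: "'a set \<Rightarrow> 'a rel \<Rightarrow> bool" where
  "prime_tournament V A \<longleftrightarrow> tournament V A \<and>
     \<not> (\<exists>S. homogeneous V A S \<and> 1 < card S \<and> card S < card V)"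


section \<open>Galaxies\<close>

definition vertex_ordering :: "'a set \<Rightarrow> 'a list \<Rightarrow> bool" where
  "vertex_ordering V \<theta> \<longleftrightarrow> distinct \<theta> \<and> set \<theta> = V"

definition before :: "'a list \<Rightarrow> 'a \<Rightarrow> 'a \<Rightarrow> bool" where
  "before \<theta> u v \<longleftrightarrow> (\<exists>i j. i < j \<and> j < length \<theta> \<and> \<theta> ! i = u \<and> \<theta> ! j = v)"

text \<open>The backward-edge graph, as a symmetric relation on the vertices.\<close>

definition backward_edges :: "'a rel \<Rightarrow> 'a list \<Rightarrow> 'a rel" where
  "backward_edges A \<theta> =
     {(u, v). (before \<theta> u v \<and> (v, u) \<in> A) \<or> (before \<theta> v u \<and> (u, v) \<in> A)}"

definition graph_components :: "'a set \<Rightarrow> 'a rel \<Rightarrow> 'a set set" where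
  "graph_components V E = {E\<^sup>* `` {v} | v. v \<in> V}"

definition star_centered_at :: "'a rel \<Rightarrow> 'a set \<Rightarrow> 'a \<Rightarrow> bool" where
  "star_centered_at E S c \<longleftrightarrow> c \<in> S \<and> S \<noteq> {c} \<and>
     (\<forall>u\<in>S. \<forall>v\<in>S. (u, v) \<in> E \<longleftrightarrow> u \<noteq> v \<and> (u = c \<or> v = c))"

definition right_star :: "'a rel \<Rightarrow> 'a list \<Rightarrow> 'a set \<Rightarrow> bool" where
  "right_star E \<theta> S \<longleftrightarrow> (\<exists>c. star_centered_at E S c \<and> (\<forall>u\<in>S - {c}. before \<theta> u c))"

definition left_star :: "'a rel \<Rightarrow> 'a list \<Rightarrow> 'a set \<Rightarrow> bool" where
  "left_star E \<theta> S \<longleftrightarrow> (\<exists>c. star_centered_at E S c \<and> (\<forall>u\<in>S - {c}. before \<theta> c u))"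

definition star_ordering :: "'a set \<Rightarrow> 'a rel \<Rightarrow> 'a list \<Rightarrow> bool" where
  "star_ordering V A \<theta> \<longleftrightarrow> vertex_ordering V \<theta> \<and>
     (\<forall>S\<in>graph_components V (backward_edges A \<theta>).
        left_star (backward_edges A \<theta>) \<theta> S \<or> right_star (backward_edges A \<theta>) \<theta> S \<or>
        (\<exists>v. S = {v}))"

text \<open>
  In a star with a single edge either endpoint may serve as the center. The function
  \<open>ctr\<close> fixes one center for each star; the leaves of \<open>S\<close> are then \<open>S - {ctr S}\<close>.
\<close>

definition galaxy :: "'a set \<Rightarrow> 'a rel \<Rightarrow> bool" where
  "galaxy V A \<longleftrightarrow> tournament V A \<and>
     (\<exists>\<theta> ctr. star_ordering V A \<theta> \<and>
        (let E = backward_edges A \<theta>; stars = {S \<in> graph_components V E. \<not> (\<exists>v. S = {v})} in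
           (\<forall>S\<in>stars. star_centered_at E S (ctr S)) \<and>
           (\<forall>S\<in>stars. \<forall>S'\<in>stars. S \<noteq> S' \<longrightarrow>
              \<not> (\<exists>x\<in>S' - {ctr S'}. \<exists>y\<in>S' - {ctr S'}.
                    before \<theta> x (ctr S) \<and> before \<theta> (ctr S) y))))"


section \<open>Algorithms\<close>

text \<open>
  The model of computation is that of first-order recursive programs over binary trees
  (LISP without mutation), with call by value. A program is a list of function bodies; the
  body of a function refers to its arguments by their positions. Every evaluation step is
  charged one unit. A tree is thought of as a pointer to shared immutable cells, so each step
  is a bounded number of pointer operations for a fixed program; up to a polynomial, this time
  measure therefore agrees with time on Turing machines and on random access machines with
  logarithmic cost.
\<close>

datatype tree = Leaf | Node tree tree

fun left :: "tree \<Rightarrow> tree" where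
  "left Leaf = Leaf"
| "left (Node s t) = s"

fun right :: "tree \<Rightarrow> tree" where
  "right Leaf = Leaf"
| "right (Node s t) = t"

text \<open>\<open>IfE c a b\<close> selects \<open>a\<close> when \<open>c\<close> evaluates to a \<^const>\<open>Node\<close>, and \<open>b\<close> otherwise.\<close>

datatype expr =
    VarE nat
  | LeafE
  | NodeE expr expr
  | LeftE expr
  | RightE expr
  | IfE expr expr expr
  | CallE nat "expr list"

type_synonym program = "expr list"

text \<open>
  \<open>eval P env e v t\<close>: in program \<open>P\<close> with arguments \<open>env\<close>, the expression \<open>e\<close> evaluates to
  \<open>v\<close> in \<open>t\<close> steps. Undefined variables, undefined functions and infinite recursion yield
  no value.
\<close>

inductive eval :: "program \<Rightarrow> tree list \<Rightarrow> expr \<Rightarrow> tree \<Rightarrow> nat \<Rightarrow> bool"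
  and evals :: "program \<Rightarrow> tree list \<Rightarrow> expr list \<Rightarrow> tree list \<Rightarrow> nat \<Rightarrow> bool"
  for P :: program
where
  Var: "i < length env \<Longrightarrow> eval P env (VarE i) (env ! i) 1"
| LeafE: "eval P env LeafE Leaf 1"
| NodeE: "eval P env a u s \<Longrightarrow> eval P env b v t \<Longrightarrow>
    eval P env (NodeE a b) (Node u v) (s + t + 1)"
| LeftE: "eval P env a v t \<Longrightarrow> eval P env (LeftE a) (left v) (t + 1)"
| RightE: "eval P env a v t \<Longrightarrow> eval P env (RightE a) (right v) (t + 1)"
| IfE_Node: "eval P env c (Node x y) s \<Longrightarrow> eval P env a v t \<Longrightarrow>
    eval P env (IfE c a b) v (s + t + 1)"
| IfE_Leaf: "eval P env c Leaf s \<Longrightarrow> eval P env b v t \<Longrightarrow>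
    eval P env (IfE c a b) v (s + t + 1)"
| Call: "f < length P \<Longrightarrow> evals P env es vs s \<Longrightarrow> eval P vs (P ! f) v t \<Longrightarrow>
    eval P env (CallE f es) v (s + t + 1)"
| Empty: "evals P env [] [] 0"
| Cons: "eval P env e v s \<Longrightarrow> evals P env es vs t \<Longrightarrow>
    evals P env (e # es) (v # vs) (s + t)"

lemma eval_deterministic:
  "eval P env e v t \<Longrightarrow> eval P env e v' t' \<Longrightarrow> v = v' \<and> t = t'"
  "evals P env es vs t \<Longrightarrow> evals P env es vs' t' \<Longrightarrow> vs = vs' \<and> t = t'"
proof (induction arbitrary: v' t' and vs' t' rule: eval_evals.inducts)
  case (Var i env)
  from Var.prems show ?case by cases auto
next
  case (LeafE env)
  from LeafE.prems show ?case by cases auto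
next
  case (NodeE env a u s b v t)
  from NodeE.prems show ?case by cases (use NodeE.IH in blast)+
next
  case (LeftE env a v t)
  from LeftE.prems show ?case by cases (use LeftE.IH in blast)+
next
  case (RightE env a v t)
  from RightE.prems show ?case by cases (use RightE.IH in blast)+
next
  case (IfE_Node env c x y s a v t b)
  from IfE_Node.prems show ?case by cases (use IfE_Node.IH in blast)+
next
  case (IfE_Leaf env c s b v t a)
  from IfE_Leaf.prems show ?case by cases (use IfE_Leaf.IH in blast)+
next
  case (Call f env es vs s v t)
  from Call.prems show ?case
    by cases (use Call.IH in blast)
next
  case (Empty env)
  from Empty.prems show ?case by cases auto
next
  case (Cons env e v s es vs t)
  from Cons.prems show ?case by cases (use Cons.IH in blast)+
qed

text \<open>The first function of a program is its entry point.\<close>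

definition computes :: "program \<Rightarrow> tree \<Rightarrow> tree \<Rightarrow> nat \<Rightarrow> bool" where
  "computes P x y t \<longleftrightarrow> eval P [x] (CallE 0 [VarE 0]) y t"

fun enc_list :: "('a \<Rightarrow> tree) \<Rightarrow> 'a list \<Rightarrow> tree" where
  "enc_list f [] = Leaf"
| "enc_list f (x # xs) = Node (f x) (enc_list f xs)"

fun enc_bool :: "bool \<Rightarrow> tree" where
  "enc_bool False = Leaf"
| "enc_bool True = Node Leaf Leaf"

text \<open>Vertices are written in unary; this costs at most a factor polynomial in \<open>n\<close>.\<close>

fun enc_nat :: "nat \<Rightarrow> tree" where
  "enc_nat 0 = Leaf"
| "enc_nat (Suc n) = Node Leaf (enc_nat n)"

text \<open>A digraph with vertex set \<open>{..<n}\<close> is given to a program by its adjacency matrix.\<close>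

definition enc_digraph :: "nat \<Rightarrow> nat rel \<Rightarrow> tree" where
  "enc_digraph n A =
     enc_list (enc_list enc_bool) (map (\<lambda>i. map (\<lambda>j. (i, j) \<in> A) [0..<n]) [0..<n])"

definition enc_sets :: "nat list list \<Rightarrow> tree" where
  "enc_sets = enc_list (enc_list enc_nat)"

text \<open>
  \<open>lists_sets ps Q\<close>: the list \<open>ps\<close> lists the members of the family \<open>Q\<close> of sets, each member
  being itself listed without repetition.
\<close>

definition lists_sets :: "nat list list \<Rightarrow> nat set set \<Rightarrow> bool" where
  "lists_sets ps Q \<longleftrightarrow> distinct (map set ps) \<and> (\<forall>p\<in>set ps. distinct p) \<and> set (map set ps) = Q"

end

theory Submission
  imports Defs
begin

text \<open>
  The algorithm \<open>tau\<close> finds a large transitive set by recursion, with a fuel \<open>d\<close> of about \<open>log n\<close>.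
  Since \<open>T\<close> is \<open>H\<close>-free, a greedy embedding of \<open>H\<close> into a part \<open>S\<close> of \<open>T\<close> gets stuck, and this yields
  \<open>X\<close>, \<open>Y\<close> in \<open>S\<close> of size linear in \<open>|S|\<close> such that almost all arcs go from \<open>X\<close> to \<open>Y\<close>. Keep \<open>X\<close>, the transitive
  set \<open>L = tau X\<close>, and go on inside the vertices of \<open>Y\<close> that are mostly dominated by \<open>X\<close> and by \<open>L\<close>. After \<open>2h + 1\<close> stages
  one has a sequence of pairs \<open>(X, L)\<close> with few backward arcs between different stages. The vertices of a galaxy are
  distributed over the stages: every centre gets a linear set \<open>X\<close> of its own, and the leaves between two
  consecutive centres share one transitive set \<open>L\<close>, cut into consecutive chunks. If the star of some centre cannot
  be placed, a positive fraction of a linear set \<open>X\<close> is complete to or from what is left of a chunk \<open>P\<close>, and \<open>P\<close> is obtained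
  from \<open>L\<close> by restricting to the neighbourhoods of at most \<open>h + 2\<close> vertices. All such \<open>P\<close> are tried, so the recursion finds a
  transitive set of size at least \<open>|P| + |tau Z|\<close>, where \<open>Z\<close> is the common neighbourhood of \<open>P\<close>. Hence if the size
  of \<open>S\<close> grows by the factor \<open>level_loss h = exp (O (h^2 log h))\<close>, the size of the transitive set grows by the
  factor \<open>1 + 1 / (4 (h + 1))\<close>, which gives the exponent.
\<close>

section \<open>The algorithm\<close>

text \<open>The obstacle is that centres and leaves make opposite demands. A blocked star must leave
  a large set to recurse on, so centres need linear sets; leaves of one star must point forward
  among themselves, which a transitive set guarantees, but transitive sets may be small. The galaxy
  condition reconciles the two: all leaves of a star lie between the same two consecutive centres,
  hence in one transitive set. Once a centre has a backward neighbour in what is left of every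
  leaf's chunk, these neighbours can be picked independently. The algorithm never attempts to embed
  the stars. It relies on the fact that a blocked star yields \<open>P\<close>, and that so few
  vertices cut out \<open>P\<close> that the enumeration is polynomial for fixed h. Polynomially
  many recursive calls over logarithmic depth give \<open>n ^ O(log n)\<close> steps. Comparing the
  gain per level with the logarithm of the loss gives an exponent of order
  \<open>1 / (h^3 log h)\<close>, better than the claimed \<open>1 / (h^5 log h)\<close>.\<close>

text \<open>
  Densities are compared with \<open>1 / t\<close> for the following values of \<open>t\<close>; each has to be small compared with the
  later ones, because averaging over one side costs the quotient of two of them.
\<close>

definition prune_at :: "nat \<Rightarrow> nat" where "prune_at h = 4 * h * (h + 1)"
definition restrict_at :: "nat \<Rightarrow> nat" where "restrict_at h = 4 * (2 * h + 1) * prune_at h"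
definition orient_at :: "nat \<Rightarrow> nat" where "orient_at h = 4 * restrict_at h"
definition emb_at :: "nat \<Rightarrow> nat" where "emb_at h = 8 * restrict_at h"

text \<open>For \<open>j < h\<close> the lists \<open>every h (drop j S)\<close> are the residue
  classes modulo h of the positions in \<open>S\<close>: a partition into nearly equal parts that
  needs no arithmetic on lengths.\<close>

fun every :: "nat \<Rightarrow> 'a list \<Rightarrow> 'a list" where
  "every h [] = []"
| "every h (x # xs) = x # every h (drop (h - 1) xs)"

definition longer :: "'a list \<Rightarrow> 'a list \<Rightarrow> 'a list" where
  "longer xs ys = (if length xs < length ys then ys else xs)"

text \<open>The tournament H enters through \<open>pat\<close>: for \<open>i < j\<close>, entry i of
  \<open>pat j\<close> says whether the arc between its i-th and j-th vertices leaves the i-th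
  one.\<close>

locale search =
  fixes A :: "nat rel" and h :: nat and pat :: "nat \<Rightarrow> bool list"
begin

definition nb :: "bool \<Rightarrow> nat \<Rightarrow> nat list \<Rightarrow> nat list" where
  "nb b v X = filter (\<lambda>x. if b then (v, x) \<in> A else (x, v) \<in> A) X"

definition sel :: "nat \<Rightarrow> bool \<Rightarrow> bool \<Rightarrow> nat list \<Rightarrow> nat list \<Rightarrow> nat list" where
  "sel t c b W V = filter (\<lambda>v. (t * length (nb b v W) < length W) = c) V"

text \<open>Once \<open>v\<close> is placed, the leading bit of every later entry has been used up.
  The guard on \<open>bs\<close> gives an empty list the head False; this agrees with the program,
  where the left part of a leaf is a leaf.\<close>

definition advance :: "nat \<Rightarrow> (bool list \<times> nat list) list \<Rightarrow> (bool list \<times> nat list) list" where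
  "advance v Ps = map (\<lambda>(bs, W). (tl bs, nb (bs \<noteq> [] \<and> hd bs) v W)) Ps"

text \<open>
  In \<open>emb V Ps Qs\<close> some vertices of \<open>H\<close> have been placed; \<open>V\<close> holds the candidates for the next one and \<open>Qs\<close> has an
  entry for every later one, with the arcs it receives from the vertices not yet placed and its candidates. \<open>Ps\<close>
  is the part of \<open>Qs\<close> against which \<open>V\<close> has not yet been filtered. In an \<open>H\<close>-free tournament this gets stuck,
  and the result is the dense pair that blocks it, with a flag for its direction.
\<close>

function emb :: "nat list \<Rightarrow> (bool list \<times> nat list) list \<Rightarrow> (bool list \<times> nat list) list \<Rightarrow>
    bool \<times> nat list \<times> nat list" where
  "emb [] [] Qs = (False, [], [])"
| "emb (v # V) [] Qs = (case advance v Qs of [] \<Rightarrow> (False, [], []) | P # Ps \<Rightarrow> emb (snd P) Ps Ps)"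
| "emb V (P # Ps) Qs =
     (let b = (fst P \<noteq> [] \<and> hd (fst P)); bad = sel (emb_at h) True b (snd P) V;
          good = sel (emb_at h) False b (snd P) V
      in if emb_at h * length bad < length good then emb good Ps Qs else (b, bad, snd P))"
  by pat_completeness auto
termination
  by (relation "measures [\<lambda>(V, Ps, Qs). length Qs, \<lambda>(V, Ps, Qs). length Ps]")
    (auto simp: advance_def map_eq_Cons_conv)

definition parts :: "nat list \<Rightarrow> (bool list \<times> nat list) list" where
  "parts S = map (\<lambda>j. (pat j, every h (drop j S))) [0..<h]"

text \<open>\<open>emb\<close> bounds the exceptional arcs at each vertex of \<open>X\<close>. When
  most arcs go from \<open>Y\<close> to \<open>X\<close>, the first component has to be
  \<open>Y\<close>, so the bound must be moved to the vertices of \<open>Y\<close>; averaging allows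
  this for at least half of them.\<close>

definition orient :: "bool \<times> nat list \<times> nat list \<Rightarrow> nat list \<times> nat list" where
  "orient r = (case r of (b, X, Y) \<Rightarrow> if b then (sel (orient_at h) True False X Y, X) else (X, Y))"

definition dense_pair :: "nat list \<Rightarrow> nat list \<times> nat list" where
  "dense_pair S = (case parts S of [] \<Rightarrow> ([], []) | P # Ps \<Rightarrow> orient (emb (snd P) Ps Ps))"

text \<open>
  \<open>restrict\<close> makes the later stages sparse as seen from a single later vertex, \<open>prune\<close> as seen from a single earlier one.
\<close>

fun prune :: "nat list \<Rightarrow> (nat list \<times> nat list) list \<Rightarrow> nat list" where
  "prune V [] = V"
| "prune V (P # Ps) =
     prune (sel (prune_at h) True False (snd P) (sel (prune_at h) True False (fst P) V)) Ps"

definition restrict :: "nat list \<Rightarrow> nat list \<Rightarrow> nat list \<Rightarrow> nat list" where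
  "restrict X L Y = sel (restrict_at h) True True L (sel (restrict_at h) True True X Y)"

text \<open>Restriction happens on the way down, because the later stages must live inside the
  restricted set; pruning happens on the way back, because it compares with later sets in their
  final form. The argument \<open>f\<close> stands for the recursive call of
  \<open>tau\<close>.\<close>

fun stages :: "(nat list \<Rightarrow> nat list) \<Rightarrow> nat \<Rightarrow> nat list \<Rightarrow> (nat list \<times> nat list) list" where
  "stages f 0 S = []"
| "stages f (Suc r) S =
     (let P = dense_pair S; L = f (fst P); zs = stages f r (restrict (fst P) L (snd P))
      in (prune (fst P) zs, prune L zs) # zs)"

fun common :: "bool \<Rightarrow> nat list \<Rightarrow> nat list \<Rightarrow> nat list" where
  "common b [] S = S"
| "common b (x # xs) S = common b xs (nb b x S)"

definition cand :: "(nat list \<Rightarrow> nat list) \<Rightarrow> nat list \<Rightarrow> nat list \<Rightarrow> nat list" where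
  "cand f P S = longer (P @ f (common True P S)) (f (common False P S) @ P)"

text \<open>Which vertices cut out a useful \<open>P\<close> is unknown, so all sequences of at most
  \<open>r\<close> signed vertices are tried: at each step the next vertex is used with either sign,
  or skipped.\<close>

fun explore :: "(nat list \<Rightarrow> nat list) \<Rightarrow> nat list \<Rightarrow> nat \<Rightarrow> nat list \<Rightarrow> nat list \<Rightarrow> nat list" where
  "explore f S r [] P = cand f P S"
| "explore f S 0 (v # vs) P = cand f P S"
| "explore f S (Suc r) (v # vs) P =
     longer (longer (explore f S r S (nb True v P)) (explore f S r S (nb False v P)))
       (explore f S (Suc r) vs P)"

text \<open>The budget is \<open>h + 2\<close> because two vertices delimit a chunk and at most h
  placed vertices restrict it further.\<close>

fun explore_all :: "(nat list \<Rightarrow> nat list) \<Rightarrow> nat list \<Rightarrow> (nat list \<times> nat list) list \<Rightarrow> nat list" where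
  "explore_all f S [] = []"
| "explore_all f S (z # zs) = longer (explore f S (h + 2) S (snd z)) (explore_all f S zs)"

text \<open>The fuel bounds the depth by about log n; recursion on the length of the list could be
  linearly deep and would spoil the running time. The candidate built from the single vertex
  \<open>x\<close> keeps the result nonempty.\<close>

fun tau :: "nat \<Rightarrow> nat list \<Rightarrow> nat list" where
  "tau 0 S = []"
| "tau (Suc d) [] = []"
| "tau (Suc d) (x # S) =
     longer (cand (tau d) [x] (x # S))
       (explore_all (tau d) (x # S) (stages (tau d) (2 * h + 1) (x # S)))"

text \<open>\<open>cs\<close> is a unary counter for the rounds; a list serves because the program
  has the vertex list itself at hand.\<close>

fun color :: "'c list \<Rightarrow> nat \<Rightarrow> nat list \<Rightarrow> nat list list" where
  "color [] d S = []"
| "color (c # cs) d [] = []"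
| "color (c # cs) d (x # S) =
     tau d (x # S) # color cs d (filter (\<lambda>y. y \<notin> set (tau d (x # S))) (x # S))"

text \<open>Transitive sets are kept in their transitive order, so that chunks are intervals of the
  list.\<close>

definition transitive_list :: "nat list \<Rightarrow> bool" where
  "transitive_list = sorted_wrt (\<lambda>x y. (x, y) \<in> A)"

lemma set_nb: "set (nb b v X) = {x \<in> set X. if b then (v, x) \<in> A else (x, v) \<in> A}"
  by (auto simp: nb_def)

lemma set_sel: "set (sel t c b W V) = {v \<in> set V. (t * length (nb b v W) < length W) = c}"
  by (auto simp: sel_def)

lemma distinct_nb [simp]: "distinct X \<Longrightarrow> distinct (nb b v X)"
  by (simp add: nb_def)

lemma distinct_sel [simp]: "distinct X \<Longrightarrow> distinct (sel t c b W X)"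
  by (simp add: sel_def)

lemma length_nb_le [simp]: "length (nb b v X) \<le> length X"
  by (simp add: nb_def)

lemma length_sel_le [simp]: "length (sel t c b W X) \<le> length X"
  by (simp add: sel_def)

lemma length_sel_add: "length (sel t True b W V) + length (sel t False b W V) = length V"
  unfolding sel_def by (simp add: sum_length_filter_compl)

lemma transitive_list_nb: "transitive_list X \<Longrightarrow> transitive_list (nb b v X)"
  by (simp add: transitive_list_def nb_def sorted_wrt_filter)

lemma set_common: "set (common b P S) = {v \<in> set S. \<forall>x\<in>set P. if b then (x, v) \<in> A else (v, x) \<in> A}"
  by (induction b P S rule: common.induct) (auto simp: set_nb)

lemma distinct_common [simp]: "distinct S \<Longrightarrow> distinct (common b P S)"
  by (induction b P S rule: common.induct) auto

lemma length_longer: "length (longer xs ys) = max (length xs) (length ys)"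
  by (auto simp: longer_def)

end

section \<open>Averaging over the two sides of a relation\<close>

lemma double_count:
  "(\<Sum>y\<leftarrow>Y. length (filter (\<lambda>x. r x y) X)) = (\<Sum>x\<leftarrow>X. length (filter (r x) Y))"
proof (induction Y)
  case (Cons y Y)
  have "(\<Sum>x\<leftarrow>X. length (filter (r x) (y # Y))) = length (filter (\<lambda>x. r x y) X) + (\<Sum>x\<leftarrow>X. length (filter (r x) Y))"
    by (induction X) simp_all
  then show ?case using Cons.IH by (simp only: list.map sum_list.Cons)
next
  case Nil
  show ?case by (induction X) simp_all
qed

lemma sum_list_filter_ge:
  fixes f :: "'a \<Rightarrow> nat"
  assumes "\<And>y. y \<in> set Y \<Longrightarrow> P y \<Longrightarrow> a \<le> f y"
  shows "a * length (filter P Y) \<le> sum_list (map f Y)"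
  using assms
proof (induction Y)
  case (Cons y Y)
  then have "a * length (filter P Y) \<le> sum_list (map f Y)" by simp
  moreover have "P y \<Longrightarrow> a \<le> f y" using Cons.prems by simp
  ultimately show ?case by auto
qed simp

lemma sum_list_le:
  fixes f :: "'a \<Rightarrow> nat"
  assumes "\<And>y. y \<in> set Y \<Longrightarrow> f y \<le> a"
  shows "sum_list (map f Y) \<le> a * length Y"
  using assms
proof (induction Y)
  case (Cons y Y)
  then have "sum_list (map f Y) \<le> a * length Y" "f y \<le> a" by simp_all
  then show ?case by auto
qed simp

text \<open>There are at most \<open>length X * length Y / t\<close> related pairs, and each
  \<open>y\<close> in the filtered list accounts for at least \<open>length X / s\<close> of
  them.\<close>

lemma markov:
  assumes X: "X \<noteq> []" and t: "\<And>x. x \<in> set X \<Longrightarrow> t * length (filter (r x) Y) \<le> length Y"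
  shows "t * length (filter (\<lambda>y. length X \<le> s * length (filter (\<lambda>x. r x y) X)) Y) \<le> s * length Y"
proof -
  let ?Z = "filter (\<lambda>y. length X \<le> s * length (filter (\<lambda>x. r x y) X)) Y"
  have "length X * length ?Z \<le> sum_list (map (\<lambda>y. s * length (filter (\<lambda>x. r x y) X)) Y)"
    by (rule sum_list_filter_ge) auto
  also have "\<dots> = s * (\<Sum>x\<leftarrow>X. length (filter (r x) Y))"
    using double_count[of r X Y] by (simp add: sum_list_const_mult)
  finally have "t * (length X * length ?Z) \<le> t * (s * (\<Sum>x\<leftarrow>X. length (filter (r x) Y)))"
    by (rule mult_left_mono) simp
  also have "\<dots> = s * (\<Sum>x\<leftarrow>X. t * length (filter (r x) Y))"
    by (simp add: sum_list_const_mult)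
  also have "\<dots> \<le> s * (length Y * length X)"
    by (intro mult_left_mono sum_list_le t) auto
  finally have "length X * (t * length ?Z) \<le> length X * (s * length Y)"
    by (simp add: mult_ac)
  then show ?thesis using X by simp
qed

text \<open>The negation appears because the same arcs are seen from the other end: for
  \<open>x\<close> in \<open>X\<close> and \<open>y\<close> in \<open>Y\<close>, \<open>y\<close> is
  in \<open>nb (\<not> b) x Y\<close> exactly if \<open>x\<close> is in
  \<open>nb b y X\<close>.\<close>

lemma (in search) markov_sel:
  assumes X: "X \<noteq> []" and t: "\<And>x. x \<in> set X \<Longrightarrow> t * length (nb (\<not> b) x Y) \<le> length Y"
  shows "t * length Y \<le> t * length (sel s True b X Y) + s * length Y"
proof -
  have 1: "nb b y X = filter (\<lambda>x. if \<not> b then (x, y) \<in> A else (y, x) \<in> A) X" for y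
    unfolding nb_def by (intro filter_cong) auto
  have "t * length (filter (\<lambda>y. length X \<le> s * length (filter (\<lambda>x. if \<not> b then (x, y) \<in> A else (y, x) \<in> A) X)) Y) \<le> s * length Y"
    by (rule markov[OF X]) (use t in \<open>auto simp: nb_def\<close>)
  also have "filter (\<lambda>y. length X \<le> s * length (filter (\<lambda>x. if \<not> b then (x, y) \<in> A else (y, x) \<in> A) X)) Y = sel s False b X Y"
    unfolding sel_def 1[symmetric] by (intro filter_cong) auto
  finally have "t * length (sel s False b X Y) \<le> s * length Y" .
  moreover have "t * length Y = t * length (sel s True b X Y) + t * length (sel s False b X Y)"
    using length_sel_add[of s b X Y] by (metis distrib_left)
  ultimately show ?thesis by linarith
qed

section \<open>Dense pairs\<close>

lemma tournament_asym: "tournament V A \<Longrightarrow> (x, y) \<in> A \<Longrightarrow> (y, x) \<notin> A"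
  unfolding tournament_def irrefl_def by (metis mem_Sigma_iff subsetD)

lemma tournament_total:
  "tournament V A \<Longrightarrow> x \<in> V \<Longrightarrow> y \<in> V \<Longrightarrow> x \<noteq> y \<Longrightarrow> (x, y) \<in> A \<or> (y, x) \<in> A"
  unfolding tournament_def by blast

lemma emb_at_pos: "h > 0 \<Longrightarrow> emb_at h \<ge> 1"
  by (simp add: emb_at_def restrict_at_def prune_at_def)

lemma length_every: "h > 0 \<Longrightarrow> length xs \<le> h * length (every h xs)"
proof (induction h xs rule: every.induct)
  case (2 h x xs)
  then show ?case by (cases h) auto
qed simp

lemma every_nth: "x \<in> set (every h xs) \<Longrightarrow> h > 0 \<Longrightarrow> \<exists>t. h * t < length xs \<and> x = xs ! (h * t)"
proof (induction h xs rule: every.induct)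
  case (2 h x' xs)
  show ?case
  proof (cases "x = x'")
    case True
    then show ?thesis by (intro exI[of _ 0]) simp
  next
    case False
    then obtain t where t: "h * t < length (drop (h - 1) xs)" "x = drop (h - 1) xs ! (h * t)"
      using 2 by auto
    have e: "h * Suc t = Suc (h - 1 + h * t)" using 2 by simp
    have "h * Suc t < length (x' # xs) \<and> x = (x' # xs) ! (h * Suc t)"
      unfolding e using t by simp
    then show ?thesis by blast
  qed
qed simp

lemma set_every: "set (every h xs) \<subseteq> set xs"
  by (induction h xs rule: every.induct) (auto dest: in_set_dropD)

lemma distinct_every: "distinct xs \<Longrightarrow> distinct (every h xs)"
proof (induction h xs rule: every.induct)
  case (2 h x xs)
  then show ?case using set_every[of h "drop (h - 1) xs"] by (auto dest: in_set_dropD)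
qed simp

lemma every_disjoint:
  assumes "distinct S" "j < h" "j' < h" "x \<in> set (every h (drop j S))" "x \<in> set (every h (drop j' S))"
  shows "j = j'"
proof -
  obtain t where t: "h * t < length (drop j S)" "x = drop j S ! (h * t)"
    using every_nth[OF assms(4)] assms(2) by auto
  obtain t' where t': "h * t' < length (drop j' S)" "x = drop j' S ! (h * t')"
    using every_nth[OF assms(5)] assms(2) by auto
  have "S ! (j + h * t) = S ! (j' + h * t')" "j + h * t < length S" "j' + h * t' < length S"
    using t t' by auto
  then have "j + h * t = j' + h * t'" using assms(1) by (simp add: nth_eq_iff_index_eq)
  then have "(j + h * t) mod h = (j' + h * t') mod h" by (rule arg_cong)
  then show ?thesis using assms(2,3) by simp
qed

lemma distinct_concat_map_upt:
  assumes "\<And>j. j < k \<Longrightarrow> distinct (g j)"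
    and "\<And>i j x. i < k \<Longrightarrow> j < k \<Longrightarrow> x \<in> set (g i) \<Longrightarrow> x \<in> set (g j) \<Longrightarrow> i = j"
  shows "distinct (concat (map g [0..<k]))"
  using assms
proof (induction k)
  case (Suc k)
  have "distinct (concat (map g [0..<k]))"
  proof (rule Suc.IH)
    show "distinct (g j)" if "j < k" for j using Suc.prems(1)[of j] that by simp
    show "i = j" if "i < k" "j < k" "x \<in> set (g i)" "x \<in> set (g j)" for i j x
      using Suc.prems(2)[of i j x] that by simp
  qed
  moreover have "x \<notin> set (g k)" if "i < k" "x \<in> set (g i)" for i x
    using Suc.prems(2)[of i k x] that by auto
  then have "set (concat (map g [0..<k])) \<inter> set (g k) = {}" by auto
  ultimately show ?case using Suc.prems(1)[of k] by simp
qed simp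

context search
begin

text \<open>The success condition for the part of H not yet placed. Positions are relative to the
  next vertex, so entry j of \<open>Ps\<close> belongs to relative position \<open>Suc j\<close> and
  carries that many bits.\<close>

definition realizes :: "nat list \<Rightarrow> (bool list \<times> nat list) list \<Rightarrow> bool" where
  "realizes V Ps \<longleftrightarrow> (\<exists>vs. length vs = Suc (length Ps) \<and> vs ! 0 \<in> set V \<and>
     (\<forall>j<length Ps. vs ! Suc j \<in> set (snd (Ps ! j)) \<and>
        (\<forall>i\<le>j. ((vs ! i, vs ! Suc j) \<in> A) = fst (Ps ! j) ! i)))"

definition cover :: "(bool list \<times> nat list) list \<Rightarrow> nat set" where
  "cover Ps = (\<Union>P\<in>set Ps. set (snd P))"

lemma distinct_concat_advance:
  "distinct (concat (map snd Qs)) \<Longrightarrow> distinct (concat (map snd (advance v Qs)))"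
  "cover (advance v Qs) \<subseteq> cover Qs"
proof -
  show c: "cover (advance v Qs) \<subseteq> cover Qs" for Qs
    by (auto simp: cover_def advance_def set_nb split: prod.splits)
  have e: "set (concat (map snd Qs)) = cover Qs" for Qs :: "(bool list \<times> nat list) list"
    by (auto simp: cover_def)
  show "distinct (concat (map snd Qs)) \<Longrightarrow> distinct (concat (map snd (advance v Qs)))"
  proof (induction Qs)
    case (Cons P Qs)
    have "distinct (concat (map snd (advance v Qs)))" using Cons by simp
    moreover have "set (snd (hd (advance v [P]))) \<subseteq> set (snd P)"
      by (auto simp: advance_def set_nb split: prod.splits)
    moreover have "distinct (snd (hd (advance v [P])))"
      using Cons.prems by (cases P) (simp add: advance_def)
    moreover have "advance v (P # Qs) = hd (advance v [P]) # advance v Qs"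
      by (simp add: advance_def)
    moreover have "set (snd P) \<inter> cover Qs = {}" using Cons.prems e[of Qs] by simp
    ultimately show ?case using c[of Qs] e[of "advance v Qs"] by auto
  qed (simp add: advance_def)
qed

text \<open>The placed vertex is put in front: \<open>advance\<close> has already intersected every
  candidate set with the neighbourhood of \<open>v\<close> that the consumed bit demands.\<close>

lemma realizes_step:
  assumes T: "tournament U A" and bits: "\<And>j. j < length Qs \<Longrightarrow> length (fst (Qs ! j)) = Suc j"
    and adv: "advance v Qs = P # Ps" and real: "realizes (snd P) Ps" and v: "v \<in> set V"
  shows "realizes V Qs"
proof -
  obtain vs where vs: "length vs = Suc (length Ps)" "vs ! 0 \<in> set (snd P)"
    "\<And>j. j < length Ps \<Longrightarrow> vs ! Suc j \<in> set (snd (Ps ! j)) \<and>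
        (\<forall>i\<le>j. ((vs ! i, vs ! Suc j) \<in> A) = fst (Ps ! j) ! i)"
    using real unfolding realizes_def by blast
  have len: "length Qs = Suc (length Ps)"
    using arg_cong[OF adv, of length] by (simp add: advance_def)
  have nth: "(P # Ps) ! j = (tl (fst (Qs ! j)), nb (hd (fst (Qs ! j))) v (snd (Qs ! j)))"
    if "j < length Qs" for j
  proof -
    have "fst (Qs ! j) \<noteq> []" using bits[OF that] by auto
    then show ?thesis
      unfolding adv[symmetric] using that by (cases "Qs ! j") (simp add: advance_def)
  qed
  have mem: "vs ! j \<in> set (snd ((P # Ps) ! j))" if "j < length Qs" for j
    using vs that len by (cases j) auto
  have "(v # vs) ! Suc j \<in> set (snd (Qs ! j)) \<and>
        (\<forall>i\<le>j. (((v # vs) ! i, (v # vs) ! Suc j) \<in> A) = fst (Qs ! j) ! i)" if j: "j < length Qs" for j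
  proof (intro conjI allI impI)
    have m: "vs ! j \<in> set (nb (hd (fst (Qs ! j))) v (snd (Qs ! j)))"
      using mem[OF j] nth[OF j] by simp
    then show "(v # vs) ! Suc j \<in> set (snd (Qs ! j))" by (simp add: set_nb)
    fix i assume i: "i \<le> j"
    have ne: "fst (Qs ! j) \<noteq> []" using bits[OF j] by auto
    show "(((v # vs) ! i, (v # vs) ! Suc j) \<in> A) = fst (Qs ! j) ! i"
    proof (cases i)
      case 0
      then show ?thesis using m ne tournament_asym[OF T]
        by (auto simp: set_nb hd_conv_nth split: if_splits)
    next
      case (Suc i')
      then obtain j' where j': "j = Suc j'" using i by (cases j) auto
      have "((vs ! i', vs ! Suc j') \<in> A) = fst (Ps ! j') ! i'"
        using vs(3)[of j'] j j' len i Suc by simp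
      moreover have "fst (Ps ! j') = tl (fst (Qs ! j))" using nth[OF j] j' by simp
      ultimately show ?thesis using Suc j' i bits[OF j] by (simp add: nth_tl)
    qed
  qed
  then show ?thesis unfolding realizes_def using vs(1) len v
    by (intro exI[of _ "v # vs"]) auto
qed

text \<open>Each size hypothesis pays for one kind of loss. An accepted filtering step keeps at
  least half of \<open>V\<close>, which the power of 2 covers; in a rejected one \<open>bad\<close>
  is at least a \<open>1 / (emb_at h + 1)\<close> fraction of \<open>V\<close>. Placing a vertex
  costs each later set a factor of at most \<open>emb_at h\<close>, because the vertices surviving
  in \<open>V\<close> are typical for all entries of \<open>Ds\<close>, the part of
  \<open>Qs\<close> already filtered. The factors 2 in the power of \<open>2 * emb_at h\<close>
  prepare each set for its own filtering.\<close>

lemma emb_dense: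
  assumes T: "tournament U A" and z: "z \<ge> 1" and h: "h > 0"
    and "distinct (V @ concat (map snd Qs))" "set V \<union> cover Qs \<subseteq> U"
    and "Qs = Ds @ Ps"
    and "\<And>P v. P \<in> set Ds \<Longrightarrow> v \<in> set V \<Longrightarrow>
           length (snd P) \<le> emb_at h * length (nb (hd (fst P)) v (snd P))"
    and "\<And>j. j < length Qs \<Longrightarrow> length (fst (Qs ! j)) = Suc j"
    and "\<And>P. P \<in> set Qs \<Longrightarrow> (2 * emb_at h) ^ Suc (length Qs) * z \<le> length (snd P)"
    and "2 ^ length Ps * ((emb_at h + 1) * z) \<le> length V"
  shows "realizes V Qs \<or> (\<exists>b X Y. emb V Ps Qs = (b, X, Y) \<and> z \<le> length X \<and> z \<le> length Y \<and>
     distinct (X @ Y) \<and> set X \<union> set Y \<subseteq> set V \<union> cover Qs \<and>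
     (\<forall>x\<in>set X. emb_at h * length (nb b x Y) < length Y))"
  using assms(4-)
proof (induction V Ps Qs arbitrary: Ds rule: emb.induct)
  case (1 Qs)
  then show ?case using z by simp
next
  case (2 v V Qs)
  show ?case
  proof (cases "advance v Qs")
    case Nil
    then have "Qs = []" by (simp add: advance_def)
    then show ?thesis unfolding realizes_def by (auto intro!: exI[of _ "[v]"])
  next
    case (Cons P Ps)
    let ?q = "emb_at h"
    have len: "length Qs = Suc (length Ps)"
      using arg_cong[OF Cons, of length] by (simp add: advance_def)
    have ne: "fst (Qs ! j) \<noteq> []" if "j < length Qs" for j
      using "2.prems"(5)[OF that] by auto
    have nth: "(P # Ps) ! j = (tl (fst (Qs ! j)), nb (hd (fst (Qs ! j))) v (snd (Qs ! j)))"
      if "j < length Qs" for j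
      unfolding Cons[symmetric] using ne[OF that] that by (cases "Qs ! j") (simp add: advance_def)
    have big: "(2 * ?q) ^ Suc (length Ps) * (2 * z) \<le> length (snd ((P # Ps) ! j))" if "j < length Qs" for j
    proof -
      have "(2 * ?q) ^ Suc (length Qs) * z \<le> length (snd (Qs ! j))"
        using "2.prems"(6) that by simp
      also have "\<dots> \<le> ?q * length (snd ((P # Ps) ! j))"
        using "2.prems"(3,4) that nth[OF that] by (auto simp: nth_mem)
      finally have "?q * ((2 * ?q) ^ Suc (length Ps) * (2 * z)) \<le> ?q * length (snd ((P # Ps) ! j))"
        by (simp add: len mult_ac)
      then show ?thesis
        using emb_at_pos[OF h] by auto
    qed
    have D: "distinct (concat (map snd (P # Ps)))" "cover (P # Ps) \<subseteq> cover Qs"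
      using "2.prems"(1) distinct_concat_advance[where Qs = Qs and v = v] Cons by auto
    have cc: "set (snd P) \<union> cover Ps \<subseteq> cover Qs" using D(2) by (auto simp: cover_def)
    have "realizes (snd P) Ps \<or> (\<exists>b X Y. emb (snd P) Ps Ps = (b, X, Y) \<and> z \<le> length X \<and> z \<le> length Y \<and>
     distinct (X @ Y) \<and> set X \<union> set Y \<subseteq> set (snd P) \<union> cover Ps \<and>
     (\<forall>x\<in>set X. emb_at h * length (nb b x Y) < length Y))"
    proof (rule "2.IH"[OF Cons, of "[]"])
      show "distinct (snd P @ concat (map snd Ps))" using D(1) by simp
      show "set (snd P) \<union> cover Ps \<subseteq> U" using cc "2.prems"(2) by auto
      show "length (fst (Ps ! j)) = Suc j" if "j < length Ps" for j
        using nth[of "Suc j"] "2.prems"(5)[of "Suc j"] that len by simp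
      show "(2 * ?q) ^ Suc (length Ps) * z \<le> length (snd P')" if P': "P' \<in> set Ps" for P'
      proof -
        obtain j where "j < length Ps" "Ps ! j = P'" using P' by (auto simp: in_set_conv_nth)
        then show ?thesis using big[of "Suc j"] len by simp
      qed
      have "2 ^ length Ps * ((?q + 1) * z) \<le> (2 * ?q) ^ Suc (length Ps) * (2 * z)"
      proof -
        have "?q \<ge> 1" using h by (rule emb_at_pos)
        then have "(?q + 1) * z \<le> ?q * (2 * z)" by (simp add: add_mult_distrib)
        moreover have "(2::nat) ^ length Ps \<le> (2 * ?q) ^ length Ps"
          using emb_at_pos[OF h] by (intro power_mono) auto
        ultimately have "2 ^ length Ps * ((?q + 1) * z) \<le> (2 * ?q) ^ length Ps * (?q * (2 * z))"
          by (rule mult_le_mono[rotated])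
        also have "\<dots> \<le> (2 * ?q) ^ Suc (length Ps) * (2 * z)" by (simp add: mult_ac)
        finally show ?thesis .
      qed
      also have "\<dots> \<le> length (snd P)" using big[of 0] len by simp
      finally show "2 ^ length Ps * ((?q + 1) * z) \<le> length (snd P)" .
    qed simp_all
    then show ?thesis
    proof
      assume "realizes (snd P) Ps"
      then show ?thesis
        using realizes_step[OF T _ Cons, of "v # V"] "2.prems"(5) by simp
    next
      assume "\<exists>b X Y. emb (snd P) Ps Ps = (b, X, Y) \<and> z \<le> length X \<and> z \<le> length Y \<and>
     distinct (X @ Y) \<and> set X \<union> set Y \<subseteq> set (snd P) \<union> cover Ps \<and>
     (\<forall>x\<in>set X. emb_at h * length (nb b x Y) < length Y)"
      then show ?thesis using Cons cc by fastforce
    qed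
  qed
next
  case (3 V P Ps Qs)
  let ?q = "emb_at h"
  let ?b = "hd (fst P)"
  let ?bad = "sel ?q True ?b (snd P) V"
  let ?good = "sel ?q False ?b (snd P) V"
  have PQ: "P \<in> set Qs" using "3.prems"(3) by simp
  have ne: "fst P \<noteq> []"
    using "3.prems"(5)[of "length Ds"] "3.prems"(3) by auto
  have add: "length ?bad + length ?good = length V" by (rule length_sel_add)
  show ?case
  proof (cases "?q * length ?bad < length ?good")
    case True
    have e: "emb V (P # Ps) Qs = emb ?good Ps Qs" using True ne by (simp add: Let_def)
    have "realizes ?good Qs \<or> (\<exists>b X Y. emb ?good Ps Qs = (b, X, Y) \<and> z \<le> length X \<and> z \<le> length Y \<and>
     distinct (X @ Y) \<and> set X \<union> set Y \<subseteq> set ?good \<union> cover Qs \<and>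
     (\<forall>x\<in>set X. emb_at h * length (nb b x Y) < length Y))"
    proof (rule "3.IH"[of "fst P \<noteq> [] \<and> ?b" ?bad ?good "Ds @ [P]"])
      show "distinct (?good @ concat (map snd Qs))" using "3.prems"(1) by (auto simp: set_sel)
      show "set ?good \<union> cover Qs \<subseteq> U" using "3.prems"(2) by (auto simp: set_sel)
      show "length (snd P') \<le> ?q * length (nb (hd (fst P')) v (snd P'))"
        if "P' \<in> set (Ds @ [P])" "v \<in> set ?good" for P' v
        using that "3.prems"(4)[of P' v] by (auto simp: set_sel)
      have "1 * length ?bad \<le> ?q * length ?bad" by (intro mult_le_mono1 emb_at_pos h)
      then have "length V \<le> 2 * length ?good" using add True by linarith
      then show "2 ^ length Ps * ((?q + 1) * z) \<le> length ?good" using "3.prems"(7) by simp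
    qed (use ne True "3.prems" in simp_all)
    moreover have "realizes ?good Qs \<Longrightarrow> realizes V Qs"
      unfolding realizes_def by (auto simp: set_sel)
    ultimately show ?thesis unfolding e by (fastforce simp: set_sel)
  next
    case False
    have e: "emb V (P # Ps) Qs = (?b, ?bad, snd P)" using False ne by (simp add: Let_def)
    have "(?q + 1) * z \<le> 2 ^ length (P # Ps) * ((?q + 1) * z)" by simp
    also have "\<dots> \<le> length V" by (rule "3.prems"(7))
    also have "\<dots> \<le> (?q + 1) * length ?bad" using False add by simp
    finally have 1: "z \<le> length ?bad" by (metis add_gr_0 mult_le_cancel1 zero_less_one)
    have "1 * z \<le> (2 * ?q) ^ Suc (length Qs) * z"
      using emb_at_pos[OF h] by (intro mult_le_mono1 one_le_power) simp
    then have 2: "z \<le> length (snd P)" using "3.prems"(6)[OF PQ] by (simp only: mult_1)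
    have sub: "set (snd P) \<subseteq> set (concat (map snd Qs))" using PQ by auto
    have "distinct (snd P)" using "3.prems"(1) PQ by (auto simp: distinct_concat_iff)
    then have 3: "distinct (?bad @ snd P)" using "3.prems"(1) sub by (auto simp: set_sel)
    show ?thesis unfolding e using 1 2 3 PQ by (auto simp: set_sel cover_def)
  qed
qed


text \<open>\<open>distinct\<close> is demanded because in a tournament, which has no loops, two
  equal vertices would also satisfy a bit False.\<close>

definition pat_free :: "nat set \<Rightarrow> bool" where
  "pat_free X \<longleftrightarrow> \<not> (\<exists>vs. length vs = h \<and> distinct vs \<and> set vs \<subseteq> X \<and>
     (\<forall>j<h. \<forall>i<j. ((vs ! i, vs ! j) \<in> A) = pat j ! i))"

lemma dense_pair:
  assumes T: "tournament U A" and h: "h > 0" and pat: "\<And>j. j < h \<Longrightarrow> length (pat j) = j"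
    and free: "pat_free (set S)" and S: "distinct S" "set S \<subseteq> U" and z: "z \<ge> 1"
    and big: "8 * h * (2 * emb_at h) ^ h * z \<le> length S"
  obtains X Y where "dense_pair S = (X, Y)" "2 * z \<le> length X" "4 * z \<le> 2 * length Y"
    "distinct (X @ Y)" "set X \<union> set Y \<subseteq> set S"
    "\<And>x. x \<in> set X \<Longrightarrow> orient_at h * length (nb False x Y) \<le> length Y"
proof -
  let ?q = "emb_at h"
  let ?g = "\<lambda>j. every h (drop j S)"
  obtain h' where h': "h = Suc h'" using h by (cases h) auto
  define Ps where "Ps = map (\<lambda>j. (pat (Suc j), ?g (Suc j))) [0..<h']"
  have parts: "parts S = (pat 0, ?g 0) # Ps"
    unfolding parts_def Ps_def unfolding h' by (simp add: map_upt_Suc del: upt_Suc)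
  \<comment> \<open>Of the 8 in the size hypothesis, 4 goes into the bound \<open>4 * z\<close> for
    \<open>emb\<close>, and 2 absorbs the at most \<open>h - 1\<close> entries dropped before a
    residue class starts.\<close>
  have gbig: "(2 * ?q) ^ h * (4 * z) \<le> length (?g j)" if "j < h" for j
  proof -
    let ?M = "(2 * ?q) ^ h * (4 * z)"
    have "1 * 1 \<le> (2 * ?q) ^ h * (4 * z)"
      using emb_at_pos[OF h] z by (intro mult_le_mono one_le_power) auto
    then have "h \<le> h * ?M" by simp
    moreover have "2 * (h * ?M) \<le> length S" using big by (simp add: mult_ac)
    ultimately have "h * ?M \<le> length S - j" using that by linarith
    then have "h * ?M \<le> length (drop j S)" unfolding length_drop .
    also have "\<dots> \<le> h * length (?g j)" by (rule length_every[OF h])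
    finally show ?thesis using h by simp
  qed
  have len: "length Ps = h'" by (simp add: Ps_def)
  have Psj: "j < h' \<Longrightarrow> Ps ! j = (pat (Suc j), ?g (Suc j))" for j by (simp add: Ps_def)
  have dis: "distinct (concat (map ?g [0..<h]))"
    by (intro distinct_concat_map_upt distinct_every distinct_drop S) (auto dest: every_disjoint[OF S(1)])
  have "map ?g [0..<h] = ?g 0 # map snd Ps"
    unfolding Ps_def unfolding h' by (simp add: map_upt_Suc del: upt_Suc)
  then have dis': "distinct (?g 0 @ concat (map snd Ps))" using dis by simp
  have gsub: "set (?g j) \<subseteq> set S" for j using set_every set_drop_subset by fast
  have cov: "set (?g 0) \<union> cover Ps \<subseteq> set S" using gsub gsub[of 0] by (auto simp: cover_def Ps_def)
  have "realizes (?g 0) Ps \<or> (\<exists>b X Y. emb (?g 0) Ps Ps = (b, X, Y) \<and> 4 * z \<le> length X \<and> 4 * z \<le> length Y \<and>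
     distinct (X @ Y) \<and> set X \<union> set Y \<subseteq> set (?g 0) \<union> cover Ps \<and>
     (\<forall>x\<in>set X. emb_at h * length (nb b x Y) < length Y))"
  proof (rule emb_dense[OF T _ h, where Ds = "[]"])
    show "set (?g 0) \<union> cover Ps \<subseteq> U" using cov S by blast
    show "(2 * ?q) ^ Suc (length Ps) * (4 * z) \<le> length (snd P)" if P: "P \<in> set Ps" for P
    proof -
      obtain j where "j < h'" "P = (pat (Suc j), ?g (Suc j))" using P by (auto simp: Ps_def)
      then show ?thesis using gbig[of "Suc j"] len h' by simp
    qed
    show "length (fst (Ps ! j)) = Suc j" if "j < length Ps" for j
      using that Psj[of j] pat[of "Suc j"] len h' by simp
    have "2 ^ length Ps * ((?q + 1) * (4 * z)) \<le> (2 ^ h' * (2 * ?q ^ h)) * (4 * z)"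
    proof -
      have "1 * ?q \<le> ?q ^ h' * ?q"
        using emb_at_pos[OF h] by (intro mult_le_mono1 one_le_power)
      moreover have "?q ^ h = ?q ^ h' * ?q" by (simp add: h')
      ultimately have "?q + 1 \<le> 2 * ?q ^ h" using emb_at_pos[OF h] by linarith
      then have "2 ^ h' * (?q + 1) * (4 * z) \<le> 2 ^ h' * (2 * ?q ^ h) * (4 * z)"
        by (intro mult_le_mono1 mult_le_mono2)
      then show ?thesis by (simp only: len mult.assoc)
    qed
    also have "\<dots> = (2 * ?q) ^ h * (4 * z)" using h' by (simp add: power_mult_distrib)
    also have "\<dots> \<le> length (?g 0)" by (rule gbig[OF h])
    finally show "2 ^ length Ps * ((?q + 1) * (4 * z)) \<le> length (?g 0)" .
  qed (use z dis' in simp_all)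
  \<comment> \<open>The residue classes are disjoint, so a realization would consist of distinct
    vertices and be a copy of H.\<close>
  moreover have "\<not> realizes (?g 0) Ps"
  proof
    assume "realizes (?g 0) Ps"
    then obtain vs where vs: "length vs = h" "vs ! 0 \<in> set (?g 0)"
      "\<And>j. j < h' \<Longrightarrow> vs ! Suc j \<in> set (?g (Suc j)) \<and>
        (\<forall>i\<le>j. ((vs ! i, vs ! Suc j) \<in> A) = pat (Suc j) ! i)"
      unfolding realizes_def len using Psj h' by fastforce
    have mem: "vs ! j \<in> set (?g j)" if "j < h" for j
      using vs that h' by (cases j) auto
    have "distinct vs"
      unfolding distinct_conv_nth vs(1)
    proof (intro allI impI)
      fix i j assume ij: "i < h" "j < h" "i \<noteq> j"
      show "vs ! i \<noteq> vs ! j"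
        using mem[OF ij(1)] mem[OF ij(2)] every_disjoint[OF S(1) ij(1,2)] ij(3) by auto
    qed
    moreover have "set vs \<subseteq> set S"
    proof
      fix x assume "x \<in> set vs"
      then obtain j where "j < h" "x = vs ! j" using vs(1) by (auto simp: in_set_conv_nth)
      then show "x \<in> set S" using mem[of j] gsub[of j] by blast
    qed
    moreover have "((vs ! i, vs ! j) \<in> A) = pat j ! i" if "j < h" "i < j" for i j
      using vs(3)[of "j - 1"] that h' by (cases j) auto
    ultimately show False using free vs(1) unfolding pat_free_def by blast
  qed
  ultimately obtain b X Y where e: "emb (?g 0) Ps Ps = (b, X, Y)" and
     XY: "4 * z \<le> length X" "4 * z \<le> length Y" "distinct (X @ Y)" "set X \<union> set Y \<subseteq> set S"
     "\<And>x. x \<in> set X \<Longrightarrow> emb_at h * length (nb b x Y) < length Y"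
    using cov by blast
  have dp: "dense_pair S = orient (b, X, Y)" using e by (simp add: dense_pair_def parts)
  have eth2: "emb_at h = 2 * orient_at h" by (simp add: emb_at_def orient_at_def)
  show ?thesis
  proof (cases b)
    case False
    show ?thesis
    proof (rule that[of X Y])
      show "orient_at h * length (nb False x Y) \<le> length Y" if "x \<in> set X" for x
        using XY(5)[OF that] False eth2 by simp
    qed (use dp False XY in \<open>simp_all add: orient_def\<close>)
  next
    case True
    let ?X = "sel (orient_at h) True False X Y"
    \<comment> \<open>Since \<open>emb_at h = 2 * orient_at h\<close>, averaging discards at most
      half of \<open>Y\<close>; hence the start with \<open>4 * z\<close> for a bound of
      \<open>2 * z\<close>.\<close>
    have "X \<noteq> []" using XY(1) z by auto
    then have "emb_at h * length Y \<le> emb_at h * length ?X + orient_at h * length Y"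
      using XY(5) True by (intro markov_sel) (auto intro: less_imp_le)
    then have "orient_at h * length Y \<le> orient_at h * (2 * length ?X)" by (simp add: eth2)
    then have "length Y \<le> 2 * length ?X" using emb_at_pos[OF h] eth2 by simp
    then show ?thesis
      using dp True XY by (intro that[of ?X X]) (auto simp: orient_def set_sel)
  qed
qed

end

section \<open>Sequences of sets with few backward arcs\<close>

text \<open>The factor lost in one stage: h for the residue classes, \<open>2 * emb_at h\<close> for
  each vertex of H, and 8 to cover rounding, a reversal in \<open>orient\<close>, and
  \<open>restrict\<close>.\<close>

definition stage_loss :: "nat \<Rightarrow> nat" where "stage_loss h = 8 * h * (2 * emb_at h) ^ h"

context search
begin

lemma pat_free_mono: "pat_free X \<Longrightarrow> Y \<subseteq> X \<Longrightarrow> pat_free Y"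
  unfolding pat_free_def by blast

lemma nb_filter_le: "length (nb b w (filter Q X)) \<le> length (nb b w X)"
  unfolding nb_def by (induction X) auto

lemma sel_filter_le: "length (sel t c b W (filter Q X)) \<le> length (sel t c b W X)"
  unfolding sel_def by (induction X) auto

lemma prune_eq:
  "prune V zs = filter (\<lambda>v. \<forall>z\<in>set zs. prune_at h * length (nb False v (fst z)) < length (fst z) \<and>
     prune_at h * length (nb False v (snd z)) < length (snd z)) V"
proof (induction V zs rule: prune.induct)
  case (2 V P Ps)
  then show ?case unfolding prune.simps by (simp add: sel_def conj_ac)
qed simp

text \<open>The hypothesis and the loss refer to the whole of \<open>Y\<close> even if
  \<open>Y\<close> has already been filtered, so the losses of successive selections add up instead
  of compounding.\<close>

lemma sel_length:
  assumes X: "X \<noteq> []" and t: "\<And>x. x \<in> set X \<Longrightarrow> t * length (nb (\<not> b) x Y) \<le> length Y"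
  shows "t * length (filter Q Y) \<le> t * length (sel s True b X (filter Q Y)) + s * length Y"
proof -
  have "t * length Y \<le> t * length (sel s True b X Y) + s * length Y"
    by (rule markov_sel[OF X]) (rule t)
  moreover have "t * length Y = t * length (sel s True b X Y) + t * length (sel s False b X Y)"
    using length_sel_add[of s b X Y] by (metis distrib_left)
  moreover have "t * length (filter Q Y) =
      t * length (sel s True b X (filter Q Y)) + t * length (sel s False b X (filter Q Y))"
    using length_sel_add[of s b X "filter Q Y"] by (metis distrib_left)
  moreover have "t * length (sel s False b X (filter Q Y)) \<le> t * length (sel s False b X Y)"
    by (intro mult_le_mono2 sel_filter_le)
  ultimately show ?thesis by linarith
qed

lemma prune_length:
  assumes "\<And>z W. z \<in> set zs \<Longrightarrow> W = fst z \<or> W = snd z \<Longrightarrow>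
     W \<noteq> [] \<and> (\<forall>w\<in>set W. restrict_at h * length (nb True w Y) \<le> length Y)"
  shows "restrict_at h * length (filter Q Y) \<le>
     restrict_at h * length (prune (filter Q Y) zs) + 2 * length zs * (prune_at h * length Y)"
  using assms
proof (induction zs arbitrary: Q)
  case (Cons z zs)
  obtain Q1 where Q1: "sel (prune_at h) True False (fst z) (filter Q Y) = filter Q1 Y"
    by (simp add: sel_def)
  obtain Q2 where Q2: "sel (prune_at h) True False (snd z) (filter Q1 Y) = filter Q2 Y"
    by (simp add: sel_def)
  have "restrict_at h * length (filter Q Y) \<le> restrict_at h * length (filter Q1 Y) + prune_at h * length Y"
    unfolding Q1[symmetric] using Cons.prems[of z "fst z"] by (intro sel_length) auto
  moreover have "restrict_at h * length (filter Q1 Y) \<le> restrict_at h * length (filter Q2 Y) + prune_at h * length Y"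
    unfolding Q2[symmetric] using Cons.prems[of z "snd z"] by (intro sel_length) auto
  moreover have "restrict_at h * length (filter Q2 Y) \<le>
     restrict_at h * length (prune (filter Q2 Y) zs) + 2 * length zs * (prune_at h * length Y)"
    using Cons.prems by (intro Cons.IH) auto
  ultimately have "restrict_at h * length (filter Q Y) \<le> restrict_at h * length (prune (filter Q2 Y) zs) +
      (2 * (prune_at h * length Y) + 2 * length zs * (prune_at h * length Y))"
    by linarith
  then show ?case by (simp add: Q1 Q2 algebra_simps)
qed simp

text \<open>\<open>orient_at h\<close> is four times \<open>restrict_at h\<close>, so each of the
  two selections removes at most a quarter of \<open>Y\<close>. The bound for \<open>X\<close>
  serves for \<open>L\<close> too, because \<open>L\<close> is contained in
  \<open>X\<close>.\<close>

lemma restrict_length: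
  assumes r: "restrict_at h > 0" and X: "X \<noteq> []" "L \<noteq> []" "set L \<subseteq> set X"
    and s: "\<And>x. x \<in> set X \<Longrightarrow> orient_at h * length (nb False x Y) \<le> length Y"
  shows "length Y \<le> 2 * length (restrict X L Y)"
proof -
  obtain Q1 where Q1: "sel (restrict_at h) True True X Y = filter Q1 Y"
    by (simp add: sel_def)
  have "orient_at h * length (filter (\<lambda>_. True) Y) \<le> orient_at h * length (filter Q1 Y) + restrict_at h * length Y"
    using sel_length[OF X(1), of "orient_at h" True Y "\<lambda>_. True" "restrict_at h"] s Q1 by simp
  moreover have "orient_at h * length (filter Q1 Y) \<le> orient_at h * length (restrict X L Y) + restrict_at h * length Y"
    using sel_length[OF X(2), of "orient_at h" True Y Q1 "restrict_at h"] s X(3) Q1 by (auto simp: restrict_def)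
  ultimately have "orient_at h * length Y \<le> orient_at h * length (restrict X L Y) + 2 * (restrict_at h * length Y)"
    by simp
  then have "restrict_at h * (2 * length Y) \<le> restrict_at h * (4 * length (restrict X L Y))"
    by (simp add: orient_at_def)
  then show ?thesis using r by simp
qed

definition sparse :: "nat list \<Rightarrow> nat list \<Rightarrow> bool" where
  "sparse X Y \<longleftrightarrow> set X \<inter> set Y = {} \<and>
     (\<forall>x\<in>set X. prune_at h * length (nb False x Y) < length Y) \<and>
     (\<forall>y\<in>set Y. prune_at h * length (nb True y X) < length X)"

text \<open>The factors 2 in the conclusion are the loss by the final pruning. The set
  \<open>X\<close> in the existential clause is the one to which \<open>f\<close> was applied: the
  transitive component of a stage is at least half of the value of \<open>f\<close> at a set of size
  at least \<open>z\<close>. This is how growth of \<open>f\<close> will be transferred to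
  it.\<close>

lemma stages:
  assumes T: "tournament U A" and h: "h > 0" and pat: "\<And>j. j < h \<Longrightarrow> length (pat j) = j"
    and z: "z \<ge> 1"
    and f: "\<And>X. distinct X \<Longrightarrow> set X \<subseteq> U \<Longrightarrow> z \<le> length X \<Longrightarrow>
      distinct (f X) \<and> set (f X) \<subseteq> set X \<and> f X \<noteq> [] \<and> transitive_list (f X)"
    and "r \<le> 2 * h + 1" "distinct S" "set S \<subseteq> U" "pat_free (set S)" "stage_loss h ^ r * z \<le> length S"
  shows "length (stages f r S) = r \<and>
    (\<forall>p\<in>set (stages f r S). distinct (fst p) \<and> set (fst p) \<subseteq> set S \<and> z \<le> 2 * length (fst p) \<and>
       distinct (snd p) \<and> set (snd p) \<subseteq> set S \<and> transitive_list (snd p) \<and> snd p \<noteq> [] \<and>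
       (\<exists>X. distinct X \<and> set X \<subseteq> set S \<and> z \<le> length X \<and> length (f X) \<le> 2 * length (snd p))) \<and>
    sorted_wrt (\<lambda>p p'. \<forall>X\<in>{fst p, snd p}. \<forall>Y\<in>{fst p', snd p'}. sparse X Y) (stages f r S)"
  using assms(6-)
proof (induction r arbitrary: S)
  case (Suc r)
  have e: "emb_at h \<ge> 1" by (rule emb_at_pos[OF h])
  have gz: "1 \<le> stage_loss h ^ r * z"
    using h e z by (simp add: stage_loss_def)
  \<comment> \<open>The second bound makes up for the doubling of densities by pruning. The third
    keeps half of a set that is pruned against at most \<open>2 * h\<close> later stages with two
    sets each.\<close>
  have rp: "restrict_at h > 0" "2 * prune_at h \<le> restrict_at h" "2 * (2 * (2 * h) * prune_at h) \<le> restrict_at h"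
    using h by (simp_all add: restrict_at_def prune_at_def algebra_simps)
  obtain X Y where dp: "dense_pair S = (X, Y)" and X: "2 * (stage_loss h ^ r * z) \<le> length X"
    and Y: "4 * (stage_loss h ^ r * z) \<le> 2 * length Y"
    and XY: "distinct (X @ Y)" "set X \<union> set Y \<subseteq> set S"
    "\<And>x. x \<in> set X \<Longrightarrow> orient_at h * length (nb False x Y) \<le> length Y"
    by (rule dense_pair[OF T h pat Suc.prems(4,2,3) gz])
      (use Suc.prems(5) in \<open>simp_all add: stage_loss_def mult_ac\<close>)
  have "1 * z \<le> stage_loss h ^ r * z" using gz by (intro mult_le_mono1) (metis less_one mult_is_0 not_le)
  then have zX: "z \<le> length X" using X by linarith
  define L where "L = f X"
  have L: "distinct L" "set L \<subseteq> set X" "L \<noteq> []" "transitive_list L"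
    using f[of X] XY zX Suc.prems(3) unfolding L_def by auto
  define B where "B = restrict X L Y"
  define zs where "zs = stages f r B"
  have st: "stages f (Suc r) S = (prune X zs, prune L zs) # zs"
    by (simp add: dp Let_def zs_def B_def L_def)
  have Xne: "X \<noteq> []" using zX z by auto
  have B: "distinct B" "set B \<subseteq> set Y"
    "\<And>b. b \<in> set B \<Longrightarrow> restrict_at h * length (nb True b X) < length X \<and> restrict_at h * length (nb True b L) < length L"
    using XY(1) by (auto simp: B_def restrict_def set_sel)
  have "length Y \<le> 2 * length B"
    unfolding B_def by (rule restrict_length[OF rp(1) Xne L(3,2) XY(3)])
  then have "stage_loss h ^ r * z \<le> length B" using Y by linarith
  moreover have "set B \<subseteq> U" "set B \<subseteq> set S" using B(2) XY(2) Suc.prems(3) by auto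
  moreover have "pat_free (set B)"
    by (rule pat_free_mono[OF Suc.prems(4)]) fact
  ultimately have IH0: "length zs = r \<and>
    (\<forall>p\<in>set zs. distinct (fst p) \<and> set (fst p) \<subseteq> set B \<and> z \<le> 2 * length (fst p) \<and>
       distinct (snd p) \<and> set (snd p) \<subseteq> set B \<and> transitive_list (snd p) \<and> snd p \<noteq> [] \<and>
       (\<exists>X. distinct X \<and> set X \<subseteq> set B \<and> z \<le> length X \<and> length (f X) \<le> 2 * length (snd p))) \<and>
    sorted_wrt (\<lambda>p p'. \<forall>X\<in>{fst p, snd p}. \<forall>Y\<in>{fst p', snd p'}. sparse X Y) zs"
    unfolding zs_def using Suc.prems(1) B(1) by (intro Suc.IH) simp_all
  have IH: "length zs = r"
    "\<And>p. p \<in> set zs \<Longrightarrow> distinct (fst p) \<and> set (fst p) \<subseteq> set B \<and> z \<le> 2 * length (fst p) \<and>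
       distinct (snd p) \<and> set (snd p) \<subseteq> set B \<and> transitive_list (snd p) \<and> snd p \<noteq> [] \<and>
       (\<exists>X. distinct X \<and> set X \<subseteq> set B \<and> z \<le> length X \<and> length (f X) \<le> 2 * length (snd p))"
    "sorted_wrt (\<lambda>p p'. \<forall>X\<in>{fst p, snd p}. \<forall>Y\<in>{fst p', snd p'}. sparse X Y) zs"
    using IH0 by blast+
  have half: "length V \<le> 2 * length (prune V zs)" if V: "V = X \<or> V = L" for V
  proof -
    have eq: "filter (\<lambda>_. True) V = V" by simp
    have "restrict_at h * length (filter (\<lambda>_. True) V) \<le>
       restrict_at h * length (prune (filter (\<lambda>_. True) V) zs) + 2 * length zs * (prune_at h * length V)"
    proof (rule prune_length)
      fix p W assume p: "p \<in> set zs" "W = fst p \<or> W = snd p"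
      have "W \<noteq> []" using IH(2)[OF p(1)] p(2) z by auto
      moreover have "set W \<subseteq> set B" using IH(2)[OF p(1)] p(2) by auto
      ultimately show "W \<noteq> [] \<and> (\<forall>w\<in>set W. restrict_at h * length (nb True w V) \<le> length V)"
        using B(3) V by (auto intro!: less_imp_le)
    qed
    moreover have "2 * (2 * length zs * prune_at h) \<le> 2 * (2 * (2 * h) * prune_at h)"
      using IH(1) Suc.prems(1) by (intro mult_le_mono) auto
    then have "2 * (2 * length zs * prune_at h) * length V \<le> restrict_at h * length V"
      using rp(3) by (intro mult_le_mono1) linarith
    then have "2 * (2 * length zs * (prune_at h * length V)) \<le> restrict_at h * length V"
      by (simp only: mult_ac)
    ultimately have "restrict_at h * length V \<le> 2 * (restrict_at h * length (prune V zs))"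
      unfolding eq by linarith
    then have "restrict_at h * length V \<le> restrict_at h * (2 * length (prune V zs))"
      by (simp only: mult_ac)
    then show ?thesis using rp(1) by simp
  qed
  have sp: "sparse (prune V zs) W" if V: "V = X \<or> V = L" and p: "p \<in> set zs" and W: "W = fst p \<or> W = snd p"
    for V W p
  proof -
    have WB: "set W \<subseteq> set B" using IH(2)[OF p(1)] W by auto
    have sub: "set (prune V zs) \<subseteq> set V" by (auto simp: prune_eq)
    have "set V \<inter> set W = {}" using XY(1) L(2) V WB B(2) by auto
    moreover have "prune_at h * length (nb False v W) < length W" if "v \<in> set (prune V zs)" for v
      using that p W by (auto simp: prune_eq)
    \<comment> \<open>Pruning keeps at least half of \<open>V\<close>, so it at most doubles the
      density measured against it.\<close>
    moreover have "prune_at h * length (nb True w (prune V zs)) < length (prune V zs)" if "w \<in> set W" for w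
    proof -
      have "2 * prune_at h * length (nb True w (prune V zs)) \<le> restrict_at h * length (nb True w V)"
        unfolding prune_eq by (intro mult_le_mono rp nb_filter_le)
      also have "\<dots> < length V" using B(3)[of w] that WB V by auto
      also have "\<dots> \<le> 2 * length (prune V zs)" by (rule half[OF V])
      finally show ?thesis by simp
    qed
    ultimately show ?thesis using sub unfolding sparse_def by blast
  qed
  have n1: "prune L zs \<noteq> []" using half[of L] L(3) by auto
  have h1: "length X \<le> 2 * length (prune X zs)" "length L \<le> 2 * length (prune L zs)"
    using half by auto
  have pX: "distinct (prune X zs)" "set (prune X zs) \<subseteq> set S" "z \<le> 2 * length (prune X zs)"
    using XY h1(1) zX by (auto simp: prune_eq)
  have pL: "distinct (prune L zs)" "set (prune L zs) \<subseteq> set S" "transitive_list (prune L zs)"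
    using XY L by (auto simp: prune_eq transitive_list_def sorted_wrt_filter)
  have ex: "\<exists>X. distinct X \<and> set X \<subseteq> set S \<and> z \<le> length X \<and> length (f X) \<le> 2 * length (prune L zs)"
    using XY zX h1(2) by (intro exI[of _ X]) (auto simp: L_def)
  have BS: "set B \<subseteq> set S" using B(2) XY(2) by auto
  show ?case
    unfolding st
  proof (intro conjI)
    show "length ((prune X zs, prune L zs) # zs) = Suc r" using IH(1) by simp
    show "\<forall>p\<in>set ((prune X zs, prune L zs) # zs).
       distinct (fst p) \<and> set (fst p) \<subseteq> set S \<and> z \<le> 2 * length (fst p) \<and>
       distinct (snd p) \<and> set (snd p) \<subseteq> set S \<and> transitive_list (snd p) \<and> snd p \<noteq> [] \<and>
       (\<exists>X. distinct X \<and> set X \<subseteq> set S \<and> z \<le> length X \<and> length (f X) \<le> 2 * length (snd p))"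
    proof
      fix p assume "p \<in> set ((prune X zs, prune L zs) # zs)"
      then consider "p = (prune X zs, prune L zs)" | "p \<in> set zs" by auto
      then show "distinct (fst p) \<and> set (fst p) \<subseteq> set S \<and> z \<le> 2 * length (fst p) \<and>
       distinct (snd p) \<and> set (snd p) \<subseteq> set S \<and> transitive_list (snd p) \<and> snd p \<noteq> [] \<and>
       (\<exists>X. distinct X \<and> set X \<subseteq> set S \<and> z \<le> length X \<and> length (f X) \<le> 2 * length (snd p))"
      proof cases
        case 1
        then show ?thesis using pX pL n1 ex by simp
      next
        case 2
        then show ?thesis using IH(2)[OF 2] BS by (meson subset_trans)
      qed
    qed
    show "sorted_wrt (\<lambda>p p'. \<forall>X\<in>{fst p, snd p}. \<forall>Y\<in>{fst p', snd p'}. sparse X Y)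
      ((prune X zs, prune L zs) # zs)"
      unfolding sorted_wrt.simps using IH(3) sp by auto
  qed
qed simp

end

section \<open>Embedding a galaxy\<close>

text \<open>
  A galaxy on the positions \<open>{..<h}\<close> is encoded by the map \<open>c\<close> sending every position to the centre of its star, and
  singletons to themselves; \<open>p\<close> and \<open>p'\<close> span a backward arc iff \<open>c p = p'\<close> or \<open>c p' = p\<close>.
\<close>

definition centers :: "nat \<Rightarrow> (nat \<Rightarrow> nat) \<Rightarrow> nat set" where
  "centers h c = {c p |p. p < h \<and> c p \<noteq> p}"

text \<open>The second clause joins two properties of a galaxy: foreign centres are excluded by the
  galaxy condition, the centre of the same star because the star is a left or a right star.\<close>

definition star_map :: "nat \<Rightarrow> (nat \<Rightarrow> nat) \<Rightarrow> bool" where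
  "star_map h c \<longleftrightarrow> (\<forall>p<h. c p < h \<and> c (c p) = c p) \<and>
     (\<forall>x y z. x < z \<and> z < y \<and> y < h \<and> c x = c y \<and> c x \<noteq> x \<and> c y \<noteq> y \<longrightarrow> z \<notin> centers h c)"

text \<open>
  The stage that hosts a position: odd exactly for centres, and constant between consecutive centres.
\<close>

definition zone :: "nat \<Rightarrow> (nat \<Rightarrow> nat) \<Rightarrow> nat \<Rightarrow> nat" where
  "zone h c p = card {q \<in> centers h c. q < p} + card {q \<in> centers h c. q \<le> p}"

lemma star_map_less: "star_map h c \<Longrightarrow> p < h \<Longrightarrow> c p < h"
  and star_map_idem: "star_map h c \<Longrightarrow> p < h \<Longrightarrow> c (c p) = c p"
  unfolding star_map_def by blast+

lemma centers_bound: "star_map h c \<Longrightarrow> centers h c \<subseteq> {..<h}"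
  using star_map_less unfolding centers_def by blast

lemma finite_centers: "star_map h c \<Longrightarrow> finite (centers h c)"
  using centers_bound finite_subset by blast

lemma zone_mono:
  assumes "star_map h c" "p \<le> p'" shows "zone h c p \<le> zone h c p'"
  unfolding zone_def using assms finite_centers[OF assms(1)]
  by (intro add_mono card_mono) auto

lemma zone_odd:
  assumes "star_map h c" shows "odd (zone h c p) \<longleftrightarrow> p \<in> centers h c"
proof -
  have "{q \<in> centers h c. q \<le> p} = {q \<in> centers h c. q < p} \<union> (if p \<in> centers h c then {p} else {})"
    by (auto simp: order_le_less)
  moreover have "finite {q \<in> centers h c. q < p}" using finite_centers[OF assms] by simp
  ultimately have "card {q \<in> centers h c. q \<le> p} = card {q \<in> centers h c. q < p} + (if p \<in> centers h c then 1 else 0)"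
    by (simp add: card_Un_disjoint)
  then show ?thesis unfolding zone_def by simp
qed

lemma zone_strict:
  assumes c: "star_map h c" and p: "p < p'" and "p \<in> centers h c \<or> p' \<in> centers h c"
  shows "zone h c p < zone h c p'"
proof -
  have "zone h c p \<noteq> zone h c p'"
  proof
    assume e: "zone h c p = zone h c p'"
    let ?C = "centers h c"
    have fin: "finite {q \<in> ?C. q < p'}" "finite {q \<in> ?C. q \<le> p'}"
      using finite_centers[OF c] by simp_all
    have sub: "{q \<in> ?C. q < p} \<subseteq> {q \<in> ?C. q < p'}" "{q \<in> ?C. q \<le> p} \<subseteq> {q \<in> ?C. q \<le> p'}"
      using p by auto
    have "card {q \<in> ?C. q < p} = card {q \<in> ?C. q < p'}" "card {q \<in> ?C. q \<le> p} = card {q \<in> ?C. q \<le> p'}"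
      using e card_mono[OF fin(1) sub(1)] card_mono[OF fin(2) sub(2)] unfolding zone_def by linarith+
    then have "{q \<in> ?C. q < p} = {q \<in> ?C. q < p'}" "{q \<in> ?C. q \<le> p} = {q \<in> ?C. q \<le> p'}"
      using card_subset_eq[OF fin(1) sub(1)] card_subset_eq[OF fin(2) sub(2)] by simp_all
    moreover have "p \<in> {q \<in> ?C. q < p'} \<or> p' \<in> {q \<in> ?C. q \<le> p'}" using assms(3) p by auto
    moreover have "p \<notin> {q \<in> ?C. q < p}" "p' \<notin> {q \<in> ?C. q \<le> p}" using p by auto
    ultimately show False by blast
  qed
  then show ?thesis using zone_mono[OF c, of p p'] p by simp
qed

lemma zone_bound:
  assumes c: "star_map h c" shows "zone h c p < 2 * h + 1"
proof -
  have "{q \<in> centers h c. q < p} \<subseteq> {..<h}" "{q \<in> centers h c. q \<le> p} \<subseteq> {..<h}"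
    using centers_bound[OF c] by blast+
  then have "card {q \<in> centers h c. q < p} \<le> card {..<h}" "card {q \<in> centers h c. q \<le> p} \<le> card {..<h}"
    by (simp_all only: card_mono finite_lessThan)
  then show ?thesis unfolding zone_def by simp
qed

lemma leaf_not_center: "star_map h c \<Longrightarrow> c x \<noteq> x \<Longrightarrow> x \<notin> centers h c"
  using star_map_idem unfolding centers_def by blast

text \<open>No centre lies between the two leaves, so both counts agree; this is the form in which
  the galaxy condition is used.\<close>

lemma zone_leaves:
  assumes c: "star_map h c" and "x < h" "y < h" "c x = c y" "c x \<noteq> x" "c y \<noteq> y"
  shows "zone h c x = zone h c y"
proof -
  have *: "zone h c x = zone h c y" if xy: "x < y" "y < h" "c x = c y" "c x \<noteq> x" "c y \<noteq> y" for x y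
  proof -
    have "z \<notin> centers h c" if z: "x \<le> z" "z \<le> y" for z
    proof (cases "z = x \<or> z = y")
      case True
      then show ?thesis using leaf_not_center[OF c] xy(4,5) by blast
    next
      case False
      then have "x < z" "z < y" using z by auto
      then show ?thesis using c xy unfolding star_map_def by blast
    qed
    then have "(q \<in> centers h c \<and> q < x) = (q \<in> centers h c \<and> q < y)"
      "(q \<in> centers h c \<and> q \<le> x) = (q \<in> centers h c \<and> q \<le> y)" for q
      using \<open>x < y\<close> by (meson leI less_imp_le le_less_trans less_le_trans order_trans)+
    then show ?thesis by (simp add: zone_def)
  qed
  show ?thesis using *[of x y] *[of y x] assms by (metis nat_neq_iff)
qed

context search
begin

text \<open>A restriction is recorded as a list of signed vertices, the objects that
  \<open>explore\<close> enumerates.\<close>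

fun nbs :: "(bool \<times> nat) list \<Rightarrow> nat list \<Rightarrow> nat list" where
  "nbs [] X = X"
| "nbs (w # ws) X = nbs ws (nb (fst w) (snd w) X)"

lemma nbs_eq: "nbs ws X = filter (\<lambda>x. \<forall>w\<in>set ws. if fst w then (snd w, x) \<in> A else (x, snd w) \<in> A) X"
proof (induction ws X rule: nbs.induct)
  case (2 w ws X)
  then show ?case by (simp add: nb_def conj_commute)
qed simp

lemma set_nbs: "set (nbs ws X) = {x \<in> set X. \<forall>w\<in>set ws. if fst w then (snd w, x) \<in> A else (x, snd w) \<in> A}"
  by (simp add: nbs_eq)

lemma nbs_append: "nbs (ws @ ws') X = nbs ws' (nbs ws X)"
  by (induction ws X rule: nbs.induct) auto

lemma distinct_nbs: "distinct X \<Longrightarrow> distinct (nbs ws X)"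
  by (induction ws X rule: nbs.induct) auto

lemma nb_compl:
  assumes T: "tournament V A" and v: "v \<in> V" "v \<notin> set X" and X: "set X \<subseteq> V"
  shows "length X = length (nb b v X) + length (nb (\<not> b) v X)"
proof -
  have "nb (\<not> b) v X = filter (\<lambda>x. \<not> (if b then (v, x) \<in> A else (x, v) \<in> A)) X"
    unfolding nb_def
  proof (intro filter_cong refl)
    fix x assume "x \<in> set X"
    then have "x \<in> V" "v \<noteq> x" using X v by auto
    then show "(if \<not> b then (v, x) \<in> A else (x, v) \<in> A) = (\<not> (if b then (v, x) \<in> A else (x, v) \<in> A))"
      using tournament_asym[OF T] tournament_total[OF T v(1) \<open>x \<in> V\<close>] by auto
  qed
  then show ?thesis unfolding nb_def by (simp add: sum_length_filter_compl)
qed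

lemma nbs_length:
  assumes T: "tournament V A" and Y: "set Y \<subseteq> V"
    and w: "\<And>w. w \<in> set ws \<Longrightarrow> snd w \<in> V \<and> snd w \<notin> set Y \<and>
       t * length (nb (\<not> fst w) (snd w) Y) \<le> length Y"
  shows "t * length (filter Q Y) \<le> t * length (nbs ws (filter Q Y)) + length ws * length Y"
  using w
proof (induction ws arbitrary: Q)
  case (Cons w ws)
  obtain Q1 where Q1: "nb (fst w) (snd w) (filter Q Y) = filter Q1 Y"
    by (simp add: nb_def)
  have "length (filter Q Y) = length (filter Q1 Y) + length (nb (\<not> fst w) (snd w) (filter Q Y))"
    unfolding Q1[symmetric] using Cons.prems[of w] Y by (intro nb_compl[OF T]) auto
  then have "t * length (filter Q Y) = t * length (filter Q1 Y) + t * length (nb (\<not> fst w) (snd w) (filter Q Y))"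
    by (metis distrib_left)
  moreover have "t * length (nb (\<not> fst w) (snd w) (filter Q Y)) \<le> t * length (nb (\<not> fst w) (snd w) Y)"
    by (intro mult_le_mono2 nb_filter_le)
  moreover have "t * length (nb (\<not> fst w) (snd w) Y) \<le> length Y" using Cons.prems[of w] by simp
  moreover have "t * length (filter Q1 Y) \<le> t * length (nbs ws (filter Q1 Y)) + length ws * length Y"
    using Cons.prems by (intro Cons.IH) auto
  ultimately have "t * length (filter Q Y) \<le> t * length (nbs ws (filter Q1 Y)) + (length Y + length ws * length Y)"
    by linarith
  then show ?case by (simp add: Q1)
qed simp

text \<open>
  The elements of a transitive list strictly between two of its members are cut out by two neighbourhoods.
\<close>

definition chunk :: "nat \<Rightarrow> nat list \<Rightarrow> (bool \<times> nat) list" where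
  "chunk q Y = [(True, Y ! (q * (length Y div (h + 1)))), (False, Y ! ((q + 1) * (length Y div (h + 1))))]"

text \<open>Steps of \<open>length Y div (h + 1)\<close> leave a right end point even for the last
  chunk, \<open>q = h - 1\<close>. Rounding and the excluded end points cost a chunk at most 2
  entries relative to \<open>length Y / (h + 1)\<close>, which is at most a quarter of it by the
  lower bound on \<open>length Y\<close>.\<close>

lemma chunk:
  assumes T: "tournament V A" and Y: "transitive_list Y" "distinct Y" "8 * (h + 1) \<le> length Y" and q: "q < h"
  shows "x \<in> set (nbs (chunk q Y) Y) \<longleftrightarrow>
      (\<exists>i. q * (length Y div (h + 1)) < i \<and> i < (q + 1) * (length Y div (h + 1)) \<and> x = Y ! i \<and> i < length Y)"
    and "3 * length Y \<le> 4 * (h + 1) * length (nbs (chunk q Y) Y)"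
    and "set (map snd (chunk q Y)) \<subseteq> set Y"
proof -
  define s where "s = length Y div (h + 1)"
  have sl: "s * (h + 1) \<le> length Y" unfolding s_def by (metis div_times_less_eq_dividend)
  have s8: "8 \<le> s" unfolding s_def using Y(3) by (metis div_le_mono nonzero_mult_div_cancel_right add_is_0 one_neq_zero)
  have "(q + 1) * s \<le> h * s" using q by (intro mult_le_mono1) simp
  moreover have "s * (h + 1) = h * s + s" by simp
  ultimately have b: "(q + 1) * s < length Y" using sl s8 by linarith
  then have a: "q * s < length Y" by simp
  have irr: "(x, x) \<notin> A" for x using T by (auto simp: tournament_def irrefl_def)
  have arc: "(Y ! i, Y ! j) \<in> A \<longleftrightarrow> i < j" if "i < length Y" "j < length Y" for i j
    using Y(1) that irr tournament_asym[OF T] unfolding transitive_list_def sorted_wrt_iff_nth_less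
    by (metis nat_neq_iff)
  have st: "x \<in> set (nbs (chunk q Y) Y) \<longleftrightarrow> (\<exists>i. q * s < i \<and> i < (q + 1) * s \<and> x = Y ! i \<and> i < length Y)" for x
  proof -
    have "x \<in> set (nbs (chunk q Y) Y) \<longleftrightarrow> x \<in> set Y \<and> (Y ! (q * s), x) \<in> A \<and> (x, Y ! ((q + 1) * s)) \<in> A"
      by (auto simp: set_nb chunk_def s_def)
    also have "\<dots> \<longleftrightarrow> (\<exists>i<length Y. x = Y ! i \<and> q * s < i \<and> i < (q + 1) * s)"
      using arc[OF a] arc[OF _ b] by (auto simp: in_set_conv_nth)
    finally show ?thesis by blast
  qed
  then show "x \<in> set (nbs (chunk q Y) Y) \<longleftrightarrow>
      (\<exists>i. q * (length Y div (h + 1)) < i \<and> i < (q + 1) * (length Y div (h + 1)) \<and> x = Y ! i \<and> i < length Y)"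
    by (simp add: s_def)
  have "(!) Y ` {q * s<..<(q + 1) * s} \<subseteq> set (nbs (chunk q Y) Y)"
  proof
    fix x assume "x \<in> (!) Y ` {q * s<..<(q + 1) * s}"
    then obtain i where "q * s < i" "i < (q + 1) * s" "x = Y ! i" by auto
    moreover from this b have "i < length Y" by linarith
    ultimately show "x \<in> set (nbs (chunk q Y) Y)" using st by blast
  qed
  then have "card ((!) Y ` {q * s<..<(q + 1) * s}) \<le> length (nbs (chunk q Y) Y)"
    by (meson List.finite_set card_length card_mono order_trans)
  moreover have "inj_on ((!) Y) {q * s<..<(q + 1) * s}"
    using b Y(2) by (auto intro!: inj_on_nth)
  ultimately have l: "s \<le> Suc (length (nbs (chunk q Y) Y))" by (auto simp: card_image)
  have "length Y < (h + 1) * (s + 1)"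
    unfolding s_def using dividend_less_div_times[of "h + 1" "length Y"] by (simp add: algebra_simps)
  also have "\<dots> \<le> (h + 1) * (length (nbs (chunk q Y) Y) + 2)" using l by (intro mult_le_mono2) simp
  finally show "3 * length Y \<le> 4 * (h + 1) * length (nbs (chunk q Y) Y)"
    using Y(3) by (simp add: algebra_simps)
  show "set (map snd (chunk q Y)) \<subseteq> set Y"
    unfolding chunk_def s_def[symmetric] using nth_mem[OF a] nth_mem[OF b] by simp
qed

lemma chunk_lt:
  assumes T: "tournament V A" and Y: "transitive_list Y" "distinct Y" "8 * (h + 1) \<le> length Y" and q: "q < q'" "q' < h"
    and "x \<in> set (nbs (chunk q Y) Y)" "y \<in> set (nbs (chunk q' Y) Y)"
  shows "(x, y) \<in> A"
proof -
  let ?s = "length Y div (h + 1)"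
  obtain i where i: "i < (q + 1) * ?s" "x = Y ! i"
    using chunk(1)[OF T Y, of q x] assms by auto
  obtain j where j: "q' * ?s < j" "y = Y ! j" "j < length Y"
    using chunk(1)[OF T Y, of q' y] assms by auto
  have "(q + 1) * ?s \<le> q' * ?s" using q by (intro mult_le_mono1) simp
  then have "i < j" using i j by linarith
  then show ?thesis using i j sorted_wrt_nth_less[OF Y(1)[unfolded transitive_list_def], of i j] by simp
qed


definition placed :: "(nat \<Rightarrow> nat) \<Rightarrow> (nat \<Rightarrow> nat) \<Rightarrow> nat \<Rightarrow> nat \<Rightarrow> bool" where
  "placed c \<psi> p p' \<longleftrightarrow> (if c p = p' \<or> c p' = p then (\<psi> p', \<psi> p) \<in> A else (\<psi> p, \<psi> p') \<in> A)"

text \<open>Stars are embedded one after the other. If a centre cannot be chosen, then for every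
  candidate centre some leaf has only wrong arcs, and by averaging one leaf is to blame for a
  fraction \<open>1 / (2 * h)\<close> of the whole set \<open>U i\<close> of the centre. The
  hypothesis \<open>nb\<close> excludes exactly this, so its failure is what later provides the set
  \<open>P\<close>.\<close>

lemma star_embedding:
  assumes T: "tournament V A" and h: "h > 0" and c: "star_map h c"
    and sp: "\<And>i j. i < j \<Longrightarrow> j < 2 * h + 1 \<Longrightarrow> sparse (U i) (U j)"
    and U: "\<And>i. i < 2 * h + 1 \<Longrightarrow> distinct (U i) \<and> set (U i) \<subseteq> V \<and> U i \<noteq> []"
    and Ue: "\<And>i. i < 2 * h + 1 \<Longrightarrow> even i \<Longrightarrow> transitive_list (U i) \<and> 8 * (h + 1) \<le> length (U i)"
    and nb: "\<And>i j ws b. i < 2 * h + 1 \<Longrightarrow> odd i \<Longrightarrow> j < 2 * h + 1 \<Longrightarrow> even j \<Longrightarrow> length ws \<le> h + 2 \<Longrightarrow>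
       set (map snd ws) \<subseteq> (\<Union>i<2 * h + 1. set (U i)) \<Longrightarrow>
       length (U j) \<le> 2 * (h + 1) * length (nbs ws (U j)) \<Longrightarrow>
       2 * h * length (filter (\<lambda>v. \<forall>x\<in>set (nbs ws (U j)). if b then (x, v) \<in> A else (v, x) \<in> A) (U i)) < length (U i)"
  shows "\<exists>\<psi>. (\<forall>p<h. \<psi> p \<in> set (U (zone h c p))) \<and> (\<forall>p' p. p < p' \<longrightarrow> p' < h \<longrightarrow> placed c \<psi> p p')"
proof -
  let ?z = "zone h c"
  \<comment> \<open>The chunk is numbered by the position itself, so positions in one zone use
    distinct chunks in the right order.\<close>
  define bw where "bw p = (if p \<in> centers h c then [] else chunk p (U (?z p)))" for p
  have zb: "?z p < 2 * h + 1" for p by (rule zone_bound[OF c])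
  have Uz: "distinct (U (?z p))" "set (U (?z p)) \<subseteq> V" "U (?z p) \<noteq> []" for p
    using U[OF zb] by auto
  have ev: "transitive_list (U (?z p))" "8 * (h + 1) \<le> length (U (?z p))" if "p \<notin> centers h c" for p
    using Ue[OF zb, of p] zone_odd[OF c, of p] that by auto
  have disj: "set (U (?z p)) \<inter> set (U (?z p')) = {}" if "?z p \<noteq> ?z p'" for p p'
    using sp[OF _ zb, of "?z p" p'] sp[OF _ zb, of "?z p'" p] that unfolding sparse_def
    by (cases "?z p < ?z p'") auto
  have samez: "p \<notin> centers h c \<and> p' \<notin> centers h c" if "?z p = ?z p'" "p \<noteq> p'" for p p'
    using zone_strict[OF c, of p p'] zone_strict[OF c, of p' p] that by (cases "p < p'") auto
  have same_zone: "(x, y) \<in> A" if "?z p = ?z p'" "p < p'" "p' < h" "x \<in> set (nbs (bw p) (U (?z p)))"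
    "y \<in> set (nbs (bw p') (U (?z p')))" for p p' x y
  proof -
    have n: "p \<notin> centers h c" "p' \<notin> centers h c" using samez[OF that(1)] that(2) by auto
    show ?thesis
      using chunk_lt[OF T ev(1)[OF n(1)] Uz(1) ev(2)[OF n(1)] that(2,3)] that n by (simp add: bw_def)
  qed
  \<comment> \<open>Induction over the set of embedded stars, each given by its root, the fixed
    point of \<open>c\<close>; a singleton is its own root.\<close>
  have roots: "\<exists>\<psi>. (\<forall>p<h. c p \<in> F \<longrightarrow> \<psi> p \<in> set (nbs (bw p) (U (?z p)))) \<and>
      (\<forall>p p'. p < p' \<longrightarrow> p' < h \<longrightarrow> c p \<in> F \<longrightarrow> c p' \<in> F \<longrightarrow> placed c \<psi> p p')"
    if "finite F" "F \<subseteq> {r. r < h \<and> c r = r}" for F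
    using that
  proof (induction F rule: finite_induct)
    case (insert r F)
    have r: "r < h" "c r = r" "r \<notin> F" using insert by auto
    obtain \<psi> where base: "\<And>p. p < h \<Longrightarrow> c p \<in> F \<Longrightarrow> \<psi> p \<in> set (nbs (bw p) (U (?z p)))"
      and pl: "\<And>p p'. p < p' \<Longrightarrow> p' < h \<Longrightarrow> c p \<in> F \<Longrightarrow> c p' \<in> F \<Longrightarrow> placed c \<psi> p p'"
      using insert.IH insert.prems by auto
    \<comment> \<open>Only vertices in other zones restrict the candidates; inside a zone the order
      of the chunks already provides the forward arcs.\<close>
    define ws where "ws p = map (\<lambda>p'. (p' < p, \<psi> p')) (filter (\<lambda>p'. c p' \<in> F \<and> ?z p' \<noteq> ?z p) [0..<h])" for p
    define cd where "cd p = nbs (bw p @ ws p) (U (?z p))" for p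
    have inU: "\<psi> p \<in> set (U (?z p))" if "p < h" "c p \<in> F" for p
      using base[OF that] by (auto simp: set_nbs)
    have wsl: "length (ws p) \<le> h" for p
      unfolding ws_def using length_filter_le[of "\<lambda>p'. c p' \<in> F \<and> ?z p' \<noteq> ?z p" "[0..<h]"] by simp
    \<comment> \<open>At most h placed vertices each exclude at most a \<open>1 / prune_at h\<close>
      fraction, in total \<open>1 / (4 * (h + 1))\<close> of the stage. This is the origin of
      \<open>prune_at\<close>.\<close>
    have cdl: "prune_at h * length (nbs (bw p) (U (?z p))) \<le> prune_at h * length (cd p) + h * length (U (?z p))" for p
    proof -
      obtain Q where Q: "nbs (bw p) (U (?z p)) = filter Q (U (?z p))"
        by (simp add: nbs_eq)
      have "prune_at h * length (filter Q (U (?z p))) \<le> prune_at h * length (nbs (ws p) (filter Q (U (?z p)))) + length (ws p) * length (U (?z p))"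
      proof (rule nbs_length[OF T Uz(2)])
        fix w assume "w \<in> set (ws p)"
        then obtain p' where p': "w = (p' < p, \<psi> p')" "p' < h" "c p' \<in> F" "?z p' \<noteq> ?z p" by (auto simp: ws_def)
        have m: "\<psi> p' \<in> set (U (?z p'))" by (rule inU[OF p'(2,3)])
        have "prune_at h * length (nb (\<not> p' < p) (\<psi> p') (U (?z p))) < length (U (?z p))"
        proof (cases "p' < p")
          case True
          then have "?z p' < ?z p" using zone_mono[OF c, of p' p] p'(4) by simp
          then show ?thesis using sp[OF _ zb] m True unfolding sparse_def by auto
        next
          case False
          then have "?z p < ?z p'" using zone_mono[OF c, of p p'] p'(4) by simp
          then show ?thesis using sp[OF _ zb] m False unfolding sparse_def by auto
        qed
        then show "snd w \<in> V \<and> snd w \<notin> set (U (?z p)) \<and> prune_at h * length (nb (\<not> fst w) (snd w) (U (?z p))) \<le> length (U (?z p))"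
          using p' m Uz(2)[of p'] disj[OF p'(4)] by auto
      qed
      also have "\<dots> \<le> prune_at h * length (nbs (ws p) (filter Q (U (?z p)))) + h * length (U (?z p))"
        using wsl by (intro add_left_mono mult_le_mono1)
      finally show ?thesis by (simp add: cd_def nbs_append Q)
    qed
    have cdc: "length (U (?z p)) \<le> 2 * length (cd p)" if "p \<in> centers h c" for p
    proof -
      have "4 * h * (h + 1) * length (U (?z p)) \<le> 4 * h * (h + 1) * length (cd p) + h * length (U (?z p))"
        using cdl[of p] that by (simp add: bw_def prune_at_def)
      then have "h * (4 * (h + 1) * length (U (?z p))) \<le> h * (4 * (h + 1) * length (cd p) + length (U (?z p)))"
        by (simp only: mult_ac distrib_left)
      then have "4 * (h + 1) * length (U (?z p)) \<le> 4 * (h + 1) * length (cd p) + length (U (?z p))"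
        using h by simp
      moreover have "length (U (?z p)) \<le> (h + 1) * length (U (?z p))" by simp
      ultimately have "(h + 1) * length (U (?z p)) \<le> (h + 1) * (2 * length (cd p))" by linarith
      then show ?thesis by (metis add_gr_0 mult_le_cancel1 zero_less_one)
    qed
    \<comment> \<open>Three quarters of \<open>1 / (h + 1)\<close> come from the chunk, and one
      quarter of it is lost to placed vertices.\<close>
    have cdn: "length (U (?z p)) \<le> 2 * (h + 1) * length (cd p)" if "p \<notin> centers h c" "p < h" for p
    proof -
      have "h * (4 * (h + 1) * length (nbs (bw p) (U (?z p)))) \<le> h * (4 * (h + 1) * length (cd p) + length (U (?z p)))"
        using cdl[of p] by (simp only: prune_at_def mult_ac distrib_left)
      then have "4 * (h + 1) * length (nbs (bw p) (U (?z p))) \<le> 4 * (h + 1) * length (cd p) + length (U (?z p))"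
        using h by simp
      moreover have "3 * length (U (?z p)) \<le> 4 * (h + 1) * length (nbs (bw p) (U (?z p)))"
        using chunk(2)[OF T ev(1)[OF that(1)] Uz(1) ev(2)[OF that(1)] that(2)] that by (simp add: bw_def)
      ultimately show ?thesis by linarith
    qed
    have cdne: "cd p \<noteq> []" if "p < h" for p
      using cdc[of p] cdn[of p] Uz(3)[of p] that by (cases "p \<in> centers h c") auto
    define Lf where "Lf = {l. l < h \<and> c l = r \<and> l \<noteq> r}"
    \<comment> \<open>A backward neighbour for each leaf may be chosen separately, since the leaves
      of one star sit in different chunks of one transitive list.\<close>
    have "\<exists>v\<in>set (cd r). \<forall>l\<in>Lf. \<exists>x\<in>set (cd l). if l < r then (v, x) \<in> A else (x, v) \<in> A"
    proof (rule ccontr)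
      assume neg: "\<not> ?thesis"
      obtain v where "v \<in> set (cd r)" using cdne[OF r(1)] by (cases "cd r") auto
      \<comment> \<open>Without leaves any candidate would do, so a failure concerns a genuine
        centre.\<close>
      then have Lne: "Lf \<noteq> {}" using neg by auto
      then have rc: "r \<in> centers h c" by (auto simp: Lf_def centers_def)
      define bad where "bad l = filter (\<lambda>v. \<forall>x\<in>set (cd l). if l < r then (x, v) \<in> A else (v, x) \<in> A) (U (?z r))" for l
      have Lz: "l \<notin> centers h c" "?z l \<noteq> ?z r" "l < h" if "l \<in> Lf" for l
        using that leaf_not_center[OF c, of l] zone_odd[OF c, of l] zone_odd[OF c, of r] rc
        by (auto simp: Lf_def)
      have sub: "set (cd r) \<subseteq> (\<Union>l\<in>Lf. set (bad l))"
      proof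
        fix v assume v: "v \<in> set (cd r)"
        then obtain l where l: "l \<in> Lf" "\<not> (\<exists>x\<in>set (cd l). if l < r then (v, x) \<in> A else (x, v) \<in> A)"
          using neg by blast
        have vU: "v \<in> set (U (?z r))" using v by (auto simp: cd_def set_nbs)
        have "if l < r then (x, v) \<in> A else (v, x) \<in> A" if "x \<in> set (cd l)" for x
        proof -
          have xU: "x \<in> set (U (?z l))" using that by (auto simp: cd_def set_nbs)
          then have "x \<noteq> v" using disj[OF Lz(2)[OF l(1)]] vU by auto
          then show ?thesis using tournament_total[OF T, of x v] xU vU Uz(2) l(2) that by (auto split: if_splits)
        qed
        then have "v \<in> set (bad l)" using vU by (auto simp: bad_def)
        then show "v \<in> (\<Union>l\<in>Lf. set (bad l))" using l(1) by blast
      qed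
      have finL: "finite Lf" "card Lf \<le> h"
      proof -
        have "Lf \<subseteq> {..<h}" by (auto simp: Lf_def)
        then show "finite Lf" "card Lf \<le> h" using finite_subset card_mono[of "{..<h}" Lf] by auto
      qed
      \<comment> \<open>The sets \<open>bad l\<close> cover \<open>cd r\<close>, which is at least
        half of the stage, while each of the at most h of them is smaller than
        \<open>1 / (2 * h)\<close> of it.\<close>
      have "distinct (cd r)" unfolding cd_def by (intro distinct_nbs Uz)
      then have "length (cd r) = card (set (cd r))" by (simp add: distinct_card)
      also have "\<dots> \<le> card (\<Union>l\<in>Lf. set (bad l))" using finL by (intro card_mono sub) auto
      also have "\<dots> \<le> (\<Sum>l\<in>Lf. card (set (bad l)))" by (rule card_UN_le[OF finL(1)])
      also have "\<dots> \<le> (\<Sum>l\<in>Lf. length (bad l))" by (intro sum_mono card_length)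
      finally have "2 * h * length (cd r) \<le> 2 * h * (\<Sum>l\<in>Lf. length (bad l))" by (rule mult_le_mono2)
      also have "\<dots> = (\<Sum>l\<in>Lf. 2 * h * length (bad l))" by (rule sum_distrib_left)
      also have "\<dots> < (\<Sum>l\<in>Lf. length (U (?z r)))"
      proof (rule sum_strict_mono[OF finL(1) Lne])
        fix l assume l: "l \<in> Lf"
        have sn: "set (map snd (bw l @ ws l)) \<subseteq> (\<Union>i<2 * h + 1. set (U i))"
        proof -
          have "set (map snd (bw l)) \<subseteq> set (U (?z l))"
            using chunk(3)[OF T ev(1)[OF Lz(1)[OF l]] Uz(1) ev(2)[OF Lz(1)[OF l]] Lz(3)[OF l]] Lz(1)[OF l]
            by (simp add: bw_def)
          moreover have "set (map snd (ws l)) \<subseteq> (\<Union>i<2 * h + 1. set (U i))"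
            using inU zb by (fastforce simp: ws_def)
          ultimately show ?thesis using zb[of l] by auto
        qed
        have "length (bw l @ ws l) \<le> h + 2" using wsl[of l] by (simp add: bw_def chunk_def)
        then show "2 * h * length (bad l) < length (U (?z r))"
          unfolding bad_def cd_def
          using nb[OF zb _ zb _ _ sn, of r l "l < r"] cdn[OF Lz(1)[OF l] Lz(3)[OF l]] zone_odd[OF c, of r] zone_odd[OF c, of l]
            rc Lz(1)[OF l] by (simp add: cd_def)
      qed
      also have "\<dots> \<le> h * length (U (?z r))" using finL(2) by simp
      also have "\<dots> \<le> h * (2 * length (cd r))" by (intro mult_le_mono2 cdc[OF rc])
      finally show False by simp
    qed
    then obtain v x where v: "v \<in> set (cd r)"
      and x: "\<And>l. l \<in> Lf \<Longrightarrow> x l \<in> set (cd l) \<and> (if l < r then (v, x l) \<in> A else (x l, v) \<in> A)"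
      by metis
    define \<phi> where "\<phi> p = (if p = r then v else if c p = r then x p else \<psi> p)" for p
    have \<phi>cd: "\<phi> p \<in> set (cd p)" if "p < h" "c p = r" for p
      using v x[of p] that by (auto simp: \<phi>_def Lf_def)
    have \<phi>old: "\<phi> p = \<psi> p" if "c p \<in> F" for p
      using that r by (auto simp: \<phi>_def)
    have cd_base: "set (cd p) \<subseteq> set (nbs (bw p) (U (?z p)))" for p by (auto simp: cd_def nbs_append set_nbs)
    have \<phi>base: "\<phi> p \<in> set (nbs (bw p) (U (?z p)))" if "p < h" "c p \<in> insert r F" for p
      using that \<phi>cd[of p] \<phi>old[of p] base[of p] cd_base[of p] by auto
    have mixed: "if p < q then (\<phi> p, \<phi> q) \<in> A else (\<phi> q, \<phi> p) \<in> A"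
      if "p < h" "c p = r" "q < h" "c q \<in> F" for p q
    proof (cases "?z p = ?z q")
      case True
      have "p \<noteq> q" using that r by auto
      then show ?thesis using same_zone[OF True _ that(3) \<phi>base \<phi>base] same_zone[OF True[symmetric] _ that(1) \<phi>base \<phi>base]
        that by auto
    next
      case False
      have "(q < p, \<psi> q) \<in> set (ws p)" using that False by (auto simp: ws_def)
      moreover have "\<forall>w\<in>set (bw p @ ws p). if fst w then (snd w, \<phi> p) \<in> A else (\<phi> p, snd w) \<in> A"
        using \<phi>cd[OF that(1,2)] by (simp add: cd_def set_nbs)
      ultimately have "if q < p then (\<psi> q, \<phi> p) \<in> A else (\<phi> p, \<psi> q) \<in> A"
        by (metis UnCI fst_conv set_append snd_conv)
      moreover have "p \<noteq> q" using that r by auto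
      ultimately show ?thesis using \<phi>old[OF that(4)] by (auto split: if_splits)
    qed
    have "placed c \<phi> p p'" if pp: "p < p'" "p' < h" "c p \<in> insert r F" "c p' \<in> insert r F" for p p'
    proof -
      have ph: "p < h" using pp by simp
      consider "c p \<in> F" "c p' \<in> F" | "c p = r" "c p' \<in> F" | "c p \<in> F" "c p' = r" | "c p = r" "c p' = r"
        using pp by auto
      then show ?thesis
      proof cases
        case 1
        then show ?thesis using pl[OF pp(1,2)] \<phi>old by (simp add: placed_def)
      next
        case 2
        have "\<not> (c p = p' \<or> c p' = p)"
          using 2 r star_map_idem[OF c ph] star_map_idem[OF c pp(2)] by auto
        then show ?thesis using mixed[OF ph 2(1) pp(2) 2(2)] pp(1) by (simp add: placed_def)
      next
        case 3
        have "\<not> (c p = p' \<or> c p' = p)"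
          using 3 r star_map_idem[OF c ph] star_map_idem[OF c pp(2)] by auto
        then show ?thesis using mixed[OF pp(2) 3(2) ph 3(1)] pp(1) by (simp add: placed_def)
      next
        case 4
        consider "p = r" | "p' = r" | "p \<noteq> r" "p' \<noteq> r" by blast
        then show ?thesis
        proof cases
          case 1
          then have "p' \<in> Lf" "p' \<noteq> r" using 4 pp by (simp_all add: Lf_def)
          then show ?thesis using x[of p'] 1 4 pp(1) by (simp add: placed_def \<phi>_def)
        next
          case 2
          then have "p \<in> Lf" "p \<noteq> r" using 4 pp(1) ph by (simp_all add: Lf_def)
          then show ?thesis using x[of p] 2 4 pp(1) by (simp add: placed_def \<phi>_def)
        next
          case 3
          \<comment> \<open>Two leaves of one star share a zone by the galaxy condition, and the
            order of the chunks makes their arc forward.\<close>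
          have "?z p = ?z p'" using 3 4 zone_leaves[OF c ph pp(2)] by simp
          then have "(\<phi> p, \<phi> p') \<in> A"
            using same_zone[OF _ pp(1,2) \<phi>base[OF ph pp(3)] \<phi>base[OF pp(2,4)]] by blast
          then show ?thesis using 3 4 by (simp add: placed_def)
        qed
      qed
    qed
    then show ?case using \<phi>base by blast
  qed simp
  have "finite {r. r < h \<and> c r = r}" by simp
  from roots[OF this order.refl] obtain \<psi> where
    \<psi>: "\<And>p. p < h \<Longrightarrow> c p \<in> {r. r < h \<and> c r = r} \<Longrightarrow> \<psi> p \<in> set (nbs (bw p) (U (?z p)))"
    "\<And>p p'. p < p' \<Longrightarrow> p' < h \<Longrightarrow> c p \<in> {r. r < h \<and> c r = r} \<Longrightarrow> c p' \<in> {r. r < h \<and> c r = r} \<Longrightarrow> placed c \<psi> p p'"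
    by blast
  have root: "c p \<in> {r. r < h \<and> c r = r}" if "p < h" for p
    using star_map_less[OF c that] star_map_idem[OF c that] by simp
  show ?thesis
  proof (intro exI conjI allI impI)
    show "\<psi> p \<in> set (U (?z p))" if "p < h" for p using \<psi>(1)[OF that root[OF that]] by (auto simp: set_nbs)
    show "placed c \<psi> p p'" if "p < p'" "p' < h" for p p'
      using \<psi>(2)[OF that root root[OF that(2)]] that by simp
  qed
qed

end

section \<open>Growth of the transitive sets\<close>

text \<open>The growth in size needed for one more level of recursion. \<open>2 * h + 1\<close>
  stages are passed; the factor \<open>4 * h\<close> is 2 for the pruning of a centre set times
  \<open>2 * h\<close> for the fraction of it that is complete to or from \<open>P\<close>.\<close>

definition level_loss :: "nat \<Rightarrow> nat" where "level_loss h = stage_loss h ^ (2 * h + 1) * (4 * h)"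
text \<open>\<open>P\<close> is at least \<open>1 / (2 * (h + 1))\<close> of a transitive component,
  which in turn is at least half of a transitive set of the previous level.\<close>

definition rho :: "nat \<Rightarrow> real" where "rho h = 1 + 1 / (4 * (real h + 1))"

context search
begin

lemma transitive_list_distinct: assumes "tournament V A" shows "transitive_list P \<Longrightarrow> distinct P"
proof (induction P)
  case (Cons x P)
  have "x \<notin> set P"
    using Cons.prems tournament_asym[OF assms, of x x] by (auto simp: transitive_list_def)
  then show ?case using Cons by (simp add: transitive_list_def)
qed simp

lemma length_le_card:
  assumes T: "tournament V A" and "transitive_list P" "set P \<subseteq> V" shows "length P \<le> card V"
proof -
  have "length P = card (set P)" using transitive_list_distinct[OF T assms(2)] by (simp add: distinct_card)
  also have "\<dots> \<le> card V" using T assms(3) by (intro card_mono) (simp_all add: tournament_def)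
  finally show ?thesis .
qed

definition sound :: "(nat list \<Rightarrow> nat list) \<Rightarrow> bool" where
  "sound f \<longleftrightarrow> (\<forall>X. transitive_list (f X) \<and> set (f X) \<subseteq> set X)"

lemma cand_sound:
  assumes f: "sound f" and P: "transitive_list P" "set P \<subseteq> set S"
  shows "transitive_list (cand f P S) \<and> set (cand f P S) \<subseteq> set S"
proof -
  have fc: "transitive_list (f (common b P S))" "set (f (common b P S)) \<subseteq> set (common b P S)" for b
    using f by (auto simp: sound_def)
  have "transitive_list (P @ f (common True P S))" "transitive_list (f (common False P S) @ P)"
    using P(1) fc(1) fc(2)[of True] fc(2)[of False]
    by (auto simp: transitive_list_def sorted_wrt_append set_common)
  moreover have "set (f (common b P S)) \<subseteq> set S" for b
    using fc(2)[of b] by (auto simp: set_common)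
  ultimately show ?thesis using P(2) by (simp add: cand_def longer_def)
qed

lemma explore_sound:
  "sound f \<Longrightarrow> transitive_list P \<Longrightarrow> set P \<subseteq> set S \<Longrightarrow>
    transitive_list (explore f S r vs P) \<and> set (explore f S r vs P) \<subseteq> set S"
proof (induction f S r vs P rule: explore.induct)
  case (3 f S r v vs P)
  have "transitive_list (nb b v P)" "set (nb b v P) \<subseteq> set S" for b
    using 3 by (auto simp: transitive_list_nb set_nb)
  then show ?case using 3 by (simp add: longer_def)
qed (simp_all add: cand_sound)

lemma emb_subset:
  "emb V Ps Qs = (b, X, Y) \<Longrightarrow> set X \<union> set Y \<subseteq> set V \<union> cover Ps \<union> cover Qs"
proof (induction V Ps Qs arbitrary: b X Y rule: emb.induct)
  case (2 v V Qs)
  show ?case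
  proof (cases "advance v Qs")
    case (Cons P Ps)
    have "cover (P # Ps) \<subseteq> cover Qs" using distinct_concat_advance(2)[of v Qs] Cons by simp
    moreover have "set X \<union> set Y \<subseteq> set (snd P) \<union> cover Ps \<union> cover Ps"
      using "2.IH"[OF Cons] "2.prems" Cons by simp
    moreover have "cover (P # Ps) = set (snd P) \<union> cover Ps" by (simp add: cover_def)
    ultimately show ?thesis by blast
  qed (use 2 in auto)
next
  case (3 V P Ps Qs)
  let ?b = "fst P \<noteq> [] \<and> hd (fst P)"
  let ?bad = "sel (emb_at h) True ?b (snd P) V"
  let ?good = "sel (emb_at h) False ?b (snd P) V"
  show ?case
  proof (cases "emb_at h * length ?bad < length ?good")
    case True
    then have "emb ?good Ps Qs = (b, X, Y)" using "3.prems" by (simp add: Let_def)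
    from "3.IH"[OF refl refl refl True this] show ?thesis by (auto simp: cover_def set_sel)
  next
    case False
    then have "(?b, ?bad, snd P) = (b, X, Y)" using "3.prems" by (simp only: emb.simps Let_def if_False)
    then show ?thesis by (auto simp: cover_def set_sel)
  qed
qed simp

lemma dense_pair_subset:
  "set (fst (dense_pair S)) \<subseteq> set S" "set (snd (dense_pair S)) \<subseteq> set S"
proof -
  have cp: "set (snd P) \<subseteq> set S" if "P \<in> set (parts S)" for P
    using that set_every set_drop_subset by (fastforce simp: parts_def)
  have "set (fst (dense_pair S)) \<subseteq> set S \<and> set (snd (dense_pair S)) \<subseteq> set S"
  proof (cases "parts S")
    case (Cons P Ps)
    obtain b X Y where e: "emb (snd P) Ps Ps = (b, X, Y)" by (metis prod_cases3)
    have "set (snd P) \<union> cover Ps \<subseteq> set S" using cp Cons by (auto simp: cover_def)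
    then have "set X \<union> set Y \<subseteq> set S" using emb_subset[OF e] by auto
    then show ?thesis using Cons e by (auto simp: dense_pair_def orient_def set_sel)
  qed (simp add: dense_pair_def)
  then show "set (fst (dense_pair S)) \<subseteq> set S" "set (snd (dense_pair S)) \<subseteq> set S" by auto
qed

lemma restrict_subset: "set (restrict X L Y) \<subseteq> set Y"
  by (auto simp: restrict_def set_sel)

lemma stages_sound:
  assumes f: "sound f"
  shows "p \<in> set (stages f r S) \<Longrightarrow> transitive_list (snd p) \<and> set (snd p) \<subseteq> set S \<and> set (fst p) \<subseteq> set S"
proof (induction r arbitrary: S)
  case (Suc r)
  let ?X = "fst (dense_pair S)" and ?Y = "snd (dense_pair S)"
  have L: "transitive_list (f ?X)" "set (f ?X) \<subseteq> set ?X" using f by (auto simp: sound_def)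
  have "transitive_list (prune (f ?X) zs)" "set (prune (f ?X) zs) \<subseteq> set S" "set (prune ?X zs) \<subseteq> set S" for zs
    using L dense_pair_subset(1)[of S] by (auto simp: prune_eq transitive_list_def sorted_wrt_filter)
  moreover have "set (restrict ?X (f ?X) ?Y) \<subseteq> set S"
    using restrict_subset dense_pair_subset(2) by blast
  moreover have "p = (prune ?X (stages f r (restrict ?X (f ?X) ?Y)), prune (f ?X) (stages f r (restrict ?X (f ?X) ?Y))) \<or>
      p \<in> set (stages f r (restrict ?X (f ?X) ?Y))"
    using Suc.prems by (simp add: Let_def)
  ultimately show ?case using Suc.IH[of "restrict ?X (f ?X) ?Y"] by (elim disjE) auto
qed simp

lemma explore_all_sound:
  assumes f: "sound f" and "\<And>z. z \<in> set zs \<Longrightarrow> transitive_list (snd z) \<and> set (snd z) \<subseteq> set S"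
  shows "transitive_list (explore_all f S zs) \<and> set (explore_all f S zs) \<subseteq> set S"
  using assms(2)
proof (induction zs)
  case (Cons z zs)
  then show ?case using explore_sound[OF f, of "snd z" S "h + 2" S] by (simp add: longer_def)
qed (simp add: transitive_list_def)

lemma tau_sound: "sound (tau d)"
proof (induction d)
  case (Suc d)
  have "transitive_list (tau (Suc d) X) \<and> set (tau (Suc d) X) \<subseteq> set X" for X
  proof (cases X)
    case (Cons x S)
    have "transitive_list (cand (tau d) [x] X) \<and> set (cand (tau d) [x] X) \<subseteq> set X"
      using Cons by (intro cand_sound[OF Suc]) (auto simp: transitive_list_def)
    moreover have "transitive_list (explore_all (tau d) X (stages (tau d) (2 * h + 1) X)) \<and>
       set (explore_all (tau d) X (stages (tau d) (2 * h + 1) X)) \<subseteq> set X"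
      using stages_sound[OF Suc] by (intro explore_all_sound[OF Suc]) blast
    ultimately show ?thesis using Cons by (simp add: longer_def)
  qed (simp add: transitive_list_def)
  then show ?case by (simp add: sound_def)
qed (simp add: sound_def transitive_list_def)

lemma tau_nonempty: "tau (Suc d) (x # S) \<noteq> []"
proof -
  have "length (cand (tau d) [x] (x # S)) \<ge> 1" by (simp add: cand_def length_longer)
  then have "length (tau (Suc d) (x # S)) \<ge> 1" by (simp add: length_longer)
  then show ?thesis by auto
qed

lemma explore_ge_cand: "length (cand f P S) \<le> length (explore f S r vs P)"
  by (induction f S r vs P rule: explore.induct) (auto simp: length_longer)

lemma explore_ge_step:
  "v \<in> set vs \<Longrightarrow> length (explore f S r S (nb b v P)) \<le> length (explore f S (Suc r) vs P)"
  by (induction vs) (cases b; auto simp: length_longer)+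

lemma explore_ge:
  "length ws \<le> r \<Longrightarrow> set (map snd ws) \<subseteq> set S \<Longrightarrow>
    length (cand f (nbs ws P) S) \<le> length (explore f S r S P)"
proof (induction ws arbitrary: r P)
  case (Cons w ws)
  then obtain r' where r: "r = Suc r'" by (cases r) auto
  have "length (cand f (nbs (w # ws) P) S) \<le> length (explore f S r' S (nb (fst w) (snd w) P))"
    using Cons r by simp
  also have "\<dots> \<le> length (explore f S r S P)"
    unfolding r using Cons.prems by (intro explore_ge_step) auto
  finally show ?case .
qed (simp add: explore_ge_cand)

lemma explore_all_ge:
  "z \<in> set zs \<Longrightarrow> length (explore f S (h + 2) S (snd z)) \<le> length (explore_all f S zs)"
  by (induction zs) (auto simp: length_longer)

lemma level_loss_ge: "h > 0 \<Longrightarrow> level_loss h \<ge> 3"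
proof -
  assume h: "h > 0"
  have "1 \<le> stage_loss h ^ (2 * h + 1)"
    using h emb_at_pos[OF h] by (intro one_le_power) (simp add: stage_loss_def)
  then have "1 * (4 * 1) \<le> stage_loss h ^ (2 * h + 1) * (4 * h)" using h by (intro mult_le_mono) auto
  then show ?thesis unfolding level_loss_def by linarith
qed

text \<open>
  The first bound comes from extending single vertices by their larger neighbourhood; it makes the transitive sets
  long enough for the chunks of the main step.
\<close>

lemma tau_growth:
  assumes T: "tournament V A" and h: "h > 0" and pat: "\<And>j. j < h \<Longrightarrow> length (pat j) = j"
    and free: "pat_free V" and c: "star_map h c"
    and noemb: "\<not> (\<exists>\<psi>. (\<forall>p<h. \<psi> p \<in> V) \<and> (\<forall>p' p. p < p' \<longrightarrow> p' < h \<longrightarrow> placed c \<psi> p p'))"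
  shows "k \<le> d \<Longrightarrow> distinct S \<Longrightarrow> set S \<subseteq> V \<Longrightarrow> level_loss h ^ k \<le> length S \<Longrightarrow>
    k \<le> length (tau d S) \<and> (16 * (h + 1) \<le> k \<longrightarrow> rho h ^ (k - 16 * (h + 1)) \<le> length (tau d S))"
proof (induction d arbitrary: k S)
  case (Suc d)
  \<comment> \<open>Chunks need a list of at least \<open>8 * (h + 1)\<close> entries, and pruning
    may halve a transitive set; so the exponential bound starts at this level.\<close>
  let ?t = "16 * (h + 1)"
  show ?case
  proof (cases k)
    case (Suc k')
    have d1: "1 \<le> level_loss h ^ k'" using level_loss_ge[OF h] by (intro one_le_power) simp
    have big: "level_loss h * level_loss h ^ k' \<le> length S" using Suc Suc.prems by simp
    have "1 * 1 \<le> level_loss h * level_loss h ^ k'" using level_loss_ge[OF h] d1 by (intro mult_le_mono) auto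
    then obtain x S' where S: "S = x # S'" using big by (cases S) auto
    \<comment> \<open>One part pays for removing \<open>x\<close>, the other two for choosing the
      larger of its two neighbourhoods.\<close>
    have "3 * level_loss h ^ k' \<le> level_loss h * level_loss h ^ k'" using level_loss_ge[OF h] by (intro mult_le_mono1)
    moreover have "length S = length S' + 1" by (simp add: S)
    ultimately have b2: "2 * level_loss h ^ k' \<le> length S'" using big d1 by linarith
    have "length S' = length (nb True x S') + length (nb False x S')"
      using nb_compl[OF T, of x S' True] Suc.prems S by simp
    then obtain b where b: "level_loss h ^ k' \<le> length (nb b x S')" using b2
      by (metis add_less_mono linorder_not_less mult_2)
    have "length (nb b x S') \<le> length (nb b x S)" by (simp add: S nb_def)
    then have "k' \<le> length (tau d (common b [x] S))"
      using Suc.IH[of k' "nb b x S"] Suc.prems Suc b by (auto simp: set_nb)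
    then have "k \<le> length (cand (tau d) [x] S)"
      using Suc by (cases b) (auto simp: cand_def length_longer)
    then have 1: "k \<le> length (tau (Suc d) S)" by (simp add: S length_longer)
    moreover have "rho h ^ (k - ?t) \<le> length (tau (Suc d) S)" if kt: "?t \<le> k"
    proof (cases "k = ?t")
      case True
      then show ?thesis using 1 by simp
    next
      case False
      then have k't: "?t \<le> k'" using kt Suc by simp
      let ?f = "tau d"
      let ?z = "4 * h * level_loss h ^ k'"
      have IH: "k' \<le> length (?f X)" "rho h ^ (k' - ?t) \<le> length (?f X)"
        if "distinct X" "set X \<subseteq> V" "level_loss h ^ k' \<le> length X" for X
        using Suc.IH[of k' X] that Suc.prems(1) Suc k't by auto
      have zd: "1 * level_loss h ^ k' \<le> ?z" using h by (intro mult_le_mono1) simp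
      have fX: "distinct (?f X) \<and> set (?f X) \<subseteq> set X \<and> ?f X \<noteq> [] \<and> transitive_list (?f X)"
        if "distinct X" "set X \<subseteq> V" "?z \<le> length X" for X
      proof -
        have "level_loss h ^ k' \<le> length X" using zd that(3) by linarith
        then have "?f X \<noteq> []" using IH(1)[OF that(1,2)] k't by auto
        then show ?thesis using tau_sound[of d] transitive_list_distinct[OF T] by (auto simp: sound_def)
      qed
      have z1: "1 \<le> ?z" using zd d1 by linarith
      have Sz: "stage_loss h ^ (2 * h + 1) * ?z \<le> length S" using big by (simp add: level_loss_def mult_ac)
      define zs where "zs = stages ?f (2 * h + 1) S"
      have st: "length zs = 2 * h + 1"
        "\<And>p. p \<in> set zs \<Longrightarrow> distinct (fst p) \<and> set (fst p) \<subseteq> set S \<and> ?z \<le> 2 * length (fst p) \<and>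
           distinct (snd p) \<and> set (snd p) \<subseteq> set S \<and> transitive_list (snd p) \<and> snd p \<noteq> [] \<and>
           (\<exists>X. distinct X \<and> set X \<subseteq> set S \<and> ?z \<le> length X \<and> length (?f X) \<le> 2 * length (snd p))"
        "sorted_wrt (\<lambda>p p'. \<forall>X\<in>{fst p, snd p}. \<forall>Y\<in>{fst p', snd p'}. sparse X Y) zs"
        using stages[OF T h pat z1 fX order.refl Suc.prems(2,3) pat_free_mono[OF free Suc.prems(3)] Sz]
        unfolding zs_def by blast+
      \<comment> \<open>The parity matches \<open>zone\<close>: odd stages host centres and use the
        large component, even ones host leaves and singletons and use the transitive one.\<close>
      define U where "U i = (if odd i then fst (zs ! i) else snd (zs ! i))" for i
      have mem: "zs ! i \<in> set zs" if "i < 2 * h + 1" for i using that st(1) by simp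
      have sp: "sparse (U i) (U j)" if "i < j" "j < 2 * h + 1" for i j
        using sorted_wrt_nth_less[OF st(3) that(1)] that st(1) unfolding U_def by auto
      have U: "distinct (U i) \<and> set (U i) \<subseteq> set S \<and> U i \<noteq> []" if "i < 2 * h + 1" for i
      proof -
        have "?z \<le> 2 * length (fst (zs ! i))" using st(2)[OF mem[OF that]] by blast
        then have "fst (zs ! i) \<noteq> []" using z1 by (metis le_trans list.size(3) mult_0_right not_one_le_zero)
        then show ?thesis using st(2)[OF mem[OF that]] unfolding U_def by simp
      qed
      have big_even: "?t \<le> 2 * length (U i)" "rho h ^ (k' - ?t) \<le> 2 * length (U i)" "transitive_list (U i)"
        if ei: "i < 2 * h + 1" "even i" for i
      proof -
        obtain X where X: "distinct X" "set X \<subseteq> set S" "?z \<le> length X" "length (?f X) \<le> 2 * length (U i)"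
          using st(2)[OF mem[OF ei(1)]] ei(2) unfolding U_def by auto
        have "level_loss h ^ k' \<le> length X" using X(3) zd by linarith
        then have "k' \<le> length (?f X)" "rho h ^ (k' - ?t) \<le> length (?f X)"
          using IH[OF X(1)] X(2) Suc.prems(3) by auto
        then show "?t \<le> 2 * length (U i)" "rho h ^ (k' - ?t) \<le> 2 * length (U i)" using X(4) k't by linarith+
        show "transitive_list (U i)" using st(2)[OF mem[OF ei(1)]] ei(2) unfolding U_def by auto
      qed
      \<comment> \<open>The negation of the conclusion of \<open>nb\<close> in
        \<open>star_embedding\<close>; without a full pair H would embed.\<close>
      define full where "full i j ws b \<longleftrightarrow> length (U i) \<le> 2 * h * length (filter (\<lambda>v. \<forall>x\<in>set (nbs ws (U j)).
         if b then (x, v) \<in> A else (v, x) \<in> A) (U i))" for i j ws b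
      have "\<exists>i j ws b. i < 2 * h + 1 \<and> odd i \<and> j < 2 * h + 1 \<and> even j \<and> length ws \<le> h + 2 \<and>
         set (map snd ws) \<subseteq> (\<Union>i<2 * h + 1. set (U i)) \<and>
         length (U j) \<le> 2 * (h + 1) * length (nbs ws (U j)) \<and> full i j ws b"
      proof (rule ccontr)
        assume neg: "\<not> ?thesis"
        have "\<exists>\<psi>. (\<forall>p<h. \<psi> p \<in> set (U (zone h c p))) \<and> (\<forall>p' p. p < p' \<longrightarrow> p' < h \<longrightarrow> placed c \<psi> p p')"
        proof (rule star_embedding[OF T h c sp])
          show "distinct (U i) \<and> set (U i) \<subseteq> V \<and> U i \<noteq> []" if "i < 2 * h + 1" for i
            using U[OF that] Suc.prems(3) by auto
          show "transitive_list (U i) \<and> 8 * (h + 1) \<le> length (U i)" if "i < 2 * h + 1" "even i" for i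
            using big_even[OF that] by auto
        next
          fix i j ws b
          assume *: "i < 2 * h + 1" "odd i" "j < 2 * h + 1" "even j" "length ws \<le> h + 2"
            "set (map snd ws) \<subseteq> (\<Union>i<2 * h + 1. set (U i))"
            "length (U j) \<le> 2 * (h + 1) * length (nbs ws (U j))"
          have "\<not> full i j ws b" using neg * by blast
          then show "2 * h * length (filter (\<lambda>v. \<forall>x\<in>set (nbs ws (U j)). if b then (x, v) \<in> A else (v, x) \<in> A) (U i)) < length (U i)"
            unfolding full_def not_le .
        qed
        then obtain \<psi> where \<psi>: "\<And>p. p < h \<Longrightarrow> \<psi> p \<in> set (U (zone h c p))"
          "\<forall>p' p. p < p' \<longrightarrow> p' < h \<longrightarrow> placed c \<psi> p p'" by blast
        have "\<psi> p \<in> V" if "p < h" for p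
          using \<psi>(1)[OF that] U[OF zone_bound[OF c], of p] Suc.prems(3) by blast
        then show False using noemb \<psi>(2) by blast
      qed
      then obtain i j ws b where w: "i < 2 * h + 1" "odd i" "j < 2 * h + 1" "even j" "length ws \<le> h + 2"
         "set (map snd ws) \<subseteq> (\<Union>i<2 * h + 1. set (U i))"
         "length (U j) \<le> 2 * (h + 1) * length (nbs ws (U j))" "full i j ws b"
        by blast
      note w8 = w(8)[unfolded full_def]
      let ?P = "nbs ws (U j)"
      define F where "F = filter (\<lambda>v. \<forall>x\<in>set ?P. if b then (x, v) \<in> A else (v, x) \<in> A) (U i)"
      have "(\<Union>i<2 * h + 1. set (U i)) \<subseteq> set S" using U by (intro UN_least) auto
      then have wsS: "set (map snd ws) \<subseteq> set S" using w(6) by (rule order_trans[rotated])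
      have sub: "set F \<subseteq> set (common b ?P S)"
      proof
        fix v assume "v \<in> set F"
        then show "v \<in> set (common b ?P S)" using U[OF w(1)] by (simp add: F_def set_common subset_iff)
      qed
      have "distinct F" "distinct (common b ?P S)" using U[OF w(1)] Suc.prems(2) by (simp_all add: F_def)
      then have "length F = card (set F)" "length (common b ?P S) = card (set (common b ?P S))"
        by (simp_all only: distinct_card)
      then have "length F \<le> length (common b ?P S)" using card_mono[OF _ sub] by simp
      moreover have "?z \<le> 2 * length (U i)" using st(2)[OF mem[OF w(1)]] w(2) unfolding U_def by simp
      then have "4 * h * level_loss h ^ k' \<le> 4 * h * length F" using w8 unfolding F_def by linarith
      then have "level_loss h ^ k' \<le> length F" using h by simp
      ultimately have cl: "level_loss h ^ k' \<le> length (common b ?P S)" by linarith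
      have "rho h ^ (k' - ?t) \<le> length (?f (common b ?P S))"
        by (rule IH(2)) (use Suc.prems cl in \<open>auto simp: set_common\<close>)
      moreover have "length ?P + length (?f (common b ?P S)) \<le> length (cand ?f ?P S)"
        by (cases b) (auto simp: cand_def length_longer)
      moreover have "length (cand ?f ?P S) \<le> length (explore ?f S (h + 2) S (U j))"
        by (rule explore_ge[OF w(5) wsS])
      moreover have "\<dots> \<le> length (explore_all ?f S zs)"
        unfolding U_def using w(4) explore_all_ge[OF mem[OF w(3)], of ?f S] by simp
      moreover have "\<dots> \<le> length (tau (Suc d) S)"
        by (simp add: S length_longer zs_def)
      ultimately have 2: "length ?P + rho h ^ (k' - ?t) \<le> length (tau (Suc d) S)" by linarith
      define e where "e = rho h ^ (k' - ?t)"
      \<comment> \<open>The previous level gives \<open>e \<le> 2 * length (U j)\<close>, and the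
        part \<open>P\<close> of \<open>U j\<close> then contributes the additional
        \<open>e / (4 * (h + 1))\<close>.\<close>
      have "real (length (U j)) \<le> real (2 * (h + 1) * length ?P)" using w(7) by (simp only: of_nat_le_iff)
      then have "e \<le> 2 * real (2 * (h + 1) * length ?P)" using big_even(2)[OF w(3,4)] unfolding e_def by linarith
      also have "\<dots> = length ?P * (4 * (real h + 1))" by (simp add: algebra_simps)
      finally have "e / (4 * (real h + 1)) \<le> length ?P"
        by (subst pos_divide_le_eq) simp_all
      moreover have "k - ?t = Suc (k' - ?t)" using Suc k't by (simp add: Suc_diff_le)
      then have "rho h ^ (k - ?t) = e * rho h" by (simp add: e_def)
      then have "rho h ^ (k - ?t) = e + e / (4 * (real h + 1))"
        unfolding rho_def by (simp only: distrib_left mult_1_right times_divide_eq_right)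
      ultimately show ?thesis using 2 unfolding e_def by linarith
    qed
    ultimately show ?thesis by blast
  qed simp
qed simp

end

section \<open>Freeness and galaxies in terms of positions in an ordering\<close>

lemma not_free_of:
  assumes T: "tournament V A" and H: "tournament VH AH" and th: "distinct \<theta>" "set \<theta> = VH"
    and vs: "length vs = length \<theta>" "distinct vs" "set vs \<subseteq> V"
    and arcs: "\<And>i j. i < j \<Longrightarrow> j < length \<theta> \<Longrightarrow> (vs ! i, vs ! j) \<in> A \<longleftrightarrow> (\<theta> ! i, \<theta> ! j) \<in> AH"
  shows "\<not> free_of VH AH V A"
proof -
  let ?I = "{..<length \<theta>}"
  have bv: "bij_betw ((!) vs) ?I (set vs)" using bij_betw_nth[OF vs(2)] vs(1) by auto
  have bt: "bij_betw ((!) \<theta>) ?I VH" using bij_betw_nth[OF th(1)] th(2) by auto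
  define f where "f = (!) \<theta> \<circ> inv_into ?I ((!) vs)"
  have bf: "bij_betw f (set vs) VH"
    unfolding f_def by (rule bij_betw_trans[OF bij_betw_inv_into[OF bv] bt])
  have fi: "f (vs ! i) = \<theta> ! i" if "i < length \<theta>" for i
    using bij_betw_inv_into_left[OF bv, of i] that by (simp add: f_def)
  have "(u, v) \<in> A \<inter> set vs \<times> set vs \<longleftrightarrow> (f u, f v) \<in> AH" if uv: "u \<in> set vs" "v \<in> set vs" for u v
  proof -
    obtain i where i: "i < length \<theta>" "u = vs ! i" using uv(1) vs(1) by (metis in_set_conv_nth)
    obtain j where j: "j < length \<theta>" "v = vs ! j" using uv(2) vs(1) by (metis in_set_conv_nth)
    have "(vs ! i, vs ! j) \<in> A \<longleftrightarrow> (\<theta> ! i, \<theta> ! j) \<in> AH"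
    proof -
      consider "i < j" | "i = j" | "j < i" by linarith
      then show ?thesis
      proof cases
        case 1 then show ?thesis using arcs j by blast
      next
        case 2
        then show ?thesis using tournament_asym[OF T] tournament_asym[OF H] by blast
      next
        case 3
        then have "(vs ! j, vs ! i) \<in> A \<longleftrightarrow> (\<theta> ! j, \<theta> ! i) \<in> AH" using arcs i by blast
        moreover have "vs ! i \<noteq> vs ! j" "\<theta> ! i \<noteq> \<theta> ! j"
          using 3 i j vs th by (simp_all add: nth_eq_iff_index_eq)
        moreover have "vs ! i \<in> V" "vs ! j \<in> V" "\<theta> ! i \<in> VH" "\<theta> ! j \<in> VH"
          using i j uv vs th by auto
        ultimately show ?thesis
          using tournament_asym[OF T] tournament_asym[OF H] tournament_total[OF T] tournament_total[OF H] by metis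
      qed
    qed
    then show ?thesis using uv i j fi by simp
  qed
  then have "isomorphic (set vs) (A \<inter> set vs \<times> set vs) VH AH"
    unfolding isomorphic_def using bf by blast
  then show ?thesis unfolding free_of_def using vs(3) by blast
qed

lemma before_nth:
  assumes "distinct \<theta>" "p < length \<theta>" "p' < length \<theta>"
  shows "before \<theta> (\<theta> ! p) (\<theta> ! p') \<longleftrightarrow> p < p'"
  unfolding before_def using assms
  by (metis nth_eq_iff_index_eq order_less_trans)

lemma backward_edges_nth:
  assumes "distinct \<theta>" "p < p'" "p' < length \<theta>"
  shows "(\<theta> ! p', \<theta> ! p) \<in> AH \<longleftrightarrow> (\<theta> ! p, \<theta> ! p') \<in> backward_edges AH \<theta>"
  using assms before_nth[of \<theta> p p'] before_nth[of \<theta> p' p] by (simp add: backward_edges_def)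

text \<open>The stars are replaced by the single map \<open>c\<close>. It describes the backward
  graph completely, because two distinct vertices of a star are adjacent exactly if one of them is
  its centre, and vertices of different components are not adjacent.\<close>

lemma galaxy_star_map:
  assumes "galaxy VH AH"
  shows "\<exists>\<theta> c. distinct \<theta> \<and> set \<theta> = VH \<and> star_map (length \<theta>) c \<and>
    (\<forall>p p'. p < p' \<longrightarrow> p' < length \<theta> \<longrightarrow> ((\<theta> ! p', \<theta> ! p) \<in> AH \<longleftrightarrow> c p = p' \<or> c p' = p))"
proof -
  obtain \<theta> ctr where so: "star_ordering VH AH \<theta>" and
    g: "let E = backward_edges AH \<theta>; stars = {S \<in> graph_components VH E. \<not> (\<exists>v. S = {v})} in
           (\<forall>S\<in>stars. star_centered_at E S (ctr S)) \<and>
           (\<forall>S\<in>stars. \<forall>S'\<in>stars. S \<noteq> S' \<longrightarrow>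
              \<not> (\<exists>x\<in>S' - {ctr S'}. \<exists>y\<in>S' - {ctr S'}.
                    before \<theta> x (ctr S) \<and> before \<theta> (ctr S) y))"
    using assms unfolding galaxy_def by blast
  define E where "E = backward_edges AH \<theta>"
  define comp where "comp v = E\<^sup>* `` {v}" for v
  define star where "star S \<longleftrightarrow> S \<in> graph_components VH E \<and> \<not> (\<exists>v. S = {v})" for S
  have th: "distinct \<theta>" "set \<theta> = VH" using so by (auto simp: star_ordering_def vertex_ordering_def)
  let ?h = "length \<theta>"
  have ctr: "star_centered_at E S (ctr S)" if "star S" for S
    using g that unfolding star_def E_def Let_def by blast
  have btw: "\<not> (before \<theta> x (ctr S) \<and> before \<theta> (ctr S) y)"
    if "star S" "star S'" "S \<noteq> S'" "x \<in> S' - {ctr S'}" "y \<in> S' - {ctr S'}" for S S' x y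
    using g that unfolding star_def E_def Let_def by blast
  have lr: "left_star E \<theta> S \<or> right_star E \<theta> S" if "star S" for S
    using so that unfolding star_ordering_def star_def E_def by blast
  have symE: "(u, v) \<in> E \<Longrightarrow> (v, u) \<in> E" for u v by (auto simp: E_def backward_edges_def)
  then have sym: "sym (E\<^sup>*)" by (intro sym_rtrancl symI)
  have comp_eq: "comp u = comp v" if "u \<in> comp v" for u v
  proof -
    have uv: "(v, u) \<in> E\<^sup>*" "(u, v) \<in> E\<^sup>*" using that sym by (auto simp: comp_def dest: symD)
    then show ?thesis unfolding comp_def by (auto intro: rtrancl_trans)
  qed
  have self: "v \<in> comp v" for v by (simp add: comp_def)
  have EV: "u \<in> VH" if "(u, v) \<in> E" for u v
  proof -
    have "before \<theta> u v \<or> before \<theta> v u" using that by (auto simp: E_def backward_edges_def)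
    then show ?thesis using th(2) unfolding before_def by (metis nth_mem order_less_trans)
  qed
  have compV: "comp v \<subseteq> VH" if "v \<in> VH" for v
  proof
    fix u assume "u \<in> comp v"
    then have "(u, v) \<in> E\<^sup>*" using sym by (auto simp: comp_def dest: symD)
    then show "u \<in> VH" using that by (cases rule: converse_rtranclE) (auto dest: EV)
  qed
  have star_comp: "star (comp v) \<longleftrightarrow> comp v \<noteq> {v}" if "v \<in> VH" for v
    using that self[of v] unfolding star_def graph_components_def comp_def[symmetric] by auto
  define cv where "cv v = (if star (comp v) then ctr (comp v) else v)" for v
  have cin: "ctr S \<in> S" if "star S" for S using ctr[OF that] by (simp add: star_centered_at_def)
  have cv_comp: "cv v \<in> comp v" for v using cin self by (simp add: cv_def)
  have cv_idem: "cv (cv v) = cv v" for v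
    using comp_eq[OF cv_comp[of v]] by (auto simp: cv_def)
  have edge: "(u, v) \<in> E \<longleftrightarrow> cv u = v \<or> cv v = u" if "u \<in> VH" "v \<in> VH" "u \<noteq> v" for u v
  proof (cases "v \<in> comp u")
    case True
    have e: "comp u = comp v" using comp_eq[OF True] by simp
    have s: "star (comp u)" using True self[of u] that star_comp[of u] by auto
    then have "(u, v) \<in> E \<longleftrightarrow> u = ctr (comp u) \<or> v = ctr (comp u)"
      using ctr[OF s] True self[of u] that(3) unfolding star_centered_at_def by blast
    then show ?thesis using s e by (auto simp: cv_def)
  next
    case False
    have "u \<notin> comp v" using False comp_eq self by blast
    then show ?thesis using False cv_comp[of u] cv_comp[of v] by (auto simp: comp_def)
  qed
  have leaves: "\<not> (before \<theta> x z \<and> before \<theta> z y)"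
    if xy: "x \<in> VH" "y \<in> VH" "w \<in> VH" "cv x = cv y" "cv x \<noteq> x" "cv y \<noteq> y" "cv w \<noteq> w" "z = cv w" for x y z w
  proof
    assume b: "before \<theta> x z \<and> before \<theta> z y"
    have e: "comp x = comp y" using comp_eq[OF cv_comp[of x]] comp_eq[OF cv_comp[of y]] xy(4) by simp
    have s: "star (comp x)" "star (comp w)" using xy by (auto simp: cv_def split: if_splits)
    have z: "z = ctr (comp w)" using s xy by (simp add: cv_def)
    have m: "x \<in> comp x - {ctr (comp x)}" "y \<in> comp x - {ctr (comp x)}"
      using self[of x] self[of y] xy s e by (auto simp: cv_def split: if_splits)
    show False
    proof (cases "comp w = comp x")
      case False
      then show ?thesis using btw[OF s(2,1) False m] b z by blast
    next
      case True
      \<comment> \<open>The centre \<open>z\<close> belongs to the star of \<open>x\<close> and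
        \<open>y\<close>. The centre \<open>c\<close> that witnesses a left or right star may differ
        from the chosen one, but only in a star with a single edge, which has just one leaf.\<close>
      obtain c where c: "star_centered_at E (comp x) c"
        and d: "(\<forall>u\<in>comp x - {c}. before \<theta> u c) \<or> (\<forall>u\<in>comp x - {c}. before \<theta> c u)"
        using lr[OF s(1)] unfolding left_star_def right_star_def by blast
      have asym: "\<not> (before \<theta> u v \<and> before \<theta> v u)" for u v
      proof
        assume "before \<theta> u v \<and> before \<theta> v u"
        then obtain i j i' j' where "i < j" "j < ?h" "\<theta> ! i = u" "\<theta> ! j = v" "i' < j'" "j' < ?h" "\<theta> ! i' = v" "\<theta> ! j' = u"
          unfolding before_def by blast
        moreover from this have "j = i'" "i = j'"
          using th(1) by (metis nth_eq_iff_index_eq order_less_trans)+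
        ultimately show False by simp
      qed
      show False
      proof (cases "c = z")
        case True
        then show ?thesis using d m b z \<open>comp w = comp x\<close> asym by metis
      next
        case False
        have zc: "star_centered_at E (comp x) z" using ctr[OF s(1)] z True by simp
        have "u = c" if "u \<in> comp x" "u \<noteq> z" for u
        proof (rule ccontr)
          assume "u \<noteq> c"
          have "(u, z) \<in> E" using zc that unfolding star_centered_at_def by blast
          then have "u = c \<or> z = c" using c that zc unfolding star_centered_at_def by blast
          then show False using \<open>u \<noteq> c\<close> False by simp
        qed
        then have "x = y" using m z True by auto
        then show False using b asym by blast
      qed
    qed
  qed
  define pos where "pos v = (THE p. p < ?h \<and> \<theta> ! p = v)" for v
  have pos: "pos v < ?h \<and> \<theta> ! pos v = v" if "v \<in> VH" for v
  proof -
    have "\<exists>!p. p < ?h \<and> \<theta> ! p = v" using that th by (metis distinct_Ex1)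
    then show ?thesis unfolding pos_def by (rule theI')
  qed
  define c where "c p = pos (cv (\<theta> ! p))" for p
  have nV: "\<theta> ! p \<in> VH" if "p < ?h" for p using that th by auto
  have cvV: "cv v \<in> VH" if "v \<in> VH" for v using compV[OF that] cv_comp[of v] by blast
  have c1: "c p < ?h" "\<theta> ! c p = cv (\<theta> ! p)" if "p < ?h" for p
    using pos[OF cvV[OF nV[OF that]]] by (auto simp: c_def)
  have inj: "p = p' \<longleftrightarrow> \<theta> ! p = \<theta> ! p'" if "p < ?h" "p' < ?h" for p p'
    using nth_eq_iff_index_eq[OF th(1) that] by simp
  have c_eq: "c p = p' \<longleftrightarrow> cv (\<theta> ! p) = \<theta> ! p'" if "p < ?h" "p' < ?h" for p p'
    using inj[OF c1(1)[OF that(1)] that(2)] c1(2)[OF that(1)] by simp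
  have "star_map ?h c"
    unfolding star_map_def
  proof (intro conjI allI impI)
    fix p assume p: "p < ?h"
    show "c p < ?h" by (rule c1(1)[OF p])
    show "c (c p) = c p" using c1(2)[OF p] cv_idem by (simp add: c_def)
  next
    fix x y z
    assume a: "x < z \<and> z < y \<and> y < ?h \<and> c x = c y \<and> c x \<noteq> x \<and> c y \<noteq> y"
    then have l: "x < ?h" "y < ?h" "z < ?h" by auto
    show "z \<notin> centers ?h c"
    proof
      assume "z \<in> centers ?h c"
      then obtain q where q: "q < ?h" "c q \<noteq> q" "z = c q" by (auto simp: centers_def)
      have "before \<theta> (\<theta> ! x) (\<theta> ! z)" "before \<theta> (\<theta> ! z) (\<theta> ! y)"
        using before_nth[OF th(1)] a l by auto
      moreover have "cv (\<theta> ! x) = cv (\<theta> ! y)" using c1(2)[OF l(1)] c1(2)[OF l(2)] a by simp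
      moreover have "cv (\<theta> ! x) \<noteq> \<theta> ! x" "cv (\<theta> ! y) \<noteq> \<theta> ! y" "cv (\<theta> ! q) \<noteq> \<theta> ! q"
        using c_eq[OF l(1,1)] c_eq[OF l(2,2)] c_eq[OF q(1,1)] a q by auto
      moreover have "\<theta> ! z = cv (\<theta> ! q)" using c1(2)[OF q(1)] q(3) by simp
      ultimately show False using leaves[OF nV nV nV, of x y q "\<theta> ! z"] l q(1) by blast
    qed
  qed
  moreover have "(\<theta> ! p', \<theta> ! p) \<in> AH \<longleftrightarrow> c p = p' \<or> c p' = p" if pp: "p < p'" "p' < ?h" for p p'
  proof -
    have p: "p < ?h" using pp by simp
    have "\<theta> ! p \<noteq> \<theta> ! p'" using inj[OF p pp(2)] pp by simp
    then show ?thesis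
      using backward_edges_nth[OF th(1) pp] edge[OF nV[OF p] nV[OF pp(2)]] c_eq[OF p pp(2)] c_eq[OF pp(2) p]
      by (simp add: E_def)
  qed
  ultimately show ?thesis using th by blast
qed

section \<open>A program and its running time\<close>

definition runs :: "program \<Rightarrow> tree list \<Rightarrow> expr \<Rightarrow> tree \<Rightarrow> nat \<Rightarrow> bool" where
  "runs P env e v b \<longleftrightarrow> (\<exists>t\<le>b. eval P env e v t)"

definition runss :: "program \<Rightarrow> tree list \<Rightarrow> expr list \<Rightarrow> tree list \<Rightarrow> nat \<Rightarrow> bool" where
  "runss P env es vs b \<longleftrightarrow> (\<exists>t\<le>b. evals P env es vs t)"

definition fn :: "program \<Rightarrow> nat \<Rightarrow> tree list \<Rightarrow> tree \<Rightarrow> nat \<Rightarrow> bool" where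
  "fn P f vs v b \<longleftrightarrow> f < length P \<and> runs P vs (P ! f) v b"

text \<open>
  The judgement \<open>runs\<close> only bounds the time, so that its rules can be applied backwards to a program text with the value and
  the bound left schematic. Branching and projections are split off for the same reason.
\<close>

definition branch :: "tree \<Rightarrow> 'a \<Rightarrow> 'a \<Rightarrow> 'a \<Rightarrow> bool" where
  "branch x a b e \<longleftrightarrow> e = (if x = Leaf then b else a)"

definition lpart :: "tree \<Rightarrow> tree \<Rightarrow> bool" where "lpart x u \<longleftrightarrow> left x = u"
definition rpart :: "tree \<Rightarrow> tree \<Rightarrow> bool" where "rpart x u \<longleftrightarrow> right x = u"

lemma branch_intros: "branch (Node x y) a b a" "branch Leaf a b b"
  by (simp_all add: branch_def)

lemma lpart_intros: "lpart (Node u w) u" "lpart (enc_list enc_bool bs) (enc_bool (bs \<noteq> [] \<and> hd bs))"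
  by (simp add: lpart_def) (cases bs; simp add: lpart_def)
lemma rpart_intros: "rpart (Node u w) w" "rpart Leaf Leaf" "rpart (enc_list f xs) (enc_list f (tl xs))"
  by (simp_all add: rpart_def) (cases xs; simp)

lemma runs_mono: "runs P env e v b \<Longrightarrow> b \<le> b' \<Longrightarrow> runs P env e v b'"
  unfolding runs_def by (meson order_trans)

lemma fn_mono: "fn P f vs v b \<Longrightarrow> b \<le> b' \<Longrightarrow> fn P f vs v b'"
  unfolding fn_def by (meson runs_mono)

lemma fn_conv: "fn P f vs v b \<Longrightarrow> v = v' \<Longrightarrow> b \<le> b' \<Longrightarrow> fn P f vs v' b'"
  using fn_mono by simp

lemma runs_var:
  "runs P (x0 # env) (VarE 0) x0 1"
  "runs P (x0 # x1 # env) (VarE (Suc 0)) x1 1"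
  "runs P (x0 # x1 # x2 # env) (VarE (Suc (Suc 0))) x2 1"
  "runs P (x0 # x1 # x2 # x3 # env) (VarE (Suc (Suc (Suc 0)))) x3 1"
  "runs P (x0 # x1 # x2 # x3 # x4 # env) (VarE (Suc (Suc (Suc (Suc 0))))) x4 1"
  unfolding runs_def by (intro exI[of _ 1] conjI; (simp; fail | (rule eval_evals.Var[THEN back_subst[of "\<lambda>v. eval P _ _ v 1"]]; simp)))+

lemma runs_leaf: "runs P env LeafE Leaf 1"
  unfolding runs_def by (blast intro: eval_evals.LeafE)

lemma runs_node: "runs P env a u s \<Longrightarrow> runs P env b v t \<Longrightarrow> runs P env (NodeE a b) (Node u v) (s + t + 1)"
  unfolding runs_def by (meson add_le_mono order_refl eval_evals.NodeE)

lemma runs_left: "runs P env a x s \<Longrightarrow> lpart x u \<Longrightarrow> runs P env (LeftE a) u (s + 1)"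
  unfolding runs_def lpart_def by (metis add_le_mono order_refl eval_evals.LeftE)

lemma runs_right: "runs P env a x s \<Longrightarrow> rpart x u \<Longrightarrow> runs P env (RightE a) u (s + 1)"
  unfolding runs_def rpart_def by (metis add_le_mono order_refl eval_evals.RightE)

lemma runs_if:
  assumes "runs P env c x s" "branch x a b e" "runs P env e v t"
  shows "runs P env (IfE c a b) v (s + t + 1)"
proof -
  obtain s' t' where st: "s' \<le> s" "t' \<le> t" "eval P env c x s'" "eval P env e v t'"
    using assms unfolding runs_def by blast
  have "eval P env (IfE c a b) v (s' + t' + 1)"
    using st assms(2) by (cases x) (auto simp: branch_def intro: eval_evals.IfE_Node eval_evals.IfE_Leaf simp del: One_nat_def add_Suc_right)
  then show ?thesis using st unfolding runs_def by (meson add_le_mono order_refl)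
qed

lemma runs_call:
  assumes "runss P env es vs s" "fn P f vs v t"
  shows "runs P env (CallE f es) v (s + t + 1)"
  using assms unfolding runs_def runss_def fn_def
  by (meson add_le_mono order_refl eval_evals.Call)

lemma runss_nil: "runss P env [] [] 0"
  unfolding runss_def by (blast intro: eval_evals.Empty)

lemma runss_cons: "runs P env e v s \<Longrightarrow> runss P env es vs t \<Longrightarrow> runss P env (e # es) (v # vs) (s + t)"
  unfolding runs_def runss_def by (meson add_le_mono eval_evals.Cons)

lemma runsI: "runs P env e v' t \<Longrightarrow> v' = v \<Longrightarrow> t \<le> b \<Longrightarrow> runs P env e v b"
  using runs_mono by simp

lemma fnI: "f < length P \<Longrightarrow> P ! f = e \<Longrightarrow> runs P vs e v' t \<Longrightarrow> v' = v \<Longrightarrow> t \<le> b \<Longrightarrow> fn P f vs v b"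
  unfolding fn_def using runs_mono by simp

fun quote :: "tree \<Rightarrow> expr" where
  "quote Leaf = LeafE"
| "quote (Node s t) = NodeE (quote s) (quote t)"

fun cells :: "tree \<Rightarrow> nat" where
  "cells Leaf = 1"
| "cells (Node s t) = cells s + cells t + 1"

lemma runs_quote: "runs P env (quote t) t (cells t)"
  by (induction t) (auto intro: runs_leaf runs_node simp del: One_nat_def add_Suc_right)

lemma cells_enc_nat: "cells (enc_nat n) = 2 * n + 1"
  by (induction n) auto

lemmas run_rules = runs_var runs_leaf runs_node runs_left runs_right runs_if runs_call runs_quote
  runss_nil runss_cons branch_intros lpart_intros rpart_intros

abbreviation "X0 \<equiv> VarE 0"
abbreviation "X1 \<equiv> VarE (Suc 0)"
abbreviation "X2 \<equiv> VarE (Suc (Suc 0))"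
abbreviation "X3 \<equiv> VarE (Suc (Suc (Suc 0)))"
abbreviation "X4 \<equiv> VarE (Suc (Suc (Suc (Suc 0))))"
abbreviation "YesE \<equiv> NodeE LeafE LeafE"
abbreviation "num k \<equiv> quote (enc_nat k)"

abbreviation (input) "fMain \<equiv> 0 :: nat"
abbreviation (input) "fMain2 \<equiv> 1 :: nat"
abbreviation (input) "fAttach \<equiv> 2 :: nat"
abbreviation (input) "fHalf \<equiv> 3 :: nat"
abbreviation (input) "fStrip \<equiv> 4 :: nat"
abbreviation (input) "fStrips \<equiv> 5 :: nat"
abbreviation (input) "fColor \<equiv> 6 :: nat"
abbreviation (input) "fLg \<equiv> 7 :: nat"
abbreviation (input) "fColor2 \<equiv> 8 :: nat"
abbreviation (input) "fEq \<equiv> 9 :: nat"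
abbreviation (input) "fMem \<equiv> 10 :: nat"
abbreviation (input) "fDiff \<equiv> 11 :: nat"
abbreviation (input) "fTau \<equiv> 12 :: nat"
abbreviation (input) "fLonger \<equiv> 13 :: nat"
abbreviation (input) "fCand \<equiv> 14 :: nat"
abbreviation (input) "fExploreAll \<equiv> 15 :: nat"
abbreviation (input) "fExplore \<equiv> 16 :: nat"
abbreviation (input) "fCommon \<equiv> 17 :: nat"
abbreviation (input) "fApp \<equiv> 18 :: nat"
abbreviation (input) "fStages \<equiv> 19 :: nat"
abbreviation (input) "fStages2 \<equiv> 20 :: nat"
abbreviation (input) "fStages3 \<equiv> 21 :: nat"
abbreviation (input) "fStages4 \<equiv> 22 :: nat"
abbreviation (input) "fPrune \<equiv> 23 :: nat"
abbreviation (input) "fDensePair \<equiv> 24 :: nat"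
abbreviation (input) "fOrient \<equiv> 25 :: nat"
abbreviation (input) "fEmb \<equiv> 26 :: nat"
abbreviation (input) "fNb \<equiv> 27 :: nat"
abbreviation (input) "fSel \<equiv> 28 :: nat"
abbreviation (input) "fLt \<equiv> 29 :: nat"
abbreviation (input) "fDrop \<equiv> 30 :: nat"
abbreviation (input) "fAdvance \<equiv> 31 :: nat"
abbreviation (input) "fNth \<equiv> 32 :: nat"
abbreviation (input) "fParts \<equiv> 33 :: nat"
abbreviation (input) "fEmb2 \<equiv> 34 :: nat"
abbreviation (input) "fEvery \<equiv> 35 :: nat"

text \<open>H is fixed, so the splitting into h parts and the bits of \<open>pat\<close> are
  unrolled into the program text instead of being computed.\<close>

definition parts_expr :: "nat \<Rightarrow> (nat \<Rightarrow> bool list) \<Rightarrow> nat list \<Rightarrow> expr" where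
  "parts_expr h pat js = foldr (\<lambda>j e. NodeE (NodeE (quote (enc_list enc_bool (pat j)))
     (CallE fEvery [(RightE ^^ j) X0])) e) js LeafE"

text \<open>The functions appear in the order of their numbers. The language has no local
  definitions, so \<open>fMain2\<close>, \<open>fColor2\<close>, \<open>fStages2\<close> to
  \<open>fStages4\<close>, \<open>fParts\<close> and \<open>fEmb2\<close> exist to receive a
  computed value as an argument.\<close>

definition prog :: "nat \<Rightarrow> (nat \<Rightarrow> bool list) \<Rightarrow> program" where
  "prog h pat = [
    CallE fMain2 [CallE fAttach [X0, LeafE]],
    CallE fStrips [CallE fColor [X0, CallE fLg [X0], X0]],
    IfE X0 (NodeE (NodeE X1 (LeftE X0)) (CallE fAttach [RightE X0, NodeE LeafE X1])) LeafE,
    IfE X0 (IfE (RightE X0) (NodeE (LeftE X0) (CallE fHalf [RightE (RightE X0)])) LeafE) LeafE,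
    IfE X0 (NodeE (LeftE (LeftE X0)) (CallE fStrip [RightE X0])) LeafE,
    IfE X0 (NodeE (CallE fStrip [LeftE X0]) (CallE fStrips [RightE X0])) LeafE,
    IfE X0 (IfE X2 (CallE fColor2 [CallE fTau [X1, X2], RightE X0, X1, X2]) LeafE) LeafE,
    IfE X0 (NodeE LeafE (CallE fLg [CallE fHalf [X0]])) LeafE,
    NodeE X0 (CallE fColor [X1, X2, CallE fDiff [X3, X0]]),
    IfE X0 (IfE X1 (CallE fEq [RightE X0, RightE X1]) LeafE) (IfE X1 LeafE YesE),
    IfE X1 (IfE (CallE fEq [LeftE X0, LeftE (LeftE X1)]) YesE (CallE fMem [X0, RightE X1])) LeafE,
    IfE X0 (IfE (CallE fMem [LeftE X0, X1]) (CallE fDiff [RightE X0, X1])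
       (NodeE (LeftE X0) (CallE fDiff [RightE X0, X1]))) LeafE,
    IfE X0 (IfE X1 (CallE fLonger [CallE fCand [NodeE (LeftE X1) LeafE, X1, RightE X0],
       CallE fExploreAll [CallE fStages [num (2 * h + 1), X1, RightE X0], X1, RightE X0]]) LeafE) LeafE,
    IfE (CallE fLt [num 1, X0, X1]) X1 X0,
    CallE fLonger [CallE fApp [X0, CallE fTau [X2, CallE fCommon [YesE, X0, X1]]],
       CallE fApp [CallE fTau [X2, CallE fCommon [LeafE, X0, X1]], X0]],
    IfE X0 (CallE fLonger [CallE fExplore [num (h + 2), X1, RightE (LeftE X0), X1, X2],
       CallE fExploreAll [RightE X0, X1, X2]]) LeafE,
    IfE X1 (IfE X0 (CallE fLonger [CallE fLonger [
         CallE fExplore [RightE X0, X3, CallE fNb [YesE, LeftE X1, X2], X3, X4],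
         CallE fExplore [RightE X0, X3, CallE fNb [LeafE, LeftE X1, X2], X3, X4]],
         CallE fExplore [X0, RightE X1, X2, X3, X4]])
       (CallE fCand [X2, X3, X4])) (CallE fCand [X2, X3, X4]),
    IfE X1 (CallE fCommon [X0, RightE X1, CallE fNb [X0, LeftE X1, X2]]) X2,
    IfE X0 (NodeE (LeftE X0) (CallE fApp [RightE X0, X1])) X1,
    IfE X0 (CallE fStages2 [CallE fDensePair [X1], RightE X0, X2]) LeafE,
    CallE fStages3 [CallE fTau [X2, LeftE X0], LeftE X0, RightE X0, X1, X2],
    CallE fStages4 [X1, X0, CallE fStages [X3, CallE fSel [num (restrict_at h), YesE, YesE, X0,
       CallE fSel [num (restrict_at h), YesE, YesE, X1, X2]], X4]],
    NodeE (NodeE (CallE fPrune [X0, X2]) (CallE fPrune [X1, X2])) X2,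
    IfE X1 (CallE fPrune [CallE fSel [num (prune_at h), YesE, LeafE, RightE (LeftE X1),
       CallE fSel [num (prune_at h), YesE, LeafE, LeftE (LeftE X1), X0]], RightE X1]) X0,
    CallE fParts [parts_expr h pat [0..<h]],
    IfE (LeftE X0) (NodeE (CallE fSel [num (orient_at h), YesE, LeafE, LeftE (RightE X0), RightE (RightE X0)])
       (LeftE (RightE X0))) (RightE X0),
    IfE X1 (IfE (CallE fLt [num (emb_at h),
           CallE fSel [num (emb_at h), YesE, LeftE (LeftE (LeftE X1)), RightE (LeftE X1), X0],
           CallE fSel [num (emb_at h), LeafE, LeftE (LeftE (LeftE X1)), RightE (LeftE X1), X0]])
         (CallE fEmb [CallE fSel [num (emb_at h), LeafE, LeftE (LeftE (LeftE X1)), RightE (LeftE X1), X0], RightE X1, X2])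
         (NodeE (LeftE (LeftE (LeftE X1)))
            (NodeE (CallE fSel [num (emb_at h), YesE, LeftE (LeftE (LeftE X1)), RightE (LeftE X1), X0]) (RightE (LeftE X1)))))
       (IfE X0 (CallE fEmb2 [CallE fAdvance [LeftE X0, X2]]) (NodeE LeafE (NodeE LeafE LeafE))),
    IfE X2 (IfE (IfE X0 (CallE fNth [RightE X1, LeftE (LeftE X2)]) (CallE fNth [RightE (LeftE X2), LeftE X1]))
       (NodeE (LeftE X2) (CallE fNb [X0, X1, RightE X2])) (CallE fNb [X0, X1, RightE X2])) LeafE,
    IfE X4 (IfE (IfE (CallE fLt [X0, CallE fNb [X2, LeftE X4, X3], X3]) X1 (IfE X1 LeafE YesE))
       (NodeE (LeftE X4) (CallE fSel [X0, X1, X2, X3, RightE X4])) (CallE fSel [X0, X1, X2, X3, RightE X4])) LeafE,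
    IfE X2 (IfE X1 (CallE fLt [X0, RightE X1, CallE fDrop [X0, X2]]) YesE) LeafE,
    IfE X0 (CallE fDrop [RightE X0, RightE X1]) X1,
    IfE X1 (NodeE (NodeE (RightE (LeftE (LeftE X1)))
       (CallE fNb [LeftE (LeftE (LeftE X1)), X0, RightE (LeftE X1)])) (CallE fAdvance [X0, RightE X1])) LeafE,
    IfE X0 (IfE X1 (CallE fNth [RightE X0, RightE X1]) (LeftE X0)) LeafE,
    IfE X0 (CallE fOrient [CallE fEmb [RightE (LeftE X0), RightE X0, RightE X0]]) (NodeE LeafE LeafE),
    IfE X0 (CallE fEmb [RightE (LeftE X0), RightE X0, RightE X0]) (NodeE LeafE (NodeE LeafE LeafE)),
    IfE X0 (NodeE (LeftE X0) (CallE fEvery [(RightE ^^ (h - 1)) (RightE X0)])) LeafE]"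

lemma length_prog [simp]: "length (prog h pat) = 36"
  by (simp add: prog_def)

text \<open>\<open>N\<close> dominates the number of vertices and the constants depending on H, so
  that costs can be stated in powers of \<open>N\<close> alone.\<close>

locale search_prog = search A h pat for A :: "nat rel" and h :: nat and pat :: "nat \<Rightarrow> bool list" +
  fixes n N :: nat
  assumes T: "tournament {..<n} A"
    and N_big: "1000 \<le> N" "n + 1 \<le> N" "2 * emb_at h + 2 * h + 10 \<le> N" "\<And>j. j < h \<Longrightarrow> cells (enc_list enc_bool (pat j)) \<le> N"
    and h_pos: "h > 0"
begin

abbreviation "PP \<equiv> prog h pat"

text \<open>
  Inside the program a vertex carries its row of the adjacency matrix.
\<close>

definition enc_vertex :: "nat \<Rightarrow> tree" where
  "enc_vertex i = Node (enc_nat i) (enc_list enc_bool (map (\<lambda>j. (i, j) \<in> A) [0..<n]))"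

abbreviation "el \<equiv> enc_list enc_vertex"


lemma A_sub: "A \<subseteq> {..<n} \<times> {..<n}"
  using T by (simp add: tournament_def)

definition enc_item :: "bool list \<times> nat list \<Rightarrow> tree" where
  "enc_item P = Node (enc_list enc_bool (fst P)) (el (snd P))"

definition enc_lists :: "nat list \<times> nat list \<Rightarrow> tree" where
  "enc_lists P = Node (el (fst P)) (el (snd P))"

definition enc_outcome :: "bool \<times> nat list \<times> nat list \<Rightarrow> tree" where
  "enc_outcome r = Node (enc_bool (fst r)) (enc_lists (snd r))"

lemma enc_parts:
  "lpart (enc_vertex i) (enc_nat i)"
  "rpart (enc_vertex i) (enc_list enc_bool (map (\<lambda>j. (i, j) \<in> A) [0..<n]))"
  "lpart (enc_item P) (enc_list enc_bool (fst P))" "rpart (enc_item P) (el (snd P))"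
  "lpart (enc_lists z) (el (fst z))" "rpart (enc_lists z) (el (snd z))"
  "lpart (enc_outcome r) (enc_bool (fst r))" "rpart (enc_outcome r) (enc_lists (snd r))"
  by (simp_all add: lpart_def rpart_def enc_vertex_def enc_item_def enc_lists_def enc_outcome_def)

lemmas rr = enc_parts run_rules

text \<open>With a factor of at least 1000 between successive powers, linear arithmetic can absorb
  the constants and lower powers collected along a program text.\<close>

lemma N_pow: "1000 \<le> N" "1000 * N \<le> N ^ 2" "1000 * N ^ 2 \<le> N ^ 3" "1000 * N ^ 3 \<le> N ^ 4"
  "1000 * N ^ 4 \<le> N ^ 5" "1000 * N ^ 5 \<le> N ^ 6" "1000 * N ^ 6 \<le> N ^ 7" "1000 * N ^ 7 \<le> N ^ 8"
proof -
  have step: "1000 * M \<le> N * M" for M by (intro mult_le_mono1 N_big(1))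
  have eqs: "N ^ 2 = N * N" "N ^ 3 = N * N ^ 2" "N ^ 4 = N * N ^ 3" "N ^ 5 = N * N ^ 4"
    "N ^ 6 = N * N ^ 5" "N ^ 7 = N * N ^ 6" "N ^ 8 = N * N ^ 7"
    by (simp_all add: eval_nat_numeral)
  show "1000 \<le> N" by (rule N_big(1))
  show "1000 * N \<le> N ^ 2" unfolding eqs(1) by (rule step)
  show "1000 * N ^ 2 \<le> N ^ 3" unfolding eqs(2) by (rule step)
  show "1000 * N ^ 3 \<le> N ^ 4" unfolding eqs(3) by (rule step)
  show "1000 * N ^ 4 \<le> N ^ 5" unfolding eqs(4) by (rule step)
  show "1000 * N ^ 5 \<le> N ^ 6" unfolding eqs(5) by (rule step)
  show "1000 * N ^ 6 \<le> N ^ 7" unfolding eqs(6) by (rule step)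
  show "1000 * N ^ 7 \<le> N ^ 8" unfolding eqs(7) by (rule step)
qed

section \<open>Cost of the list and adjacency functions\<close>

lemma fn_nth: "fn PP fNth [enc_list enc_bool l, enc_nat i] (enc_bool (i < length l \<and> l ! i)) (20 * (length l + 1))"
proof (induction l arbitrary: i)
  case Nil
  show ?case
    by (rule fnI, simp, simp add: prog_def, unfold enc_list.simps, (rule rr)+, simp_all)
next
  case (Cons a l)
  show ?case
  proof (cases i)
    case 0
    show ?thesis unfolding 0 enc_list.simps enc_nat.simps
      by (rule fnI, simp, simp add: prog_def, (rule rr)+, simp_all)
  next
    case (Suc j)
    show ?thesis unfolding Suc enc_list.simps enc_nat.simps
      by (rule fnI, simp, simp add: prog_def, (rule rr Cons)+, simp_all)
  qed
qed

text \<open>Reading beyond the end of a row gives False, which is correct because all arcs of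
  \<open>A\<close> lie inside \<open>{..<n}\<close>.\<close>

lemma fn_adj: "fn PP fNth [enc_list enc_bool (map (\<lambda>j. (i, j) \<in> A) [0..<n]), enc_nat k] (enc_bool ((i, k) \<in> A)) (20 * N)"
proof -
  have "(k < length (map (\<lambda>j. (i, j) \<in> A) [0..<n]) \<and> map (\<lambda>j. (i, j) \<in> A) [0..<n] ! k) = ((i, k) \<in> A)"
    using A_sub by auto
  then show ?thesis
    using fn_mono[OF fn_nth[of "map (\<lambda>j. (i, j) \<in> A) [0..<n]" k], of "20 * N"] N_big(2) by simp
qed

lemma fn_drop: "fn PP fDrop [enc_nat m, enc_list g Y] (enc_list g (drop m Y)) (10 * (m + 1))"
proof (induction m arbitrary: Y)
  case 0
  show ?case unfolding enc_nat.simps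
    by (rule fnI, simp, simp add: prog_def, (rule rr)+, simp_all)
next
  case (Suc m)
  show ?case unfolding enc_nat.simps
    by (rule fnI, simp, simp add: prog_def, (rule rr Suc)+, simp_all add: drop_Suc)
qed

text \<open>The comparison runs without multiplication: for each entry of \<open>X\<close> the
  program drops \<open>m\<close> entries of \<open>Y\<close>.\<close>

lemma fn_lt: "fn PP fLt [enc_nat m, enc_list f X, enc_list g Y] (enc_bool (m * length X < length Y))
   ((length X + 1) * (10 * m + 30))"
proof (induction X arbitrary: Y)
  case Nil
  show ?case
  proof (cases Y)
    case Nil
    show ?thesis unfolding Nil enc_list.simps
      by (rule fnI, simp, simp add: prog_def, (rule rr)+, simp_all)
  next
    case (Cons y Y)
    show ?thesis unfolding Cons enc_list.simps
      by (rule fnI, simp, simp add: prog_def, (rule rr)+, simp_all)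
  qed
next
  case (Cons x X)
  show ?case
  proof (cases Y)
    case Nil
    show ?thesis unfolding Nil enc_list.simps
      by (rule fnI, simp, simp add: prog_def, (rule rr)+, simp_all)
  next
    case Y: (Cons y Y')
    have 1: "fn PP fDrop [enc_nat m, Node (g y) (enc_list g Y')] (enc_list g (drop m Y)) (10 * (m + 1))"
      using fn_drop[of m g Y] Y by simp
    have 2: "m * length X < length (drop m Y) \<longleftrightarrow> m * length (x # X) < length Y" by auto
    show ?thesis unfolding Y enc_list.simps
      by (rule fnI, simp, simp add: prog_def, (rule rr Cons 1)+)
        (use 2 Y in \<open>simp_all add: algebra_simps\<close>)
  qed
qed

lemma fn_lt': "length X \<le> n \<Longrightarrow> m + 3 \<le> N \<Longrightarrow>
   fn PP fLt [enc_nat m, enc_list f X, enc_list g Y] (enc_bool (m * length X < length Y)) (10 * N ^ 2)"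
proof (rule fn_mono[OF fn_lt])
  assume "length X \<le> n" "m + 3 \<le> N"
  then have "(length X + 1) * (10 * m + 30) \<le> N * (10 * N)" using N_big(2) by (intro mult_le_mono) auto
  then show "(length X + 1) * (10 * m + 30) \<le> 10 * N ^ 2" by (simp add: power2_eq_square)
qed

lemma fn_nb1: "fn PP fNb [enc_bool b, enc_vertex v, el X] (el (nb b v X)) ((length X + 1) * (30 * N))"
proof (induction X)
  case Nil
  show ?case unfolding enc_list.simps
    by (rule fnI, simp, simp add: prog_def, (rule rr)+) (use N_big in \<open>simp_all add: nb_def\<close>)
next
  case (Cons x X)
  show ?case
  proof (cases b)
    case b: True
    have c: "enc_bool b = Node Leaf Leaf" using b by simp
    note IH = Cons[unfolded c]
    show ?thesis
    proof (cases "(v, x) \<in> A")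
      case a: True
      have 1: "fn PP fNth [enc_list enc_bool (map (\<lambda>j. (v, j) \<in> A) [0..<n]), enc_nat x] (Node Leaf Leaf) (20 * N)"
        using fn_adj[of v x] a by simp
      show ?thesis unfolding enc_list.simps c
        by (rule fnI, simp, simp add: prog_def, (rule rr 1 IH)+)
          (use N_pow(1) a b in \<open>simp_all add: nb_def algebra_simps\<close>)
    next
      case a: False
      have 1: "fn PP fNth [enc_list enc_bool (map (\<lambda>j. (v, j) \<in> A) [0..<n]), enc_nat x] Leaf (20 * N)"
        using fn_adj[of v x] a by simp
      show ?thesis unfolding enc_list.simps c
        by (rule fnI, simp, simp add: prog_def, (rule rr 1 IH)+)
          (use N_pow(1) a b in \<open>simp_all add: nb_def algebra_simps\<close>)
    qed
  next
    case b: False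
    have c: "enc_bool b = Leaf" using b by simp
    note IH = Cons[unfolded c]
    show ?thesis
    proof (cases "(x, v) \<in> A")
      case a: True
      have 1: "fn PP fNth [enc_list enc_bool (map (\<lambda>j. (x, j) \<in> A) [0..<n]), enc_nat v] (Node Leaf Leaf) (20 * N)"
        using fn_adj[of x v] a by simp
      show ?thesis unfolding enc_list.simps c
        by (rule fnI, simp, simp add: prog_def, (rule rr 1 IH)+)
          (use N_pow(1) a b in \<open>simp_all add: nb_def algebra_simps\<close>)
    next
      case a: False
      have 1: "fn PP fNth [enc_list enc_bool (map (\<lambda>j. (x, j) \<in> A) [0..<n]), enc_nat v] Leaf (20 * N)"
        using fn_adj[of x v] a by simp
      show ?thesis unfolding enc_list.simps c
        by (rule fnI, simp, simp add: prog_def, (rule rr 1 IH)+)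
          (use N_pow(1) a b in \<open>simp_all add: nb_def algebra_simps\<close>)
    qed
  qed
qed

lemma len_mult: "length X \<le> n \<Longrightarrow> (length X + 1) * c \<le> N * c"
  using N_big(2) by (intro mult_le_mono1) simp

lemma fn_nb: "length X \<le> n \<Longrightarrow> fn PP fNb [enc_bool b, enc_vertex v, el X] (el (nb b v X)) (30 * N ^ 2)"
  by (rule fn_mono[OF fn_nb1]) (use len_mult[of X "30 * N"] in \<open>simp add: power2_eq_square\<close>)

lemma fn_sel1:
  assumes W: "length W \<le> n" and t: "t + 3 \<le> N"
  shows "fn PP fSel [enc_nat t, enc_bool c, enc_bool b, el W, el V] (el (sel t c b W V)) ((length V + 1) * (50 * N ^ 2))"
proof (induction V)
  case Nil
  show ?case unfolding enc_list.simps
    by (rule fnI, simp, simp add: prog_def, (rule rr)+) (use N_pow in \<open>simp_all add: sel_def\<close>)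
next
  case (Cons v V)
  let ?q = "t * length (nb b v W) < length W"
  have nb: "fn PP fNb [enc_bool b, enc_vertex v, el W] (el (nb b v W)) (30 * N ^ 2)" by (rule fn_nb[OF W])
  have lt: "fn PP fLt [enc_nat t, el (nb b v W), el W] (enc_bool ?q) (10 * N ^ 2)"
    by (rule fn_lt'[OF _ t]) (use W length_nb_le[of b v W] in linarith)
  consider "c" "?q" | "c" "\<not> ?q" | "\<not> c" "?q" | "\<not> c" "\<not> ?q" by blast
  then show ?case
  proof cases
    case 1
    have c: "enc_bool c = Node Leaf Leaf" using 1 by simp
    note f = lt[unfolded eqTrueI[OF 1(2)] enc_bool.simps] Cons[unfolded c]
    show ?thesis unfolding enc_list.simps c
      by (rule fnI, simp, simp add: prog_def, (rule rr nb f)+)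
        (use N_pow 1 in \<open>simp_all add: sel_def\<close>)
  next
    case 2
    have c: "enc_bool c = Node Leaf Leaf" "enc_bool ?q = Leaf" using 2 by simp_all
    note f = lt[unfolded c] Cons[unfolded c]
    show ?thesis unfolding enc_list.simps c
      by (rule fnI, simp, simp add: prog_def, (rule rr nb f)+)
        (use N_pow 2 in \<open>simp_all add: sel_def\<close>)
  next
    case 3
    have c: "enc_bool c = Leaf" "enc_bool ?q = Node Leaf Leaf" using 3 by simp_all
    note f = lt[unfolded c] Cons[unfolded c]
    show ?thesis unfolding enc_list.simps c
      by (rule fnI, simp, simp add: prog_def, (rule rr nb f)+)
        (use N_pow 3 in \<open>simp_all add: sel_def\<close>)
  next
    case 4
    have c: "enc_bool c = Leaf" "enc_bool ?q = Leaf" using 4 by simp_all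
    note f = lt[unfolded c] Cons[unfolded c]
    show ?thesis unfolding enc_list.simps c
      by (rule fnI, simp, simp add: prog_def, (rule rr nb f)+)
        (use N_pow 4 in \<open>simp_all add: sel_def\<close>)
  qed
qed

lemma fn_sel: "length W \<le> n \<Longrightarrow> length V \<le> n \<Longrightarrow> t + 3 \<le> N \<Longrightarrow>
   fn PP fSel [enc_nat t, enc_bool c, enc_bool b, el W, el V] (el (sel t c b W V)) (50 * N ^ 3)"
  by (rule fn_mono[OF fn_sel1]) (use len_mult[of V "50 * N ^ 2"] in \<open>simp_all add: power3_eq_cube power2_eq_square mult_ac\<close>)


section \<open>Cost of the search for dense pairs\<close>

lemma cells_N: "cells (enc_nat (emb_at h)) \<le> N" "cells (enc_nat (orient_at h)) \<le> N" "cells (enc_nat (restrict_at h)) \<le> N"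
  "cells (enc_nat (prune_at h)) \<le> N" "cells (enc_nat (2 * h + 1)) \<le> N" "cells (enc_nat (h + 2)) \<le> N"
  "cells (enc_nat 1) \<le> N"
proof -
  have "1 * (2 * h + 1) \<le> 4 * prune_at h * (2 * h + 1)" "1 * prune_at h \<le> 4 * (2 * h + 1) * prune_at h"
    using h_pos by (intro mult_le_mono1; simp add: prune_at_def)+
  then have "prune_at h \<le> restrict_at h" "restrict_at h \<le> orient_at h" "orient_at h \<le> emb_at h" "2 * h + 1 \<le> restrict_at h" "8 * restrict_at h = emb_at h"
    by (simp_all add: restrict_at_def orient_at_def emb_at_def mult_ac)
  then show "cells (enc_nat (emb_at h)) \<le> N" "cells (enc_nat (orient_at h)) \<le> N" "cells (enc_nat (restrict_at h)) \<le> N"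
    "cells (enc_nat (prune_at h)) \<le> N" "cells (enc_nat (2 * h + 1)) \<le> N" "cells (enc_nat (h + 2)) \<le> N"
    "cells (enc_nat 1) \<le> N"
    unfolding cells_enc_nat using N_big(1,3) by simp_all
qed

lemma enc_item_pair: "enc_item (bs, W) = Node (enc_list enc_bool bs) (el W)"
  by (simp add: enc_item_def)

lemma enc_lists_pair: "enc_lists (X, Y) = Node (el X) (el Y)"
  by (simp add: enc_lists_def)

lemma advance_snd: "P' \<in> set (advance v Qs) \<Longrightarrow> \<exists>Q\<in>set Qs. length (snd P') \<le> length (snd Q)"
proof -
  assume "P' \<in> set (advance v Qs)"
  then obtain Q where "Q \<in> set Qs" "snd P' = nb (fst Q \<noteq> [] \<and> hd (fst Q)) v (snd Q)"
    unfolding advance_def case_prod_unfold set_map by (elim imageE) (metis snd_conv)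
  then show ?thesis by (intro bexI[of _ Q]) simp_all
qed

lemma fn_advance:
  "(\<And>P. P \<in> set Ps \<Longrightarrow> length (snd P) \<le> n) \<Longrightarrow>
   fn PP fAdvance [enc_vertex v, enc_list enc_item Ps] (enc_list enc_item (advance v Ps)) ((length Ps + 1) * (40 * N ^ 2))"
proof (induction Ps)
  case Nil
  show ?case unfolding enc_list.simps
    by (rule fnI, simp, simp add: prog_def, (rule rr)+) (use N_pow in \<open>simp_all add: advance_def\<close>)
next
  case (Cons P Ps)
  have 1: "fn PP fNb [enc_bool (fst P \<noteq> [] \<and> hd (fst P)), enc_vertex v, el (snd P)] (el (nb (fst P \<noteq> [] \<and> hd (fst P)) v (snd P))) (30 * N ^ 2)"
    by (rule fn_nb) (use Cons.prems in simp)
  have 2: "fn PP fAdvance [enc_vertex v, enc_list enc_item Ps] (enc_list enc_item (advance v Ps)) ((length Ps + 1) * (40 * N ^ 2))"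
    by (rule Cons.IH) (use Cons.prems in simp)
  show ?case unfolding enc_list.simps
    by (rule fnI, simp, simp add: prog_def, (rule rr 1 2)+)
      (use N_pow in \<open>simp_all add: advance_def case_prod_unfold enc_item_pair\<close>)
qed

text \<open>\<open>length Ps\<close> counts the filtering steps for the current vertex; the
  quadratic term pays for all later vertices, each of which is filtered against the whole remaining
  list.\<close>

lemma fn_emb:
  "length V \<le> n \<Longrightarrow> (\<And>P. P \<in> set Ps \<union> set Qs \<Longrightarrow> length (snd P) \<le> n) \<Longrightarrow> length Qs \<le> h \<Longrightarrow>
   fn PP fEmb [el V, enc_list enc_item Ps, enc_list enc_item Qs] (enc_outcome (emb V Ps Qs))
     ((length Ps + 1 + length Qs * (length Qs + 1)) * (400 * N ^ 3))"
proof (induction V Ps Qs rule: emb.induct)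
  case (1 Qs)
  show ?case unfolding enc_list.simps
    by (rule fnI, simp, simp add: prog_def, (rule rr)+) (use N_pow in \<open>simp_all add: enc_outcome_def enc_lists_def\<close>)
next
  case (2 v V Qs)
  have adv: "fn PP fAdvance [enc_vertex v, enc_list enc_item Qs] (enc_list enc_item (advance v Qs)) (40 * N ^ 3)"
  proof (rule fn_mono[OF fn_advance])
    show "length (snd P) \<le> n" if "P \<in> set Qs" for P using 2 that by simp
    have "length Qs + 1 \<le> N" using "2.prems"(3) N_big(3) by linarith
    then have "(length Qs + 1) * (40 * N ^ 2) \<le> N * (40 * N ^ 2)" by (rule mult_le_mono1)
    then show "(length Qs + 1) * (40 * N ^ 2) \<le> 40 * N ^ 3" by (simp add: power3_eq_cube power2_eq_square mult_ac)
  qed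
  show ?case
  proof (cases "advance v Qs")
    case Nil
    have e2: "fn PP fEmb2 [Leaf] (enc_outcome (False, [], [])) 10"
      by (rule fnI, simp, simp add: prog_def, (rule rr)+, simp_all add: enc_outcome_def enc_lists_def)
    show ?thesis unfolding enc_list.simps
      by (rule fnI, simp, simp add: prog_def, (rule rr adv[unfolded Nil enc_list.simps] e2)+)
        (use N_pow Nil in \<open>simp_all add: add_mult_distrib\<close>)
  next
    case (Cons P Ps)
    have len: "length Qs = Suc (length Ps)"
      using arg_cong[OF Cons, of length] by (simp add: advance_def)
    have small: "length (snd P') \<le> n" if "P' \<in> set (advance v Qs)" for P'
      using advance_snd[OF that] "2.prems"(2) by (meson UnI2 order_trans)
    let ?c = "(length Ps + 1 + length Ps * (length Ps + 1)) * (400 * N ^ 3)"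
    have IH: "fn PP fEmb [el (snd P), enc_list enc_item Ps, enc_list enc_item Ps] (enc_outcome (emb (snd P) Ps Ps)) ?c"
      by (rule "2.IH"[OF Cons]) (use small Cons "2.prems"(3) len in auto)
    have e2: "fn PP fEmb2 [Node (enc_item P) (enc_list enc_item Ps)] (enc_outcome (emb (snd P) Ps Ps)) (?c + 20)"
      by (rule fnI, simp, simp add: prog_def, (rule rr IH)+, simp_all)
    show ?thesis unfolding enc_list.simps
      by (rule fnI, simp, simp add: prog_def, (rule rr adv[unfolded Cons enc_list.simps] e2)+)
        (use N_pow Cons len in \<open>simp_all add: algebra_simps\<close>)
  qed
next
  case (3 V P Ps Qs)
  let ?b = "fst P \<noteq> [] \<and> hd (fst P)"
  let ?s = "\<lambda>c. sel (emb_at h) c ?b (snd P) V"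
  let ?q = "emb_at h * length (?s True) < length (?s False)"
  have P: "length (snd P) \<le> n" using "3.prems"(2)[of P] by simp
  have e: "emb_at h + 3 \<le> N" using N_big(3) by linarith
  have s: "fn PP fSel [enc_nat (emb_at h), enc_bool c, enc_bool ?b, el (snd P), el V] (el (?s c)) (50 * N ^ 3)" for c
    by (rule fn_sel[OF P "3.prems"(1) e])
  note ss = s[of True, unfolded enc_bool.simps] s[of False, unfolded enc_bool.simps]
  have lt: "fn PP fLt [enc_nat (emb_at h), el (?s True), el (?s False)] (enc_bool ?q) (10 * N ^ 2)"
    by (rule fn_lt'[OF _ e]) (rule order_trans[OF length_sel_le "3.prems"(1)])
  show ?case
  proof (cases ?q)
    case True
    have IH: "fn PP fEmb [el (?s False), enc_list enc_item Ps, enc_list enc_item Qs] (enc_outcome (emb (?s False) Ps Qs))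
       ((length Ps + 1 + length Qs * (length Qs + 1)) * (400 * N ^ 3))"
    proof (rule "3.IH"[OF refl refl refl True])
      show "length (?s False) \<le> n" by (rule order_trans[OF length_sel_le "3.prems"(1)])
    qed (use "3.prems"(2,3) in auto)
    have c: "enc_bool ?q = Node Leaf Leaf" unfolding eqTrueI[OF True] by simp
    show ?thesis unfolding enc_list.simps
      by (rule fnI, simp, simp add: prog_def, (rule rr ss lt[unfolded c] IH)+)
        (use N_pow cells_N True in \<open>simp_all add: Let_def algebra_simps\<close>)
  next
    case False
    have c: "enc_bool ?q = Leaf" using False by simp
    show ?thesis unfolding enc_list.simps
      by (rule fnI, simp, simp add: prog_def, (rule rr ss lt[unfolded c])+)
        (use N_pow cells_N False in \<open>simp_all add: Let_def algebra_simps enc_outcome_def enc_lists_def\<close>)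
  qed
qed

lemma runs_rights: "runs PP env e (enc_list f xs) s \<Longrightarrow> runs PP env ((RightE ^^ j) e) (enc_list f (drop j xs)) (s + j)"
proof (induction j)
  case (Suc j)
  have "runs PP env (RightE ((RightE ^^ j) e)) (enc_list f (tl (drop j xs))) (s + j + 1)"
    by (rule runs_right[OF Suc.IH[OF Suc.prems] rpart_intros(3)])
  then show ?case by (simp add: drop_Suc tl_drop)
qed simp

lemma fn_every: "fn PP fEvery [enc_list f S] (enc_list f (every h S)) ((length S + 1) * (2 * N))"
proof (induction "length S" arbitrary: S rule: less_induct)
  case less
  show ?case
  proof (cases S)
    case Nil
    show ?thesis unfolding Nil enc_list.simps
      by (rule fnI, simp, simp add: prog_def, (rule rr)+) (use N_pow in simp_all)
  next
    case (Cons x xs)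
    have IH: "fn PP fEvery [enc_list f (drop (h - Suc 0) xs)] (enc_list f (every h (drop (h - Suc 0) xs))) ((length xs + 1) * (2 * N))"
      by (rule fn_mono[OF less]) (use Cons in auto)
    have r: "runs PP [Node (f x) (enc_list f xs)] ((RightE ^^ (h - Suc 0)) (RightE X0)) (enc_list f (drop (h - Suc 0) xs)) (1 + 1 + (h - Suc 0))"
      by (rule runs_rights, (rule rr)+)
    have h: "2 * h + 10 \<le> N" using N_big(3) by linarith
    show ?thesis unfolding Cons enc_list.simps
      by (rule fnI, simp, simp add: prog_def, (rule r rr IH)+) (use N_pow h in simp_all)
  qed
qed

lemma runs_parts:
  assumes "length S \<le> n"
  shows "(\<And>j. j \<in> set js \<Longrightarrow> j < h) \<Longrightarrow> runs PP [el S] (parts_expr h pat js)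
    (enc_list enc_item (map (\<lambda>j. (pat j, every h (drop j S))) js)) (length js * (5 * N ^ 2) + 1)"
proof (induction js)
  case Nil
  show ?case by (simp add: parts_expr_def runs_leaf[unfolded One_nat_def])
next
  case (Cons j js)
  have j: "j < h" "2 * h + 10 \<le> N" using Cons.prems[of j] N_big(3) by auto
  have r: "runs PP [el S] ((RightE ^^ j) X0) (el (drop j S)) (1 + j)" by (rule runs_rights, rule rr)
  have e: "fn PP fEvery [el (drop j S)] (el (every h (drop j S))) (2 * N ^ 2)"
  proof (rule fn_mono[OF fn_every])
    have "length (drop j S) \<le> n" using assms by simp
    from len_mult[OF this, of "2 * N"] show "(length (drop j S) + 1) * (2 * N) \<le> 2 * N ^ 2"
      by (simp only: power2_eq_square mult_ac)
  qed
  have eqn: "parts_expr h pat (j # js) =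
      NodeE (NodeE (quote (enc_list enc_bool (pat j))) (CallE fEvery [(RightE ^^ j) X0])) (parts_expr h pat js)"
    by (simp add: parts_expr_def)
  have q: "runs PP [el S] (quote (enc_list enc_bool (pat j))) (enc_list enc_bool (pat j)) N"
    by (rule runs_mono[OF runs_quote N_big(4)[OF j(1)]])
  have IH: "runs PP [el S] (parts_expr h pat js)
    (enc_list enc_item (map (\<lambda>j. (pat j, every h (drop j S))) js)) (length js * (5 * N ^ 2) + 1)"
    by (rule Cons.IH) (use Cons.prems in simp)
  show ?case
    unfolding eqn by (rule runsI, (rule q r IH e rr)+) (use N_pow j in \<open>simp_all add: enc_item_pair\<close>)
qed

lemma fn_orient:
  "length (fst (snd r)) \<le> n \<Longrightarrow> length (snd (snd r)) \<le> n \<Longrightarrow> fn PP fOrient [enc_outcome r] (enc_lists (orient r)) (60 * N ^ 3)"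
proof -
  assume l: "length (fst (snd r)) \<le> n" "length (snd (snd r)) \<le> n"
  have e: "orient_at h + 3 \<le> N" using N_big(3) by (simp add: orient_at_def emb_at_def)
  obtain b X Y where r: "r = (b, X, Y)" by (metis prod_cases3)
  have s: "fn PP fSel [enc_nat (orient_at h), Node Leaf Leaf, Leaf, el X, el Y] (el (sel (orient_at h) True False X Y)) (50 * N ^ 3)"
    using fn_sel[of X Y "orient_at h" True False] l e r by simp
  show ?thesis
  proof (cases b)
    case True
    show ?thesis unfolding r enc_outcome_def fst_conv snd_conv enc_lists_def eqTrueI[OF True] enc_bool.simps
      by (intro fnI, simp, simp add: prog_def, (rule rr s)+)
        (use N_pow cells_N in \<open>simp_all add: orient_def\<close>)
  next
    case False
    show ?thesis unfolding r enc_outcome_def fst_conv snd_conv enc_lists_def Eq_FalseI[OF False] enc_bool.simps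
      by (intro fnI, simp, simp add: prog_def, (rule rr s)+)
        (use N_pow cells_N in \<open>simp_all add: orient_def\<close>)
  qed
qed

lemma emb_len:
  "length V \<le> M \<Longrightarrow> (\<And>P. P \<in> set Ps \<union> set Qs \<Longrightarrow> length (snd P) \<le> M) \<Longrightarrow>
   length (fst (snd (emb V Ps Qs))) \<le> M \<and> length (snd (snd (emb V Ps Qs))) \<le> M"
proof (induction V Ps Qs rule: emb.induct)
  case (2 v V Qs)
  show ?case
  proof (cases "advance v Qs")
    case (Cons P Ps)
    have "length (snd P') \<le> M" if P': "P' \<in> set (advance v Qs)" for P'
      using advance_snd[OF P'] "2.prems"(2) by (meson UnI2 order_trans)
    then show ?thesis using "2.IH"[OF Cons] Cons by simp
  qed simp
next
  case (3 V P Ps Qs)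
  let ?b = "fst P \<noteq> [] \<and> hd (fst P)"
  let ?s = "\<lambda>c. sel (emb_at h) c ?b (snd P) V"
  have s: "length (?s c) \<le> M" for c by (rule order_trans[OF length_sel_le "3.prems"(1)])
  show ?case
  proof (cases "emb_at h * length (?s True) < length (?s False)")
    case True
    then show ?thesis using "3.IH"[OF refl refl refl True s] "3.prems"(2) by (simp add: Let_def)
  next
    case False
    then show ?thesis using s[of True] "3.prems"(2)[of P] by (simp add: Let_def)
  qed
qed simp

lemma length_every_le: "length (every k xs) \<le> length xs"
proof (induction k xs rule: every.induct)
  case (2 k x xs)
  then have "length (every k (drop (k - 1) xs)) \<le> length xs" by simp
  then show ?case by simp
qed simp

lemma fn_dense_pair:
  assumes S: "length S \<le> n"
  shows "fn PP fDensePair [el S] (enc_lists (dense_pair S)) (2 * N ^ 6)"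
proof -
  obtain P Ps where Ps: "parts S = P # Ps"
    using h_pos by (cases "parts S") (auto simp: parts_def)
  have len: "length (parts S) = h" by (simp add: parts_def)
  have small: "length (snd Q) \<le> n" if Q: "Q \<in> set (parts S)" for Q
  proof -
    obtain j where "snd Q = every h (drop j S)" using Q by (auto simp: parts_def)
    then have "length (snd Q) \<le> length (drop j S)" by (simp only: length_every_le)
    then show ?thesis using S by simp
  qed
  let ?r = "emb (snd P) Ps Ps"
  have "length Ps + 1 + length Ps * (length Ps + 1) \<le> N + N * N"
    using len Ps N_big(3) by (intro add_mono mult_le_mono) auto
  also have "\<dots> \<le> 2 * (N * N)" using N_big(1) by simp
  finally have l: "length Ps + 1 + length Ps * (length Ps + 1) \<le> 2 * (N * N)" .
  have e: "fn PP fEmb [el (snd P), enc_list enc_item Ps, enc_list enc_item Ps] (enc_outcome ?r) (N ^ 6)"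
  proof (rule fn_mono[OF fn_emb])
    have "(length Ps + 1 + length Ps * (length Ps + 1)) * (400 * N ^ 3) \<le> 2 * (N * N) * (400 * N ^ 3)"
      by (rule mult_le_mono1[OF l])
    also have "N ^ 5 = N * N * N ^ 3" by (simp add: eval_nat_numeral)
    then have "2 * (N * N) * (400 * N ^ 3) = 800 * N ^ 5" by simp
    also have "\<dots> \<le> N ^ 6" using N_pow by linarith
    finally show "(length Ps + 1 + length Ps * (length Ps + 1)) * (400 * N ^ 3) \<le> N ^ 6" .
  qed (use small Ps len in auto)
  have rl: "length (fst (snd ?r)) \<le> n \<and> length (snd (snd ?r)) \<le> n"
    by (rule emb_len) (use small Ps in auto)
  have o: "fn PP fOrient [enc_outcome ?r] (enc_lists (orient ?r)) (60 * N ^ 3)" by (rule fn_orient) (use rl in auto)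
  have p: "runs PP [el S] (parts_expr h pat [0..<h]) (Node (enc_item P) (enc_list enc_item Ps)) (5 * N ^ 3)"
  proof (rule runsI[OF runs_parts[OF S]])
    show "enc_list enc_item (map (\<lambda>j. (pat j, every h (drop j S))) [0..<h]) = Node (enc_item P) (enc_list enc_item Ps)"
      using Ps by (simp add: parts_def)
    have "Suc h * (5 * N ^ 2) \<le> N * (5 * N ^ 2)" using N_big(3) by (intro mult_le_mono1) linarith
    moreover have "N * (5 * N ^ 2) = 5 * N ^ 3" by (simp add: power3_eq_cube power2_eq_square)
    moreover have "Suc h * (5 * N ^ 2) = h * (5 * N ^ 2) + 5 * N ^ 2" by simp
    ultimately show "length [0..<h] * (5 * N ^ 2) + 1 \<le> 5 * N ^ 3"
      using N_pow(1,2) by simp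
  qed simp
  have q: "fn PP fParts [Node (enc_item P) (enc_list enc_item Ps)] (enc_lists (orient ?r)) (N ^ 6 + N ^ 4)"
    by (rule fnI, simp, simp add: prog_def, (rule rr e o)+) (use N_pow in simp_all)
  show ?thesis
    by (rule fnI, simp, simp add: prog_def, (rule p rr q)+)
      (use N_pow Ps in \<open>simp_all add: dense_pair_def\<close>)
qed


section \<open>Cost of the stages, of the exploration and of the recursion\<close>

lemma fn_prune:
  assumes "length V \<le> n" "\<And>z. z \<in> set zs \<Longrightarrow> length (fst z) \<le> n \<and> length (snd z) \<le> n"
  shows "fn PP fPrune [el V, enc_list enc_lists zs] (el (prune V zs)) ((length zs + 1) * (110 * N ^ 3))"
  using assms
proof (induction zs arbitrary: V)
  case Nil
  show ?case unfolding enc_list.simps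
    by (rule fnI, simp, simp add: prog_def, (rule rr)+) (use N_pow in simp_all)
next
  case (Cons z zs)
  have p: "prune_at h + 3 \<le> N" using cells_N(4) N_big(1) by (simp add: cells_enc_nat)
  let ?V1 = "sel (prune_at h) True False (fst z) V"
  have l1: "length ?V1 \<le> n" by (rule order_trans[OF length_sel_le Cons.prems(1)])
  let ?V2 = "sel (prune_at h) True False (snd z) ?V1"
  have l2: "length ?V2 \<le> n" by (rule order_trans[OF length_sel_le l1])
  have z: "length (fst z) \<le> n" "length (snd z) \<le> n" using Cons.prems(2)[of z] by auto
  note f = fn_sel[OF z(1) Cons.prems(1) p, of True False, unfolded enc_bool.simps]
    fn_sel[OF z(2) l1 p, of True False, unfolded enc_bool.simps]
  have IH: "fn PP fPrune [el ?V2, enc_list enc_lists zs] (el (prune ?V2 zs)) ((length zs + 1) * (110 * N ^ 3))"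
    by (rule Cons.IH[OF l2]) (use Cons.prems(2) in simp)
  show ?case unfolding enc_list.simps
    by (rule fnI, simp, simp add: prog_def, (rule rr f IH)+) (use N_pow cells_N in simp_all)
qed

lemma length_common_le: "length (common b P S) \<le> length S"
proof (induction b P S rule: common.induct)
  case (2 b x xs S)
  from order_trans[OF this length_nb_le] show ?case by simp
qed simp

lemma fn_common:
  "length S \<le> n \<Longrightarrow> fn PP fCommon [enc_bool b, el P, el S] (el (common b P S)) ((length P + 1) * (40 * N ^ 2))"
proof (induction P arbitrary: S)
  case Nil
  show ?case unfolding enc_list.simps
    by (rule fnI, simp, simp add: prog_def, (rule rr)+) (use N_pow in simp_all)
next
  case (Cons x P)
  have IH: "fn PP fCommon [enc_bool b, el P, el (nb b x S)] (el (common b P (nb b x S))) ((length P + 1) * (40 * N ^ 2))"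
    by (rule Cons.IH[OF order_trans[OF length_nb_le Cons.prems]])
  show ?case unfolding enc_list.simps
    by (rule fnI, simp, simp add: prog_def, (rule rr fn_nb[OF Cons.prems] IH)+) (use N_pow in simp_all)
qed

lemma fn_app: "fn PP fApp [enc_list f X, enc_list f Y] (enc_list f (X @ Y)) ((length X + 1) * 20)"
proof (induction X)
  case Nil
  show ?case unfolding enc_list.simps
    by (rule fnI, simp, simp add: prog_def, (rule rr)+) (use N_pow in simp_all)
next
  case (Cons x X)
  show ?case unfolding enc_list.simps
    by (rule fnI, simp, simp add: prog_def, (rule rr Cons)+) (use N_pow in simp_all)
qed

lemma fn_longer:
  assumes "length X \<le> 2 * n"
  shows "fn PP fLonger [el X, el Y] (el (longer X Y)) (20 * N ^ 2)"
proof -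
  have lt: "fn PP fLt [enc_nat 1, el X, el Y] (enc_bool (length X < length Y)) (80 * N)"
  proof (rule fn_conv[OF fn_lt])
    have "length X + 1 \<le> 2 * N" using assms N_big(2) by simp
    then have "(length X + 1) * 40 \<le> 2 * N * 40" by (rule mult_le_mono1)
    then show "(length X + 1) * (10 * 1 + 30) \<le> 80 * N" by simp
  qed simp
  show ?thesis
  proof (cases "length X < length Y")
    case True
    then have c: "enc_bool (length X < length Y) = Node Leaf Leaf" by simp
    show ?thesis
      by (rule fnI, simp, simp add: prog_def del: One_nat_def enc_nat.simps quote.simps, (rule rr lt[unfolded c])+)
        (use N_pow cells_N(7) True in \<open>simp_all add: longer_def del: One_nat_def enc_nat.simps cells.simps\<close>)
  next
    case False
    then have c: "enc_bool (length X < length Y) = Leaf" by simp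
    show ?thesis
      by (rule fnI, simp, simp add: prog_def del: One_nat_def enc_nat.simps quote.simps, (rule rr lt[unfolded c])+)
        (use N_pow cells_N(7) False in \<open>simp_all add: longer_def del: One_nat_def enc_nat.simps cells.simps\<close>)
  qed
qed

text \<open>One bound for all inputs with a given fuel, since the next level calls
  \<open>tau\<close> on sets that are not known in advance.\<close>

definition tau_cost :: "nat \<Rightarrow> nat \<Rightarrow> bool" where
  "tau_cost d B \<longleftrightarrow> (\<forall>S. set S \<subseteq> {..<n} \<longrightarrow> length S \<le> n \<longrightarrow>
     fn PP fTau [enc_nat d, el S] (el (tau d S)) B)"

lemma tau_cost: "tau_cost d B \<Longrightarrow> set S \<subseteq> {..<n} \<Longrightarrow> length S \<le> n \<Longrightarrow>
    fn PP fTau [enc_nat d, el S] (el (tau d S)) B"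
  by (simp add: tau_cost_def)

lemma tau_len: "set S \<subseteq> {..<n} \<Longrightarrow> length (tau d S) \<le> n"
  using length_le_card[OF T, of "tau d S"] tau_sound[of d] by (auto simp: sound_def)

lemma set_common_sub: "set (common b P S) \<subseteq> set S"
  by (auto simp: set_common)

lemma len_cand:
  assumes "set S \<subseteq> {..<n}" "length P \<le> n"
  shows "length (cand (tau d) P S) \<le> 2 * n"
proof -
  have "length (tau d (common b P S)) \<le> n" for b
    by (rule tau_len) (use assms set_common_sub[of b P S] in blast)
  from this[of True] this[of False] show ?thesis using assms(2) by (simp add: cand_def length_longer)
qed

lemma fn_cand:
  assumes B: "tau_cost d B" and S: "set S \<subseteq> {..<n}" "length S \<le> n" and P: "length P \<le> n"
  shows "fn PP fCand [el P, el S, enc_nat d] (el (cand (tau d) P S)) (2 * B + N ^ 4)"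
proof -
  have c: "set (common b P S) \<subseteq> {..<n}" "length (common b P S) \<le> n" for b
    using S(1) set_common_sub[of b P S] order_trans[OF length_common_le S(2)] by blast+
  let ?t = "\<lambda>b. tau d (common b P S)"
  have cm: "fn PP fCommon [enc_bool b, el P, el S] (el (common b P S)) (40 * N ^ 3)" for b
    by (rule fn_mono[OF fn_common[OF S(2)]])
      (use len_mult[OF P, of "40 * N ^ 2"] in \<open>simp add: power3_eq_cube power2_eq_square mult_ac\<close>)
  have tl: "length (?t b) \<le> n" for b by (rule tau_len[OF c(1)])
  have a1: "fn PP fApp [el P, el (?t True)] (el (P @ ?t True)) (20 * N)"
    by (rule fn_mono[OF fn_app]) (use len_mult[OF P, of 20] in simp)
  have a2: "fn PP fApp [el (?t False), el P] (el (?t False @ P)) (20 * N)"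
    by (rule fn_mono[OF fn_app]) (use len_mult[OF tl[of False], of 20] in simp)
  have l: "fn PP fLonger [el (P @ ?t True), el (?t False @ P)] (el (cand (tau d) P S)) (20 * N ^ 2)"
    unfolding cand_def by (rule fn_longer) (use P tl[of True] in simp)
  note f = cm[of True, unfolded enc_bool.simps] cm[of False, unfolded enc_bool.simps] tau_cost[OF B c]
  show ?thesis
    by (rule fnI, simp, simp add: prog_def, (rule rr f a1 a2 l)+) (use N_pow in simp_all)
qed

lemma len_explore:
  "set S \<subseteq> {..<n} \<Longrightarrow> length P \<le> n \<Longrightarrow> length (explore (tau d) S r vs P) \<le> 2 * n"
proof (induction "tau d" S r vs P rule: explore.induct)
  case (3 S r v vs P)
  have "length (nb b v P) \<le> n" for b by (rule order_trans[OF length_nb_le "3.prems"(2)])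
  then show ?case using 3 by (simp add: length_longer)
qed (simp_all add: len_cand)

text \<open>Each vertex of \<open>vs\<close> triggers two explorations with one step less, each of
  which runs through \<open>S\<close> and so costs at most \<open>N\<close> times the unit cost of
  that budget. The overhead fits into as much again, hence the factor \<open>4 * N\<close> per
  step.\<close>

lemma fn_explore:
  assumes B: "tau_cost d B" and S: "set S \<subseteq> {..<n}" "length S \<le> n"
  shows "length P \<le> n \<Longrightarrow> fn PP fExplore [enc_nat r, el vs, el P, el S, enc_nat d] (el (explore (tau d) S r vs P))
    ((length vs + 1) * ((4 * N) ^ r * (2 * B + N ^ 5)))"
proof (induction r arbitrary: vs P)
  case 0
  have e: "explore (tau d) S 0 vs P = cand (tau d) P S" by (cases vs) auto
  have "1 * (2 * B + N ^ 5) \<le> (length vs + 1) * (2 * B + N ^ 5)" by (intro mult_le_mono1) simp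
  then have g: "2 * B + N ^ 5 \<le> (length vs + 1) * ((4 * N) ^ 0 * (2 * B + N ^ 5))" by simp
  show ?case
  proof (cases vs)
    case Nil
    show ?thesis unfolding e enc_nat.simps Nil enc_list.simps
      by (rule fnI, simp, simp add: prog_def, (rule rr fn_cand[OF B S 0])+) (use N_pow in simp_all)
  next
    case (Cons w ws)
    have "fn PP fExplore [Leaf, Node (enc_vertex w) (el ws), el P, el S, enc_nat d] (el (cand (tau d) P S)) (2 * B + N ^ 5)"
      by (rule fnI, simp, simp add: prog_def, (rule rr fn_cand[OF B S 0])+) (use N_pow in simp_all)
    from fn_mono[OF this g] show ?thesis unfolding e by (simp add: Cons)
  qed
next
  case (Suc r)
  define C where "C = (4 * N) ^ r * (2 * B + N ^ 5)"
  have C: "N ^ 5 \<le> C"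
  proof -
    have "1 * (2 * B + N ^ 5) \<le> C" unfolding C_def
      using N_big(1) by (intro mult_le_mono1 one_le_power) simp
    then show ?thesis by simp
  qed
  have CN: "N ^ 5 \<le> N * C" "C \<le> N * C" using C N_big(1) by (cases N; simp)+
  have eC: "(4 * N) ^ Suc r * (2 * B + N ^ 5) = 4 * (N * C)" by (simp add: C_def mult_ac)
  have "fn PP fExplore [enc_nat (Suc r), el vs, el P, el S, enc_nat d] (el (explore (tau d) S (Suc r) vs P))
     ((length vs + 1) * (4 * (N * C)))"
  proof (induction vs)
    case Nil
    show ?case unfolding enc_nat.simps enc_list.simps explore.simps
    proof (rule fnI, simp, simp add: prog_def, (rule rr fn_cand[OF B S Suc.prems])+)
      have "2 * B + N ^ 5 \<le> C" using mult_le_mono1[of 1 "(4 * N) ^ r" "2 * B + N ^ 5"] N_big(1)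
        by (simp add: C_def)
      then have "6 + (2 * B + N ^ 4) \<le> 4 * (N * C)" using CN N_pow by linarith
      then show "1 + (1 + (1 + (1 + 0)) + (2 * B + N ^ 4) + 1) + 1 \<le> (length [] + 1) * (4 * (N * C))"
        by simp
    qed simp_all
  next
    case (Cons w ws)
    have l: "length (nb b w P) \<le> n" for b by (rule order_trans[OF length_nb_le Suc.prems])
    let ?e = "\<lambda>b. explore (tau d) S r S (nb b w P)"
    have e: "fn PP fExplore [enc_nat r, el S, el (nb b w P), el S, enc_nat d] (el (?e b)) (N * C)" for b
      by (rule fn_mono[OF Suc.IH[OF l]]) (use len_mult[OF S(2), of C] in \<open>simp add: C_def\<close>)
    have le: "length (?e b) \<le> 2 * n" for b by (rule len_explore[OF S(1) l])
    have l1: "fn PP fLonger [el (?e True), el (?e False)] (el (longer (?e True) (?e False))) (20 * N ^ 2)"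
      by (intro fn_longer len_explore S l)
    have l2: "fn PP fLonger [el (longer (?e True) (?e False)), el (explore (tau d) S (Suc r) ws P)]
      (el (explore (tau d) S (Suc r) (w # ws) P)) (20 * N ^ 2)"
      unfolding explore.simps
      by (intro fn_longer) (use le[of True] le[of False] in \<open>simp add: length_longer\<close>)
    note f = fn_nb[OF Suc.prems, of True, unfolded enc_bool.simps] fn_nb[OF Suc.prems, of False, unfolded enc_bool.simps]
      Cons[unfolded enc_nat.simps] e l1 l2
    have big: "100 * N ^ 2 + 40 \<le> 2 * (N * C)" using CN N_pow by linarith
    show ?case unfolding enc_nat.simps enc_list.simps
      by (rule fnI, simp, simp add: prog_def, (rule rr f)+) (use N_pow big in \<open>simp_all add: algebra_simps\<close>)
  qed
  then show ?case unfolding eC .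
qed

definition explore_bound :: "nat \<Rightarrow> nat" where
  "explore_bound B = N * ((4 * N) ^ (h + 2) * (2 * B + N ^ 5))"

lemma explore_bound_ge: "2 * B + N ^ 5 \<le> explore_bound B"
proof -
  have "1 * (2 * B + N ^ 5) \<le> (4 * N) ^ (h + 2) * (2 * B + N ^ 5)"
    using N_big(1) by (intro mult_le_mono1 one_le_power) simp
  then have "1 * (2 * B + N ^ 5) \<le> N * ((4 * N) ^ (h + 2) * (2 * B + N ^ 5))"
    using N_big(1) by (intro mult_le_mono) simp_all
  then show ?thesis by (simp add: explore_bound_def)
qed

lemma fn_explore_all:
  assumes B: "tau_cost d B" and S: "set S \<subseteq> {..<n}" "length S \<le> n"
  shows "(\<And>z. z \<in> set zs \<Longrightarrow> length (snd z) \<le> n) \<Longrightarrow>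
    fn PP fExploreAll [enc_list enc_lists zs, el S, enc_nat d] (el (explore_all (tau d) S zs))
      ((length zs + 1) * (2 * explore_bound B))"
proof (induction zs)
  case Nil
  show ?case unfolding enc_list.simps
    by (rule fnI, simp, simp add: prog_def, (rule rr)+)
      (use N_pow explore_bound_ge[of B] in simp_all)
next
  case (Cons z zs)
  have z: "length (snd z) \<le> n" using Cons.prems by simp
  have IH: "fn PP fExploreAll [enc_list enc_lists zs, el S, enc_nat d] (el (explore_all (tau d) S zs)) ((length zs + 1) * (2 * explore_bound B))"
    by (rule Cons.IH) (use Cons.prems in simp)
  have e: "fn PP fExplore [enc_nat (h + 2), el S, el (snd z), el S, enc_nat d] (el (explore (tau d) S (h + 2) S (snd z))) (explore_bound B)"
    unfolding explore_bound_def
    by (rule fn_mono[OF fn_explore[OF B S z]]) (rule len_mult[OF S(2)])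
  have l: "fn PP fLonger [el (explore (tau d) S (h + 2) S (snd z)), el (explore_all (tau d) S zs)]
     (el (explore_all (tau d) S (z # zs))) (20 * N ^ 2)"
    unfolding explore_all.simps by (intro fn_longer len_explore S z)
  show ?case unfolding enc_list.simps
    by (rule fnI, simp, simp add: prog_def del: enc_nat.simps quote.simps add_2_eq_Suc' add_2_eq_Suc, (rule rr e IH l)+)
      (use N_pow cells_N(6) explore_bound_ge[of B] in \<open>simp_all add: algebra_simps del: enc_nat.simps cells.simps add_2_eq_Suc' add_2_eq_Suc\<close>)
qed

lemma length_prune_le: "length (prune V zs) \<le> length V"
  by (simp add: prune_eq)

lemma dense_pair_len: "length (fst (dense_pair S)) \<le> length S" "length (snd (dense_pair S)) \<le> length S"
proof -
  have small: "length (snd Q) \<le> length S" if Q: "Q \<in> set (parts S)" for Q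
  proof -
    obtain j where "snd Q = every h (drop j S)" using Q by (auto simp: parts_def)
    then have "length (snd Q) \<le> length (drop j S)" by (simp only: length_every_le)
    then show ?thesis by simp
  qed
  have "length (fst (dense_pair S)) \<le> length S \<and> length (snd (dense_pair S)) \<le> length S"
  proof (cases "parts S")
    case (Cons P Ps)
    obtain b X Y where e: "emb (snd P) Ps Ps = (b, X, Y)" by (metis prod_cases3)
    have "length X \<le> length S \<and> length Y \<le> length S"
      using emb_len[of "snd P" "length S" Ps Ps] small Cons e by simp
    moreover from this have "length (sel (orient_at h) True False X Y) \<le> length S"
      using order_trans[OF length_sel_le] by blast
    ultimately show ?thesis using Cons e by (simp add: dense_pair_def orient_def)
  qed (simp add: dense_pair_def)
  then show "length (fst (dense_pair S)) \<le> length S" "length (snd (dense_pair S)) \<le> length S" by auto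
qed

lemma length_restrict_le: "length (restrict X L Y) \<le> length Y"
  unfolding restrict_def by (rule order_trans[OF length_sel_le length_sel_le])

lemma stages_len:
  "set S \<subseteq> {..<n} \<Longrightarrow> length S \<le> n \<Longrightarrow> z \<in> set (stages (tau d) r S) \<Longrightarrow> length (fst z) \<le> n \<and> length (snd z) \<le> n"
proof (induction r arbitrary: S)
  case (Suc r)
  let ?X = "fst (dense_pair S)" and ?Y = "snd (dense_pair S)"
  let ?B = "restrict ?X (tau d ?X) ?Y"
  let ?zs = "stages (tau d) r ?B"
  have X: "set ?X \<subseteq> {..<n}" using dense_pair_subset(1)[of S] Suc.prems(1) by blast
  have "length (prune ?X ?zs) \<le> n" using length_prune_le[of ?X ?zs] dense_pair_len(1)[of S] Suc.prems(2) by linarith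
  moreover have "length (prune (tau d ?X) ?zs) \<le> n" using length_prune_le[of "tau d ?X" ?zs] tau_len[OF X, of d] by linarith
  moreover have "z \<in> set ?zs \<Longrightarrow> length (fst z) \<le> n \<and> length (snd z) \<le> n"
  proof (rule Suc.IH)
    show "set ?B \<subseteq> {..<n}" using restrict_subset[of ?X "tau d ?X" ?Y] dense_pair_subset(2)[of S] Suc.prems(1) by blast
    show "length ?B \<le> n" using length_restrict_le[of ?X "tau d ?X" ?Y] dense_pair_len(2)[of S] Suc.prems(2) by linarith
  qed
  moreover have "z = (prune ?X ?zs, prune (tau d ?X) ?zs) \<or> z \<in> set ?zs" using Suc.prems(3) by (simp add: Let_def)
  ultimately show ?case by (elim disjE) auto
qed simp

lemma length_stages: "length (stages f r S) = r"
  by (induction r arbitrary: S) (auto simp: Let_def)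

lemma fn_stages:
  assumes B: "tau_cost d B"
  shows "set S \<subseteq> {..<n} \<Longrightarrow> length S \<le> n \<Longrightarrow> r \<le> 2 * h + 1 \<Longrightarrow>
    fn PP fStages [enc_nat r, el S, enc_nat d] (enc_list enc_lists (stages (tau d) r S)) ((r + 1) * (B + N ^ 7))"
proof (induction r arbitrary: S)
  case 0
  show ?case unfolding enc_nat.simps
    by (rule fnI, simp, simp add: prog_def, (rule rr)+) (use N_pow in simp_all)
next
  case (Suc r)
  let ?X = "fst (dense_pair S)" and ?Y = "snd (dense_pair S)"
  let ?L = "tau d ?X"
  let ?B1 = "sel (restrict_at h) True True ?X ?Y"
  let ?B = "restrict ?X ?L ?Y"
  let ?zs = "stages (tau d) r ?B"
  have X: "set ?X \<subseteq> {..<n}" "length ?X \<le> n"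
    using dense_pair_subset(1)[of S] dense_pair_len(1)[of S] Suc.prems(1,2) by (blast, linarith)
  have Y: "set ?Y \<subseteq> {..<n}" "length ?Y \<le> n"
    using dense_pair_subset(2)[of S] dense_pair_len(2)[of S] Suc.prems(1,2) by (blast, linarith)
  have L: "length ?L \<le> n" by (rule tau_len[OF X(1)])
  have B1: "length ?B1 \<le> n" by (rule order_trans[OF length_sel_le Y(2)])
  have Bs: "set ?B \<subseteq> {..<n}" "length ?B \<le> n"
    using restrict_subset[of ?X ?L ?Y] length_restrict_le[of ?X ?L ?Y] Y by (blast, linarith)
  have m: "restrict_at h + 3 \<le> N" using cells_N(3) N_big(1) by (simp add: cells_enc_nat)
  have zl: "length ?zs \<le> 2 * h" using Suc.prems(3) by (simp add: length_stages)
  have zn: "length (fst z) \<le> n \<and> length (snd z) \<le> n" if "z \<in> set ?zs" for z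
    by (rule stages_len[OF Bs that])
  have pr: "fn PP fPrune [el V, enc_list enc_lists ?zs] (el (prune V ?zs)) (110 * N ^ 4)" if "length V \<le> n" for V
  proof (rule fn_mono[OF fn_prune[OF that zn]])
    have "(length ?zs + 1) * (110 * N ^ 3) \<le> N * (110 * N ^ 3)" using zl N_big(3) by (intro mult_le_mono1) linarith
    also have "N ^ 4 = N * N ^ 3" by (simp add: eval_nat_numeral)
    then have "N * (110 * N ^ 3) = 110 * N ^ 4" by simp
    finally show "(length ?zs + 1) * (110 * N ^ 3) \<le> 110 * N ^ 4" .
  qed
  have s1: "fn PP fSel [enc_nat (restrict_at h), Node Leaf Leaf, Node Leaf Leaf, el ?X, el ?Y] (el ?B1) (50 * N ^ 3)"
    using fn_sel[OF X(2) Y(2) m, of True True] by simp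
  have s2: "fn PP fSel [enc_nat (restrict_at h), Node Leaf Leaf, Node Leaf Leaf, el ?L, el ?B1] (el ?B) (50 * N ^ 3)"
    using fn_sel[OF L B1 m, of True True] by (simp add: restrict_def)
  have IH: "fn PP fStages [enc_nat r, el ?B, enc_nat d] (enc_list enc_lists ?zs) ((r + 1) * (B + N ^ 7))"
    by (rule Suc.IH[OF Bs]) (use Suc.prems(3) in simp)
  have st: "stages (tau d) (Suc r) S = (prune ?X ?zs, prune ?L ?zs) # ?zs" by (simp add: Let_def)
  have c4: "fn PP fStages4 [el ?X, el ?L, enc_list enc_lists ?zs] (enc_list enc_lists (stages (tau d) (Suc r) S)) (N ^ 5)"
    unfolding st enc_list.simps enc_lists_pair
    by (rule fnI, simp, simp add: prog_def, (rule rr pr[OF X(2)] pr[OF L])+) (use N_pow in simp_all)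
  have c3: "fn PP fStages3 [el ?L, el ?X, el ?Y, enc_nat r, enc_nat d] (enc_list enc_lists (stages (tau d) (Suc r) S))
      ((r + 1) * (B + N ^ 7) + 2 * N ^ 5)"
    by (rule fnI, simp, simp add: prog_def, (rule rr s1 s2 IH c4)+) (use N_pow cells_N in simp_all)
  have c2: "fn PP fStages2 [enc_lists (dense_pair S), enc_nat r, enc_nat d] (enc_list enc_lists (stages (tau d) (Suc r) S))
      ((r + 1) * (B + N ^ 7) + 3 * N ^ 5 + B)"
    by (rule fnI, simp, simp add: prog_def, (rule rr tau_cost[OF B X] c3)+) (use N_pow in simp_all)
  show ?case unfolding enc_nat.simps
    by (rule fnI, simp, simp add: prog_def, (rule rr fn_dense_pair[OF Suc.prems(2)] c2)+) (use N_pow in simp_all)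
qed

lemma tau_cost_0: "tau_cost 0 10"
proof -
  have "fn PP fTau [enc_nat 0, el S] (el (tau 0 S)) 10" for S
    unfolding enc_nat.simps
    by (rule fnI, simp, simp add: prog_def, (rule rr)+) simp_all
  then show ?thesis by (simp add: tau_cost_def)
qed

text \<open>For fixed H a level makes only polynomially many recursive calls, so it multiplies the
  cost by a polynomial in \<open>N\<close>, up to an additive power of \<open>N\<close>.\<close>

lemma tau_cost_Suc:
  assumes B: "tau_cost d B"
  shows "tau_cost (Suc d) (4 * N * explore_bound B + N ^ 8)"
proof -
  have "fn PP fTau [enc_nat (Suc d), el S] (el (tau (Suc d) S)) (4 * N * explore_bound B + N ^ 8)"
    if S: "set S \<subseteq> {..<n}" "length S \<le> n" for S
  proof (cases S)
    case Nil
    show ?thesis unfolding enc_nat.simps Nil enc_list.simps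
      by (rule fnI, simp, simp add: prog_def, (rule rr)+) (use N_pow in simp_all)
  next
    case (Cons x S')
    have n1: "length [x] \<le> n" using S Cons by simp
    let ?zs = "stages (tau d) (2 * h + 1) S"
    have zn: "length (snd z) \<le> n" if "z \<in> set ?zs" for z
      using stages_len[OF S that] by simp
    have c: "fn PP fCand [Node (enc_vertex x) Leaf, Node (enc_vertex x) (el S'), enc_nat d] (el (cand (tau d) [x] S)) (2 * B + N ^ 4)"
      using fn_cand[OF B S n1] Cons by simp
    have st: "fn PP fStages [enc_nat (2 * h + 1), Node (enc_vertex x) (el S'), enc_nat d] (enc_list enc_lists ?zs) (N * (B + N ^ 7))"
    proof -
      have "(2 * h + 1 + 1) * (B + N ^ 7) \<le> N * (B + N ^ 7)" using N_big(3) by (intro mult_le_mono1) linarith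
      then show ?thesis using fn_mono[OF fn_stages[OF B S order.refl]] Cons by simp
    qed
    have ex: "fn PP fExploreAll [enc_list enc_lists ?zs, Node (enc_vertex x) (el S'), enc_nat d] (el (explore_all (tau d) S ?zs)) (N * (2 * explore_bound B))"
    proof -
      have "(length ?zs + 1) * (2 * explore_bound B) \<le> N * (2 * explore_bound B)"
        using N_big(3) unfolding length_stages by (intro mult_le_mono1) linarith
      then show ?thesis using fn_mono[OF fn_explore_all[OF B S zn]] Cons by simp
    qed
    have l: "fn PP fLonger [el (cand (tau d) [x] S), el (explore_all (tau d) S ?zs)] (el (tau (Suc d) S)) (20 * N ^ 2)"
      unfolding Cons tau.simps unfolding Cons[symmetric] by (intro fn_longer len_cand S n1)
    have e8: "N * (B + N ^ 7) = N * B + N ^ 8" by (simp add: distrib_left eval_nat_numeral)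
    have nb: "N * (2 * B + N ^ 5) \<le> N * explore_bound B" by (intro mult_le_mono2 explore_bound_ge)
    have "1 * B \<le> N * B" using N_big(1) by (intro mult_le_mono1) simp
    moreover have "N * (2 * B + N ^ 5) = 2 * (N * B) + N ^ 6" by (simp add: distrib_left eval_nat_numeral)
    ultimately have fin: "2 * B + N * B + N ^ 6 + 2 * (N * explore_bound B) \<le> 4 * (N * explore_bound B)"
      using nb by linarith
    show ?thesis unfolding enc_nat.simps Cons enc_list.simps
      unfolding Cons[symmetric]
      by (rule fnI, simp, simp add: prog_def del: enc_nat.simps quote.simps One_nat_def, (rule rr c st[unfolded e8] ex l)+)
        (use N_pow cells_N(5) fin in \<open>simp_all add: mult_ac del: enc_nat.simps cells.simps One_nat_def\<close>)
  qed
  then show ?thesis by (simp add: tau_cost_def)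
qed

end

section \<open>The logarithmic depth and the colouring program\<close>

fun half :: "'a list \<Rightarrow> 'a list" where
  "half (x # y # xs) = x # half xs"
| "half xs = []"

text \<open>The number of binary digits of \<open>n\<close>, which the program finds by halving the
  vertex list until it is empty.\<close>

fun lg :: "nat \<Rightarrow> nat" where
  "lg n = (if n = 0 then 0 else Suc (lg (n div 2)))"

declare lg.simps [simp del]

lemma length_half: "length (half xs) = length xs div 2"
  by (induction xs rule: half.induct) auto

lemma lg_lower: "n < 2 ^ lg n"
proof (induction n rule: lg.induct)
  case (1 n)
  show ?case
  proof (cases "n = 0")
    case False
    have "n < 2 * Suc (n div 2)" using div_mult_mod_eq[of n 2] mod_less_divisor[of 2 n] by simp
    also have "\<dots> \<le> 2 * 2 ^ lg (n div 2)" using 1 False by simp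
    finally show ?thesis using False by (simp add: lg.simps[of n])
  qed (simp add: lg.simps)
qed

lemma lg_upper: "n > 0 \<Longrightarrow> 2 ^ lg n \<le> 2 * n"
proof (induction n rule: lg.induct)
  case (1 n)
  show ?case
  proof (cases "n div 2 = 0")
    case True
    then show ?thesis using 1 by (simp add: lg.simps[of n] lg.simps[of 0])
  next
    case False
    then have "2 ^ lg (n div 2) \<le> 2 * (n div 2)" using 1 by simp
    then show ?thesis using 1 by (simp add: lg.simps[of n])
  qed
qed

context search_prog
begin

lemma fn_eq: "fn PP fEq [enc_nat i, enc_nat j] (enc_bool (i = j)) ((i + 1) * 20)"
proof (induction i arbitrary: j)
  case 0
  show ?case unfolding enc_nat.simps
    by (cases j; simp only: enc_nat.simps; rule fnI, simp, simp add: prog_def, (rule rr)+) simp_all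
next
  case (Suc i)
  show ?case
  proof (cases j)
    case 0
    show ?thesis unfolding 0 enc_nat.simps
      by (rule fnI, simp, simp add: prog_def, (rule rr)+) simp_all
  next
    case j: (Suc j')
    show ?thesis unfolding j enc_nat.simps
      by (rule fnI, simp, simp add: prog_def, (rule rr Suc)+) simp_all
  qed
qed

lemma fn_mem:
  assumes x: "x < n"
  shows "fn PP fMem [enc_vertex x, el p] (enc_bool (x \<in> set p)) ((length p + 1) * (30 * N))"
proof (induction p)
  case Nil
  show ?case unfolding enc_list.simps
    by (rule fnI, simp, simp add: prog_def, (rule rr)+) (use N_pow in simp_all)
next
  case (Cons y p)
  have e: "fn PP fEq [enc_nat x, enc_nat y] (enc_bool (x = y)) (20 * N)"
    by (rule fn_mono[OF fn_eq]) (use x N_big(2) in simp)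
  show ?case
  proof (cases "x = y")
    case True
    then have c: "enc_bool (x = y) = Node Leaf Leaf" by simp
    show ?thesis unfolding enc_list.simps
      by (rule fnI, simp, simp add: prog_def, (rule rr e[unfolded c])+) (use N_pow True in simp_all)
  next
    case False
    then have c: "enc_bool (x = y) = Leaf" by simp
    show ?thesis unfolding enc_list.simps
      by (rule fnI, simp, simp add: prog_def, (rule rr e[unfolded c] Cons)+) (use N_pow False in simp_all)
  qed
qed

lemma fn_diff:
  assumes p: "length p \<le> n"
  shows "set S \<subseteq> {..<n} \<Longrightarrow> fn PP fDiff [el S, el p] (el (filter (\<lambda>y. y \<notin> set p) S)) ((length S + 1) * (40 * N ^ 2))"
proof (induction S)
  case Nil
  show ?case unfolding enc_list.simps
    by (rule fnI, simp, simp add: prog_def, (rule rr)+) (use N_pow in simp_all)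
next
  case (Cons x S)
  have m: "fn PP fMem [enc_vertex x, el p] (enc_bool (x \<in> set p)) (30 * N ^ 2)"
    by (rule fn_mono[OF fn_mem]) (use Cons.prems len_mult[OF p, of "30 * N"] in \<open>simp_all add: power2_eq_square\<close>)
  have IH: "fn PP fDiff [el S, el p] (el (filter (\<lambda>y. y \<notin> set p) S)) ((length S + 1) * (40 * N ^ 2))"
    by (rule Cons.IH) (use Cons.prems in simp)
  show ?case
  proof (cases "x \<in> set p")
    case True
    then have c: "enc_bool (x \<in> set p) = Node Leaf Leaf" by simp
    show ?thesis unfolding enc_list.simps
      by (rule fnI, simp, simp add: prog_def, (rule rr m[unfolded c] IH)+) (use N_pow True in simp_all)
  next
    case False
    then have c: "enc_bool (x \<in> set p) = Leaf" by simp
    show ?thesis unfolding enc_list.simps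
      by (rule fnI, simp, simp add: prog_def, (rule rr m[unfolded c] IH)+) (use N_pow False in simp_all)
  qed
qed

lemma fn_color:
  assumes B: "tau_cost d B"
  shows "set S \<subseteq> {..<n} \<Longrightarrow> length S \<le> n \<Longrightarrow>
    fn PP fColor [enc_list f cs, enc_nat d, el S] (enc_list el (color cs d S)) ((length cs + 1) * (B + N ^ 4))"
proof (induction cs arbitrary: S)
  case Nil
  show ?case unfolding enc_list.simps
    by (rule fnI, simp, simp add: prog_def, (rule rr)+) (use N_pow in simp_all)
next
  case (Cons c cs)
  show ?case
  proof (cases S)
    case Nil
    show ?thesis unfolding Nil enc_list.simps
      by (rule fnI, simp, simp add: prog_def, (rule rr)+) (use N_pow in simp_all)
  next
    case S: (Cons x S')
    let ?p = "tau d S"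
    let ?R = "filter (\<lambda>y. y \<notin> set ?p) S"
    have e: "color (c # cs) d S = ?p # color cs d ?R" unfolding S color.simps ..
    have lp: "length ?p \<le> n" by (rule tau_len[OF Cons.prems(1)])
    have df: "fn PP fDiff [el S, el ?p] (el ?R) (40 * N ^ 3)"
      by (rule fn_mono[OF fn_diff[OF lp Cons.prems(1)]])
        (use len_mult[OF Cons.prems(2), of "40 * N ^ 2"] in \<open>simp add: power3_eq_cube power2_eq_square mult_ac\<close>)
    have R: "set ?R \<subseteq> {..<n}" "length ?R \<le> n"
      using Cons.prems order_trans[OF length_filter_le Cons.prems(2)] by (auto)
    have c2: "fn PP fColor2 [el ?p, enc_list f cs, enc_nat d, el S] (enc_list el (color (c # cs) d S))
       ((length cs + 1) * (B + N ^ 4) + 50 * N ^ 3)"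
      unfolding e enc_list.simps
      by (rule fnI, simp, simp add: prog_def, (rule rr df Cons.IH[OF R])+) (use N_pow in simp_all)
    have t: "fn PP fTau [enc_nat d, Node (enc_vertex x) (el S')] (el ?p) B"
      using tau_cost[OF B Cons.prems] S by simp
    show ?thesis unfolding enc_list.simps S
      unfolding S[symmetric]
      by (rule fnI, simp, simp add: prog_def, (rule rr t c2[unfolded S enc_list.simps, folded S])+) (use N_pow in simp_all)
  qed
qed

lemma fn_attach:
  "fn PP fAttach [enc_list (enc_list enc_bool) (map (\<lambda>i. map (\<lambda>j. (i, j) \<in> A) [0..<n]) [i..<i + k]), enc_nat i]
    (el [i..<i + k]) (20 * (k + 1))"
proof (induction k arbitrary: i)
  case 0
  have u: "[i..<i + 0] = []" by simp
  show ?case unfolding u list.map enc_list.simps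
    by (rule fnI, simp, simp add: prog_def, (rule rr)+) simp_all
next
  case (Suc k)
  have u: "[i..<i + Suc k] = i # [Suc i..<Suc i + k]" by (simp add: upt_conv_Cons)
  have e: "enc_vertex i = Node (enc_nat i) (enc_list enc_bool (map (\<lambda>j. (i, j) \<in> A) [0..<n]))" by (rule enc_vertex_def)
  show ?case unfolding u list.map enc_list.simps e
    by (rule fnI, simp, simp add: prog_def, (rule rr Suc[of "Suc i", unfolded enc_nat.simps])+) simp_all
qed

lemma fn_half: "fn PP fHalf [enc_list f S] (enc_list f (half S)) ((length S + 1) * 20)"
proof (induction S rule: half.induct)
  case (1 x y xs)
  show ?case unfolding enc_list.simps half.simps
    by (rule fnI, simp, simp add: prog_def, (rule rr 1)+) simp_all
next
  case "2_1"
  show ?case unfolding enc_list.simps half.simps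
    by (rule fnI, simp, simp add: prog_def, (rule rr)+) simp_all
next
  case ("2_2" v)
  show ?case unfolding enc_list.simps half.simps
    by (rule fnI, simp, simp add: prog_def, (rule rr)+) simp_all
qed

lemma fn_lg: "length S \<le> n \<Longrightarrow> fn PP fLg [enc_list f S] (enc_nat (lg (length S))) ((length S + 1) * (40 * N))"
proof (induction "length S" arbitrary: S rule: less_induct)
  case less
  show ?case
  proof (cases S)
    case Nil
    have z: "enc_nat (lg (length S)) = Leaf" unfolding Nil by (simp add: lg.simps)
    show ?thesis unfolding z unfolding Nil enc_list.simps
      by (rule fnI, simp, simp add: prog_def, (rule rr)+) (use N_pow in simp_all)
  next
    case (Cons x S')
    have z: "lg (length S) = Suc (lg (length (half S)))"
      unfolding length_half using lg.simps[of "length S"] Cons by simp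
    have hs: "fn PP fHalf [Node (f x) (enc_list f S')] (enc_list f (half S)) (20 * N)"
      using fn_mono[OF fn_half[of f S], of "20 * N"] less.prems N_big(2) Cons by simp
    have lt: "length (half S) < length S" unfolding length_half using Cons by simp
    have IH: "fn PP fLg [enc_list f (half S)] (enc_nat (lg (length (half S)))) ((length (half S) + 1) * (40 * N))"
      by (rule less.hyps[OF lt]) (use lt less.prems in simp)
    have "(length (half S) + 1) * (40 * N) \<le> length S * (40 * N)" using lt by (intro mult_le_mono1) simp
    then have g: "(length (half S) + 1) * (40 * N) + 40 * N \<le> (length S + 1) * (40 * N)" by simp
    have "fn PP fLg [Node (f x) (enc_list f S')] (enc_nat (Suc (lg (length (half S))))) ((length (half S) + 1) * (40 * N) + 40 * N)"
      unfolding enc_nat.simps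
      by (rule fnI, simp, simp add: prog_def, (rule rr hs IH)+) (use N_pow in simp_all)
    from fn_mono[OF this g] show ?thesis unfolding z unfolding Cons enc_list.simps .
  qed
qed

lemma fn_strip: "fn PP fStrip [el p] (enc_list enc_nat p) ((length p + 1) * 20)"
proof (induction p)
  case Nil
  show ?case unfolding enc_list.simps
    by (rule fnI, simp, simp add: prog_def, (rule rr)+) simp_all
next
  case (Cons x p)
  show ?case unfolding enc_list.simps
    by (rule fnI, simp, simp add: prog_def, (rule rr Cons)+) simp_all
qed

lemma fn_strips:
  "(\<And>p. p \<in> set ps \<Longrightarrow> length p \<le> n) \<Longrightarrow> fn PP fStrips [enc_list el ps] (enc_sets ps) ((length ps + 1) * (40 * N))"
  unfolding enc_sets_def
proof (induction ps)
  case Nil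
  show ?case unfolding enc_list.simps
    by (rule fnI, simp, simp add: prog_def, (rule rr)+) (use N_pow in simp_all)
next
  case (Cons p ps)
  have s: "fn PP fStrip [el p] (enc_list enc_nat p) (20 * N)"
    by (rule fn_mono[OF fn_strip]) (use len_mult[of p 20] Cons.prems in simp)
  have IH: "fn PP fStrips [enc_list el ps] (enc_list (enc_list enc_nat) ps) ((length ps + 1) * (40 * N))"
    by (rule Cons.IH) (use Cons.prems in simp)
  show ?case unfolding enc_list.simps
    by (rule fnI, simp, simp add: prog_def, (rule rr s IH)+) (use N_pow in simp_all)
qed

lemma color_lengths: "set S \<subseteq> {..<n} \<Longrightarrow> p \<in> set (color cs d S) \<Longrightarrow> length p \<le> n"
proof (induction cs arbitrary: S)
  case (Cons c cs)
  show ?case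
  proof (cases S)
    case S: (Cons x S')
    let ?R = "filter (\<lambda>y. y \<notin> set (tau d S)) S"
    have "color (c # cs) d S = tau d S # color cs d ?R" unfolding S color.simps ..
    then consider "p = tau d S" | "p \<in> set (color cs d ?R)" using Cons.prems(2) by auto
    then show ?thesis
    proof cases
      case 1
      then show ?thesis using tau_len[OF Cons.prems(1)] by simp
    next
      case 2
      then show ?thesis by (rule Cons.IH[rotated]) (use Cons.prems(1) in auto)
    qed
  qed (use Cons in simp)
qed simp

lemma length_color_le: "length (color cs d S) \<le> length cs"
  by (induction cs d S rule: color.induct) auto

lemma computes_color:
  assumes B: "tau_cost (lg n) B"
  shows "\<exists>t\<le>N * (B + N ^ 4) + N ^ 4. computes PP (enc_digraph n A) (enc_sets (color [0..<n] (lg n) [0..<n])) t"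
proof -
  let ?S = "[0..<n]"
  let ?ps = "color ?S (lg n) ?S"
  have at: "fn PP fAttach [enc_digraph n A, Leaf] (el ?S) (20 * N)"
    using fn_mono[OF fn_attach[of 0 n], of "20 * N"] N_big(2) by (simp add: enc_digraph_def)
  have l: "fn PP fLg [el ?S] (enc_nat (lg n)) (N ^ 3)"
  proof -
    have "(n + 1) * (40 * N) \<le> N * (40 * N)" by (intro mult_le_mono1 N_big)
    also have "\<dots> = 40 * N ^ 2" by (simp add: power2_eq_square)
    also have "\<dots> \<le> N ^ 3" using N_pow by linarith
    finally show ?thesis using fn_mono[OF fn_lg[of ?S enc_vertex], of "N ^ 3"] by simp
  qed
  have c: "fn PP fColor [el ?S, enc_nat (lg n), el ?S] (enc_list el ?ps) (N * (B + N ^ 4))"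
  proof (rule fn_mono[OF fn_color[OF B]])
    have "(n + 1) * (B + N ^ 4) \<le> N * (B + N ^ 4)" by (intro mult_le_mono1 N_big)
    then show "(length ?S + 1) * (B + N ^ 4) \<le> N * (B + N ^ 4)" by simp
  qed auto
  have st: "fn PP fStrips [enc_list el ?ps] (enc_sets ?ps) (40 * N ^ 2)"
  proof (rule fn_mono[OF fn_strips])
    show "length p \<le> n" if "p \<in> set ?ps" for p by (rule color_lengths[OF _ that]) auto
    have "length ?ps + 1 \<le> N" using length_color_le[of ?S "lg n" ?S] N_big(2) by simp
    then have "(length ?ps + 1) * (40 * N) \<le> N * (40 * N)" by (rule mult_le_mono1)
    then show "(length ?ps + 1) * (40 * N) \<le> 40 * N ^ 2" by (simp add: power2_eq_square)
  qed
  have m2: "fn PP fMain2 [el ?S] (enc_sets ?ps) (N * (B + N ^ 4) + 2 * N ^ 3)"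
    by (rule fnI, simp, simp add: prog_def, (rule rr l c st)+) (use N_pow in simp_all)
  have m: "fn PP fMain [enc_digraph n A] (enc_sets ?ps) (N * (B + N ^ 4) + 3 * N ^ 3)"
    by (rule fnI, simp, simp add: prog_def, (rule rr at m2[unfolded One_nat_def])+) (use N_pow in simp_all)
  have "runs PP [enc_digraph n A] (CallE fMain [VarE 0]) (enc_sets ?ps) (N * (B + N ^ 4) + N ^ 4)"
    by (rule runsI, (rule rr m)+) (use N_pow in simp_all)
  then show ?thesis unfolding runs_def computes_def by blast
qed

text \<open>In the exponent, \<open>2 * (h + 2)\<close> bounds the powers of \<open>4 * N\<close> in
  the exploration, 7 comes from two factors \<open>N\<close> and the \<open>N ^ 5\<close> next to
  the recursive cost, and 2 more absorb the numerical constants.\<close>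

definition base :: nat where "base = N ^ (2 * h + 13)"

lemma tau_cost_mono: "tau_cost d B \<Longrightarrow> B \<le> B' \<Longrightarrow> tau_cost d B'"
  unfolding tau_cost_def by (meson fn_mono)

lemma tau_cost_power: "tau_cost d (base ^ (d + 1))"
proof (induction d)
  case 0
  have "N ^ 1 \<le> base" unfolding base_def using N_big(1) by (intro power_increasing) auto
  then have "10 \<le> base ^ (0 + 1)" using N_big(1) by simp
  then show ?case by (rule tau_cost_mono[OF tau_cost_0])
next
  case (Suc d)
  define B where "B = base ^ (d + 1)"
  have B1: "1 \<le> B" unfolding B_def base_def using N_big(1) by (intro one_le_power) simp
  have "4 * N * explore_bound B + N ^ 8 \<le> base * B"
  proof -
    have "N ^ 5 * 1 \<le> N ^ 5 * B" by (intro mult_le_mono2 B1)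
    moreover have "1 * B \<le> N ^ 5 * B" using N_big(1) by (intro mult_le_mono1 one_le_power) simp
    ultimately have "2 * B + N ^ 5 \<le> 3 * (N ^ 5 * B)" by linarith
    moreover have "(4 * N) ^ (h + 2) \<le> (N * N) ^ (h + 2)" using N_big(1) by (intro power_mono mult_le_mono1) auto
    ultimately have "(4 * N) ^ (h + 2) * (2 * B + N ^ 5) \<le> (N * N) ^ (h + 2) * (3 * (N ^ 5 * B))"
      by (rule mult_le_mono[rotated])
    then have "4 * N * explore_bound B \<le> 4 * N * (N * ((N * N) ^ (h + 2) * (3 * (N ^ 5 * B))))"
      unfolding explore_bound_def by (intro mult_le_mono2)
    also have "\<dots> = 12 * (N ^ (2 * h + 11) * B)"
    proof -
      have "(N * N) ^ (h + 2) = N ^ (2 * h + 4)"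
        unfolding power_mult_distrib power_add[symmetric] by (rule arg_cong[where f = "power N"]) simp
      moreover have "N * (N * (N ^ (2 * h + 4) * N ^ 5)) = N ^ (2 * h + 11)"
      proof -
        have "N ^ (2 * h + 11) = N ^ (2 * h + 4) * N ^ 7"
          unfolding power_add[symmetric] by (rule arg_cong[where f = "power N"]) simp
        moreover have "N ^ 7 = N * (N * N ^ 5)" by (simp add: eval_nat_numeral)
        ultimately show ?thesis by simp
      qed
      ultimately show ?thesis by (simp add: mult_ac)
    qed
    finally have 1: "4 * N * explore_bound B \<le> 12 * (N ^ (2 * h + 11) * B)" .
    have "N ^ 8 * 1 \<le> N ^ (2 * h + 11) * B"
      using N_big(1) B1 by (intro mult_le_mono power_increasing) auto
    with 1 have "4 * N * explore_bound B + N ^ 8 \<le> 13 * (N ^ (2 * h + 11) * B)" by linarith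
    also have "\<dots> \<le> (N * N) * (N ^ (2 * h + 11) * B)"
      using N_big(1) mult_le_mono[of 13 N 1 N] by (intro mult_le_mono1) simp
    also have "\<dots> = base * B"
    proof -
      have "2 * h + 13 = Suc (Suc (2 * h + 11))" by simp
      then have "base = N * (N * N ^ (2 * h + 11))" unfolding base_def by (simp only: power_Suc)
      then show ?thesis by simp
    qed
    finally show ?thesis .
  qed
  then have "4 * N * explore_bound (base ^ (d + 1)) + N ^ 8 \<le> base ^ (Suc d + 1)" by (simp add: B_def)
  then show ?case by (rule tau_cost_mono[OF tau_cost_Suc[OF Suc.IH]])
qed

end

section \<open>The number of parts\<close>

lemma transitive_set_list:
  assumes T: "tournament V A" and p: "search.transitive_list A p"
  shows "transitive_set A (set p)"
proof -
  interpret search A 0 "\<lambda>_. []" .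
  have "distinct p" by (rule transitive_list_distinct[OF T p])
  have nth: "(p ! i, p ! j) \<in> A \<longleftrightarrow> i < j" if "i < length p" "j < length p" for i j
    using p that tournament_asym[OF T] unfolding transitive_list_def sorted_wrt_iff_nth_less
    by (metis nat_neq_iff)
  define idx where "idx x = (THE i. i < length p \<and> p ! i = x)" for x
  have idx: "idx (p ! i) = i" if "i < length p" for i
    unfolding idx_def using that \<open>distinct p\<close> by (intro the_equality) (auto simp: nth_eq_iff_index_eq)
  have "A \<inter> set p \<times> set p \<subseteq> measure idx"
  proof
    fix e assume "e \<in> A \<inter> set p \<times> set p"
    then obtain i j where "i < length p" "j < length p" "e = (p ! i, p ! j)" "e \<in> A"
      by (auto simp: in_set_conv_nth)
    then show "e \<in> measure idx" using nth idx by auto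
  qed
  then have "wf (A \<inter> set p \<times> set p)" by (rule wf_subset[OF wf_measure])
  then show ?thesis unfolding transitive_set_def by (rule wf_acyclic)
qed

context search
begin

text \<open>With positive fuel every part is nonempty, so each round removes a vertex and
  \<open>length S\<close> rounds suffice.\<close>

lemma color_partition:
  assumes T: "tournament V A" and d: "d > 0"
  shows "length S \<le> length cs \<Longrightarrow> distinct S \<Longrightarrow> set S \<subseteq> V \<Longrightarrow>
    (\<forall>p\<in>set (color cs d S). transitive_list p \<and> p \<noteq> [] \<and> distinct p) \<and> (\<Union>p\<in>set (color cs d S). set p) = set S \<and>
    distinct (concat (color cs d S))"
proof (induction cs arbitrary: S)
  case (Cons c cs)
  show ?case
  proof (cases S)
    case S: (Cons x S')
    let ?p = "tau d S"
    let ?R = "filter (\<lambda>y. y \<notin> set ?p) S"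
    obtain d' where d': "d = Suc d'" using d by (cases d) auto
    have e: "color (c # cs) d S = ?p # color cs d ?R" unfolding S color.simps ..
    have p: "transitive_list ?p" "set ?p \<subseteq> set S" using tau_sound[of d] by (auto simp: sound_def)
    have ne: "?p \<noteq> []" using tau_nonempty[of d' x S'] by (simp add: S d')
    then have "\<exists>y\<in>set S. y \<in> set ?p" using p(2) by (cases ?p) auto
    then have "length ?R < length S" by (auto intro: length_filter_less)
    then have IH: "(\<forall>p\<in>set (color cs d ?R). transitive_list p \<and> p \<noteq> [] \<and> distinct p) \<and>
      (\<Union>p\<in>set (color cs d ?R). set p) = set ?R \<and> distinct (concat (color cs d ?R))"
      using Cons.prems by (intro Cons.IH) auto
    moreover have "set (concat (color cs d ?R)) = (\<Union>p\<in>set (color cs d ?R). set p)" by simp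
    ultimately show ?thesis
      unfolding e using p ne transitive_list_distinct[OF T p(1)] by auto
  qed simp
qed simp

lemma color_partition_on:
  assumes T: "tournament V A" and d: "d > 0" and S: "length S \<le> length cs" "distinct S" "set S = V"
  shows "lists_sets (color cs d S) (set ` set (color cs d S))"
    "partition_on V (set ` set (color cs d S))"
    "\<forall>X\<in>set ` set (color cs d S). transitive_set A X"
proof -
  let ?ps = "color cs d S"
  have c: "\<And>p. p \<in> set ?ps \<Longrightarrow> transitive_list p \<and> p \<noteq> [] \<and> distinct p" "(\<Union>p\<in>set ?ps. set p) = V" "distinct (concat ?ps)"
    using color_partition[OF T d S(1,2)] S(3) by auto
  have noempty: "[] \<notin> set ?ps" using c(1) by blast
  then have dps: "distinct ?ps" and dj: "\<And>p p'. p \<in> set ?ps \<Longrightarrow> p' \<in> set ?ps \<Longrightarrow> p \<noteq> p' \<Longrightarrow> set p \<inter> set p' = {}"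
    using c(3) by (auto simp: distinct_concat_iff removeAll_id)
  have "inj_on set (set ?ps)"
  proof (rule inj_onI)
    fix p p' assume a: "p \<in> set ?ps" "p' \<in> set ?ps" "set p = set p'"
    then have "set p \<inter> set p' = set p" by simp
    then have "set p \<inter> set p' \<noteq> {}" using c(1)[OF a(1)] by simp
    then show "p = p'" using dj[OF a(1,2)] by blast
  qed
  then have "distinct (map set ?ps)" using dps by (simp add: distinct_map)
  then show "lists_sets ?ps (set ` set ?ps)" using c(1) by (auto simp: lists_sets_def)
  show "partition_on V (set ` set ?ps)"
    unfolding partition_on_def disjoint_def
  proof (intro conjI ballI impI)
    show "\<Union> (set ` set ?ps) = V" using c(2) by simp
    show "{} \<notin> set ` set ?ps" using c(1) by auto
  qed (use dj in auto)
  show "\<forall>X\<in>set ` set ?ps. transitive_set A X"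
    using c(1) transitive_set_list[OF T] by auto
qed

text \<open>
  A part found when \<open>s\<close> vertices are left has at least \<open>a s^\<epsilon>\<close> vertices, so the terms of the sum that belong to it add up
  to at least \<open>1\<close>.
\<close>

lemma color_count:
  fixes a \<epsilon> :: real
  assumes T: "tournament V A" and d: "d > 0" and a: "a > 0" and eps: "\<epsilon> \<ge> 0"
    and g: "\<And>X. distinct X \<Longrightarrow> set X \<subseteq> V \<Longrightarrow> X \<noteq> [] \<Longrightarrow> a * real (length X) powr \<epsilon> \<le> length (tau d X)"
  shows "distinct S \<Longrightarrow> set S \<subseteq> V \<Longrightarrow>
    length (color cs d S) \<le> (\<Sum>x=1..length S. 1 / (a * real x powr \<epsilon>))"
proof (induction cs arbitrary: S)
  case Nil
  then show ?case using a by (simp add: sum_nonneg)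
next
  case (Cons c cs)
  show ?case
  proof (cases S)
    case Nil
    then show ?thesis by simp
  next
    case S: (Cons x S')
    let ?p = "tau d S"
    let ?R = "filter (\<lambda>y. y \<notin> set ?p) S"
    have e: "color (c # cs) d S = ?p # color cs d ?R" unfolding S color.simps ..
    have p: "transitive_list ?p" "set ?p \<subseteq> set S" using tau_sound[of d] by (auto simp: sound_def)
    have dp: "distinct ?p" by (rule transitive_list_distinct[OF T p(1)])
    have lR: "length S = length ?R + length ?p"
    proof -
      have "length ?R = card (set S - set ?p)"
        using Cons.prems(1) by (simp add: distinct_length_filter set_diff_eq Int_def conj_commute)
      also have "\<dots> = card (set S) - card (set ?p)" using p(2) by (intro card_Diff_subset) auto
      finally show ?thesis using dp Cons.prems(1) p(2) card_mono[of "set S" "set ?p"] by (simp add: distinct_card)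
    qed
    let ?s = "length S" and ?r = "length ?R"
    have s0: "real ?s powr \<epsilon> > 0" using S by simp
    have "1 \<le> length ?p / (a * real ?s powr \<epsilon>)"
      using g[OF Cons.prems] S a s0 by (simp add: le_divide_eq)
    also have "\<dots> = (\<Sum>x=?r+1..?s. 1 / (a * real ?s powr \<epsilon>))" using lR by simp
    also have "\<dots> \<le> (\<Sum>x=?r+1..?s. 1 / (a * real x powr \<epsilon>))"
      using a eps by (intro sum_mono divide_left_mono mult_left_mono powr_mono2 mult_pos_pos) auto
    finally have 1: "1 \<le> (\<Sum>x=?r+1..?s. 1 / (a * real x powr \<epsilon>))" .
    have "length (color cs d ?R) \<le> (\<Sum>x=1..?r. 1 / (a * real x powr \<epsilon>))"
      using Cons.prems by (intro Cons.IH) auto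
    then have "1 + real (length (color cs d ?R)) \<le> (\<Sum>x=1..?r. 1 / (a * real x powr \<epsilon>)) + (\<Sum>x=?r+1..?s. 1 / (a * real x powr \<epsilon>))"
      using 1 by simp
    also have "\<dots> = (\<Sum>x=1..?s. 1 / (a * real x powr \<epsilon>))"
      using sum.ub_add_nat[of 1 ?r "\<lambda>x. 1 / (a * real x powr \<epsilon>)" "length ?p"] lR by simp
    finally show ?thesis unfolding e by simp
  qed
qed

end

section \<open>Estimates for the number of parts, the exponent and the running time\<close>

lemma harmonic_le: "n \<ge> 1 \<Longrightarrow> (\<Sum>x=1..n. 1 / real x) \<le> 1 + ln (real n)"
proof (induction n rule: dec_induct)
  case (step n)
  have "ln (real n / real (Suc n)) \<le> real n / real (Suc n) - 1"
    using step by (intro ln_le_minus_one) simp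
  then have "1 / real (Suc n) \<le> ln (real (Suc n)) - ln (real n)"
    using step by (simp add: ln_div field_simps)
  then show ?case using step by simp
qed simp

lemma ln_2_ge: "1 / 2 \<le> ln (2 :: real)"
  using ln_le_minus_one[of "1 / 2 :: real"] by (simp add: ln_div)

text \<open>\<open>1 / x powr \<epsilon>\<close> is at most
  \<open>n powr (1 - \<epsilon>) / x\<close>, so the sum is bounded by a harmonic one; this is the
  source of the factor \<open>ln n\<close>. The 3 comes from
  \<open>1 \<le> 2 * ln n\<close>.\<close>

lemma power_sum_le:
  fixes a \<epsilon> :: real
  assumes n: "n \<ge> 2" and a: "a > 0" and eps: "0 \<le> \<epsilon>" "\<epsilon> \<le> 1"
  shows "(\<Sum>x=1..n. 1 / (a * real x powr \<epsilon>)) \<le> 3 / a * (real n powr (1 - \<epsilon>) * ln (real n))"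
proof -
  have "(\<Sum>x=1..n. 1 / (a * real x powr \<epsilon>)) \<le> (\<Sum>x=1..n. (real n powr (1 - \<epsilon>) / a) * (1 / real x))"
  proof (rule sum_mono)
    fix x assume x: "x \<in> {1..n}"
    have "1 / real x powr \<epsilon> = real x powr (1 - \<epsilon>) / real x"
      using x by (simp add: powr_diff)
    also have "\<dots> \<le> real n powr (1 - \<epsilon>) / real x"
      using x eps by (intro divide_right_mono powr_mono2) auto
    finally have "1 / real x powr \<epsilon> / a \<le> real n powr (1 - \<epsilon>) / real x / a"
      using a by (intro divide_right_mono) auto
    then show "1 / (a * real x powr \<epsilon>) \<le> (real n powr (1 - \<epsilon>) / a) * (1 / real x)"
      by (simp add: mult.commute)
  qed
  also have "\<dots> = real n powr (1 - \<epsilon>) / a * (\<Sum>x=1..n. 1 / real x)" by (simp only: sum_distrib_left)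
  also have "\<dots> \<le> real n powr (1 - \<epsilon>) / a * (1 + ln (real n))"
    using n a by (intro mult_left_mono harmonic_le) auto
  also have "\<dots> \<le> real n powr (1 - \<epsilon>) / a * (3 * ln (real n))"
  proof (intro mult_left_mono)
    have "ln 2 \<le> ln (real n)" using n by simp
    then show "1 + ln (real n) \<le> 3 * ln (real n)" using ln_2_ge by linarith
  qed (use a in auto)
  finally show ?thesis by (simp add: mult_ac)
qed

text \<open>All numerical factors are absorbed into powers of h by \<open>2 \<le> h\<close>. The
  exponent ends up as \<open>32 * h ^ 2 + 16 * h + 3\<close>, and 41 is the least integer
  coefficient of \<open>h ^ 2\<close> that dominates it at \<open>h = 2\<close>.\<close>

lemma level_loss_le:
  assumes h: "h \<ge> 2"
  shows "level_loss h \<le> h ^ (41 * h ^ 2)"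
proof -
  have p2: "2 * k \<le> h * k" for k using h by (intro mult_le_mono1)
  have four: "4 * k \<le> h ^ 2 * k" for k
    using p2[of k] p2[of "h * k"] unfolding power2_eq_square mult.assoc by linarith
  have h1: "h + 1 \<le> h ^ 2" using p2[of h] h unfolding power2_eq_square by linarith
  have h2: "2 * h + 1 \<le> h ^ 3" using four[of h] h unfolding power3_eq_cube power2_eq_square by linarith
  have "4 * (h * (h + 1)) \<le> h ^ 2 * (h * h ^ 2)" using h1 by (intro order_trans[OF four] mult_le_mono) auto
  also have "\<dots> = h ^ 5" by (simp add: eval_nat_numeral)
  finally have prune_at: "prune_at h \<le> h ^ 5" by (simp add: prune_at_def mult.assoc)
  have "4 * ((2 * h + 1) * prune_at h) \<le> h ^ 2 * (h ^ 3 * h ^ 5)" using h2 prune_at by (intro order_trans[OF four] mult_le_mono) auto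
  also have "\<dots> = h ^ 10" by (simp flip: power_add)
  finally have restrict_at: "restrict_at h \<le> h ^ 10" by (simp only: restrict_at_def mult.assoc)
  have "2 * emb_at h = 2 * (2 * (2 * (2 * restrict_at h)))" by (simp add: emb_at_def)
  also have "\<dots> \<le> h * (h * (h * (h * h ^ 10)))"
    using restrict_at h by (intro mult_le_mono) auto
  also have "\<dots> = h ^ 14" by (simp add: eval_nat_numeral)
  finally have e: "2 * emb_at h \<le> h ^ 14" .
  have "8 * h = 2 * (2 * (2 * h))" by simp
  also have "\<dots> \<le> h * (h * (h * h))" using h by (intro mult_le_mono) auto
  also have "\<dots> = h ^ 4" by (simp add: eval_nat_numeral)
  finally have "8 * h * (2 * emb_at h) ^ h \<le> h ^ 4 * (h ^ 14) ^ h" using e by (intro mult_le_mono power_mono) auto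
  also have "\<dots> = h ^ (4 + 14 * h)" by (simp add: power_add power_mult)
  also have "\<dots> \<le> h ^ (16 * h)" using h by (intro power_increasing) auto
  finally have g: "stage_loss h \<le> h ^ (16 * h)" by (simp add: stage_loss_def)
  have "level_loss h \<le> (h ^ (16 * h)) ^ (2 * h + 1) * (h ^ 2 * h)"
    unfolding level_loss_def using g by (intro mult_le_mono power_mono four) auto
  also have "\<dots> = h ^ (16 * h * (2 * h + 1) + 3)"

  proof -
    have "(h ^ X) ^ Y * (h ^ 2 * h) = h ^ (X * Y + 3)" for X Y
      by (simp add: power_add power_mult power3_eq_cube power2_eq_square)
    then show ?thesis .
  qed
  also have "\<dots> \<le> h ^ (41 * h ^ 2)"
  proof (rule power_increasing)
    show "16 * h * (2 * h + 1) + 3 \<le> 41 * h ^ 2"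
    proof -
      have "16 * h * (2 * h + 1) + 3 = 32 * (h * h) + 16 * h + 3" by (simp add: algebra_simps)
      then show ?thesis using p2[of h] h unfolding power2_eq_square by linarith
    qed
  qed (use h in simp)
  finally show ?thesis .
qed

text \<open>\<open>328 = 8 * 41\<close>: the 8 is from \<open>ln (rho h) \<ge> 1 / (8 * h)\<close>,
  a consequence of \<open>ln x \<ge> 1 - 1 / x\<close>, and the 41 from
  \<open>level_loss_le\<close>. The resulting \<open>h ^ 3\<close> is weakened to the fifth
  power.\<close>

lemma exponent_le:
  assumes h: "h \<ge> 2"
  shows "1 / 328 / (real h ^ 5 * ln (real h)) \<le> ln (rho h) / ln (real (level_loss h))"
proof -
  have lh: "ln (real h) > 0" using h by simp
  have d3: "level_loss h \<ge> 3" using h by (intro search.level_loss_ge) simp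
  then have ld: "ln (real (level_loss h)) > 0" by simp
  have "real (level_loss h) \<le> real (h ^ (41 * h ^ 2))" using level_loss_le[OF h] by (simp only: of_nat_le_iff)
  then have "real (level_loss h) \<le> real h ^ (41 * h ^ 2)" by simp
  then have "ln (real (level_loss h)) \<le> ln (real h ^ (41 * h ^ 2))" using d3 h by (subst ln_le_cancel_iff) auto
  also have "\<dots> = 41 * real h ^ 2 * ln (real h)" using h by (simp add: ln_realpow)
  finally have up: "ln (real (level_loss h)) \<le> 41 * real h ^ 2 * ln (real h)" .
  have r: "rho h > 0" by (simp add: rho_def add_pos_nonneg)
  have "ln (1 / rho h) \<le> 1 / rho h - 1" using r by (intro ln_le_minus_one) simp
  then have "1 - 1 / rho h \<le> ln (rho h)" using r by (simp add: ln_div)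
  moreover have "1 - 1 / rho h = 1 / (4 * real h + 5)" by (simp add: rho_def field_simps)
  moreover have "1 / (8 * real h) \<le> 1 / (4 * real h + 5)" using h by (intro divide_left_mono) auto
  ultimately have lo: "1 / (8 * real h) \<le> ln (rho h)" by linarith
  have "1 / 328 / (real h ^ 5 * ln (real h)) \<le> 1 / 328 / (real h ^ 3 * ln (real h))"
    using h lh by (intro divide_left_mono mult_right_mono power_increasing mult_pos_pos) auto
  also have "\<dots> = 1 / (8 * real h) / (41 * real h ^ 2 * ln (real h))"
    by (simp add: power3_eq_cube power2_eq_square)
  also have "\<dots> \<le> ln (rho h) / (41 * real h ^ 2 * ln (real h))"
    using lo lh by (intro divide_right_mono) auto
  also have "\<dots> \<le> ln (rho h) / ln (real (level_loss h))"
    using up ld lo h lh by (intro divide_left_mono mult_pos_pos) (auto intro: order_trans[rotated])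
  finally show ?thesis .
qed

text \<open>Growth by the factor \<open>rho h\<close> per factor \<open>level_loss h\<close> in size
  is a power law with exponent \<open>ln (rho h) / ln (level_loss h)\<close>. The constant in front
  pays for the \<open>16 * (h + 1)\<close> initial levels and for rounding the size down to a power
  of \<open>level_loss h\<close>.\<close>

lemma (in search) tau_growth_powr:
  fixes \<epsilon> :: real
  assumes T: "tournament {..<n} A" and h: "h > 0" and pat: "\<And>j. j < h \<Longrightarrow> length (pat j) = j"
    and free: "pat_free {..<n}" and c: "star_map h c"
    and noemb: "\<not> (\<exists>\<psi>. (\<forall>p<h. \<psi> p \<in> {..<n}) \<and> (\<forall>p' p. p < p' \<longrightarrow> p' < h \<longrightarrow> placed c \<psi> p p'))"
    and eps: "\<epsilon> \<le> ln (rho h) / ln (real (level_loss h))"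
    and S: "distinct S" "set S \<subseteq> {..<n}" "S \<noteq> []"
  shows "1 / rho h ^ (16 * (h + 1) + 1) * real (length S) powr \<epsilon> \<le> length (tau (lg n) S)"
proof -
  let ?t = "16 * (h + 1)" and ?s = "length S" and ?D = "level_loss h"
  have d3: "?D \<ge> 3" by (rule level_loss_ge[OF h])
  have s1: "1 \<le> ?s" using S(3) by (cases S) auto
  have r1: "rho h \<ge> 1" by (simp add: rho_def)
  obtain k where k: "?D ^ k \<le> ?s" "?s < ?D ^ (k + 1)"
    using ex_power_ivl1[of ?D ?s] d3 s1 by auto
  have "length S = card (set S)" using S(1) by (simp add: distinct_card)
  also have "\<dots> \<le> n" using S(2) card_mono[of "{..<n}" "set S"] by simp
  finally have sn: "?s \<le> n" .
  \<comment> \<open>The fuel suffices, because each level uses up a factor of at least 2 in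
    size.\<close>
  have "(2::nat) ^ k \<le> ?D ^ k" using d3 by (intro power_mono) auto
  also have "\<dots> < 2 ^ lg n" using k(1) sn lg_lower[of n] by linarith
  finally have kd: "k \<le> lg n" by simp
  have gr: "k \<le> length (tau (lg n) S)" "?t \<le> k \<Longrightarrow> rho h ^ (k - ?t) \<le> length (tau (lg n) S)"
    using tau_growth[OF T h pat free c noemb kd S(1,2) k(1)] by auto
  have ne: "1 \<le> length (tau (lg n) S)"
  proof -
    have "n \<noteq> 0" using sn s1 by simp
    then obtain d' where "lg n = Suc d'" by (simp add: lg.simps[of n])
    moreover obtain x S' where "S = x # S'" using S(3) by (cases S) auto
    ultimately have "tau (lg n) S \<noteq> []" using tau_nonempty by simp
    then show ?thesis by (cases "tau (lg n) S") auto
  qed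
  have "rho h ^ k \<le> rho h ^ ?t * length (tau (lg n) S)"
  proof (cases "?t \<le> k")
    case True
    have "rho h ^ k = rho h ^ ?t * rho h ^ (k - ?t)" using True by (simp flip: power_add)
    also have "\<dots> \<le> rho h ^ ?t * length (tau (lg n) S)"
      using gr(2)[OF True] r1 by (intro mult_left_mono) auto
    finally show ?thesis .
  next
    case False
    then have "rho h ^ k \<le> rho h ^ ?t" using r1 by (intro power_increasing) auto
    also have "\<dots> \<le> rho h ^ ?t * length (tau (lg n) S)"
      using mult_left_mono[of 1 "real (length (tau (lg n) S))" "rho h ^ ?t"] ne r1 by simp
    finally show ?thesis .
  qed
  then have "rho h * rho h ^ k \<le> rho h * (rho h ^ ?t * length (tau (lg n) S))"
    using r1 by (intro mult_left_mono) auto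
  then have 1: "rho h ^ (k + 1) \<le> rho h ^ (?t + 1) * length (tau (lg n) S)"
    by (simp only: Suc_eq_plus1[symmetric] power_Suc mult.assoc)
  define e0 where "e0 = ln (rho h) / ln (real ?D)"
  have e0: "e0 \<ge> 0" unfolding e0_def using r1 d3 by simp
  have Dp: "real ?D powr e0 = rho h"
    unfolding e0_def powr_def using d3 r1 by simp
  have "real ?s powr \<epsilon> \<le> real ?s powr e0" using eps s1 unfolding e0_def by (intro powr_mono) auto
  also have "\<dots> \<le> real (?D ^ (k + 1)) powr e0" using k(2) e0 by (intro powr_mono2) (auto simp del: power_Suc of_nat_power)
  also have "\<dots> = (real ?D powr e0) ^ (k + 1)"
    using d3 by (simp add: powr_mult powr_power[symmetric] powr_powr powr_realpow[symmetric] mult.commute del: power_Suc)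
  also have "\<dots> = rho h ^ (k + 1)" by (simp only: Dp)
  also note 1
  finally show ?thesis using r1 by (simp add: field_simps)
qed

text \<open>\<open>lg n + 1\<close> is at most \<open>4 * ln n\<close>, so the time is at most
  \<open>exp (4 * e * b * (ln n) ^ 2)\<close>; since \<open>ln n \<ge> 1\<close> for
  \<open>n \<ge> 3\<close>, the exponent 2 may be raised to the common constant that the form of the
  bound requires.\<close>

lemma quasipolynomial_bound:
  fixes n b e :: nat
  assumes n: "n \<ge> 3" and N: "N \<le> n ^ b" and b: "b \<ge> 1" and e: "e \<ge> 1"
    and t: "t \<le> N ^ (e * (lg n + 1))"
  shows "real t \<le> exp (real (4 * e * b) * ln (real n) powr real (4 * e * b))"
proof -
  have l1: "1 \<le> ln (real n)"
  proof -
    have "exp 1 \<le> real n" using exp_le n by linarith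
    then show ?thesis using n by (subst ln_ge_iff) auto
  qed
  have "real (2 ^ lg n) \<le> real (2 * n)" using lg_upper[of n] n by (simp only: of_nat_le_iff)
  then have "(2::real) ^ lg n \<le> 2 * real n" by simp
  then have "ln ((2::real) ^ lg n) \<le> ln (2 * real n)" using n by (subst ln_le_cancel_iff) auto
  then have "real (lg n) * ln 2 \<le> ln 2 + ln (real n)" using n by (simp add: ln_realpow ln_mult)
  then have "(real (lg n) - 1) * ln 2 \<le> ln (real n)" by (simp add: algebra_simps)
  moreover have "(real (lg n) - 1) * (1 / 2) \<le> (real (lg n) - 1) * ln 2" if "lg n \<ge> 1"
    using that ln_2_ge by (intro mult_left_mono) auto
  ultimately have "real (lg n) + 1 \<le> 4 * ln (real n)" using l1 by (cases "lg n \<ge> 1") auto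
  then have l: "real e * (real (lg n) + 1) * real b \<le> real e * (4 * ln (real n)) * real b"
    by (intro mult_left_mono mult_right_mono) auto
  have "t \<le> (n ^ b) ^ (e * (lg n + 1))" using t N power_mono[of N "n ^ b" "e * (lg n + 1)"] by linarith
  then have "real t \<le> real ((n ^ b) ^ (e * (lg n + 1)))" by (simp only: of_nat_le_iff)
  also have "\<dots> = exp (ln (real n)) ^ (b * (e * (lg n + 1)))" using n by (simp add: power_mult)
  also have "\<dots> = exp (real (b * (e * (lg n + 1))) * ln (real n))" by (simp only: exp_of_nat_mult)
  also have "\<dots> \<le> exp (real (4 * e * b) * ln (real n) powr real (4 * e * b))"
  proof -
    have "real (b * (e * (lg n + 1))) * ln (real n) = real e * (real (lg n) + 1) * real b * ln (real n)"
      by (simp add: algebra_simps)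
    also have "\<dots> \<le> real e * (4 * ln (real n)) * real b * ln (real n)"
      by (rule mult_right_mono[OF l]) (use l1 in simp)
    also have "\<dots> = real (4 * e * b) * ln (real n) ^ 2" by (simp add: power2_eq_square)
    also have "\<dots> = real (4 * e * b) * ln (real n) powr 2" using l1 by simp
    also have "\<dots> \<le> real (4 * e * b) * ln (real n) powr real (4 * e * b)"
    proof (intro mult_left_mono powr_mono l1)
      have "1 * 1 \<le> e * b" using b e by (intro mult_le_mono)
      then show "2 \<le> real (4 * e * b)" by (simp flip: of_nat_mult)
    qed simp
    finally show ?thesis by simp
  qed
  finally show ?thesis .
qed

theorem theorem6:
  shows "\<exists>C::real. C > 0 \<and>
    (\<forall>(VH :: nat set) AH.
       tournament VH AH \<and> prime_tournament VH AH \<and> galaxy VH AH \<and> card VH \<ge> 2 \<longrightarrow>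
       (\<exists>(P :: program) (K :: real) (c :: real).
          \<forall>(n :: nat) A. tournament {..<n} A \<and> free_of VH AH {..<n} A \<longrightarrow>
            (\<exists>ps Q t.
               computes P (enc_digraph n A) (enc_sets ps) t \<and>
               lists_sets ps Q \<and> partition_on {..<n} Q \<and>
               (\<forall>S\<in>Q. transitive_set A S) \<and>
               (n \<ge> 3 \<longrightarrow> real t \<le> exp (K * ln (real n) powr K)) \<and>
               (n \<ge> 2 \<longrightarrow> real (card Q) \<le>
                  c * (real n powr (1 - C / (real (card VH) ^ 5 * ln (real (card VH)))) * ln (real n))))))"
proof (intro exI[of _ "1 / 328 :: real"] conjI allI impI)
  fix VH :: "nat set" and AH
  assume H: "tournament VH AH \<and> prime_tournament VH AH \<and> galaxy VH AH \<and> card VH \<ge> 2"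
  then have TH: "tournament VH AH" and card2: "card VH \<ge> 2" by auto
  obtain \<theta> c where th: "distinct \<theta>" "set \<theta> = VH" and c: "star_map (length \<theta>) c"
    and bk: "\<And>p p'. p < p' \<Longrightarrow> p' < length \<theta> \<Longrightarrow> ((\<theta> ! p', \<theta> ! p) \<in> AH \<longleftrightarrow> c p = p' \<or> c p' = p)"
    using galaxy_star_map[of VH AH] H by blast
  define h where "h = length \<theta>"
  have hc: "h = card VH" using th by (simp add: h_def distinct_card flip: th(2))
  have h2: "h \<ge> 2" using card2 hc by simp
  have ch: "star_map h c" using c by (simp add: h_def)
  define pat where "pat j = map (\<lambda>i. (\<theta> ! i, \<theta> ! j) \<in> AH) [0..<j]" for j
  define \<epsilon> where "\<epsilon> = 1 / 328 / (real h ^ 5 * ln (real h))"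
  \<comment> \<open>Collects the constants depending on H, so that \<open>N = n + K0\<close> meets
    the requirements of \<open>search_prog\<close>.\<close>
  define K0 where "K0 = 1000 + (2 * emb_at h + 2 * h + 10) + (\<Sum>j<h. cells (enc_list enc_bool (pat j)))"
  \<comment> \<open>Chosen for \<open>n + K0 \<le> n * (K0 + 1) \<le> n ^ b\<close>, by
    \<open>K0 + 1 < 2 ^ (K0 + 1)\<close>.\<close>
  define b where "b = K0 + 2"
  \<comment> \<open>\<open>2 * h + 13\<close> is the exponent in \<open>base\<close>; the 8 leaves
    room for two further factors \<open>N\<close>, one for the rounds of the colouring and one for
    constants.\<close>
  define e where "e = 2 * h + 13 + 8"
  define a where "a = 1 / rho h ^ (16 * (h + 1) + 1)"
  have rho: "rho h > 0" by (simp add: rho_def add_pos_nonneg)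
  have a: "a > 0" using rho by (simp add: a_def)
  have eps: "0 \<le> \<epsilon>" "\<epsilon> \<le> ln (rho h) / ln (real (level_loss h))"
    using h2 exponent_le[OF h2] by (auto simp: \<epsilon>_def)
  show "\<exists>(P :: program) (K :: real) (cc :: real).
          \<forall>(n :: nat) A. tournament {..<n} A \<and> free_of VH AH {..<n} A \<longrightarrow>
            (\<exists>ps Q t.
               computes P (enc_digraph n A) (enc_sets ps) t \<and>
               lists_sets ps Q \<and> partition_on {..<n} Q \<and>
               (\<forall>S\<in>Q. transitive_set A S) \<and>
               (n \<ge> 3 \<longrightarrow> real t \<le> exp (K * ln (real n) powr K)) \<and>
               (n \<ge> 2 \<longrightarrow> real (card Q) \<le>
                  cc * (real n powr (1 - 1 / 328 / (real (card VH) ^ 5 * ln (real (card VH)))) * ln (real n))))"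
  proof (rule exI[of _ "prog h pat"], rule exI[of _ "real (4 * e * b)"], rule exI[of _ "3 / a"], intro allI impI)
    fix n :: nat and A
    assume TA: "tournament {..<n} A \<and> free_of VH AH {..<n} A"
    then have T: "tournament {..<n} A" and free: "free_of VH AH {..<n} A" by auto
    define N where "N = n + K0"
    interpret search_prog A h pat n N
    proof
      show "cells (enc_list enc_bool (pat j)) \<le> N" if "j < h" for j
      proof -
        have "cells (enc_list enc_bool (pat j)) \<le> (\<Sum>j<h. cells (enc_list enc_bool (pat j)))"
          using that by (intro member_le_sum) auto
        then show ?thesis by (simp add: N_def K0_def)
      qed
    qed (use T h2 in \<open>auto simp: N_def K0_def\<close>)
    let ?ps = "color [0..<n] (lg n) [0..<n]"
    have pat_len: "length (pat j) = j" for j by (simp add: pat_def)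
    have nofree: "\<not> (\<exists>vs. length vs = length \<theta> \<and> distinct vs \<and> set vs \<subseteq> {..<n} \<and>
       (\<forall>j<length \<theta>. \<forall>i<j. (vs ! i, vs ! j) \<in> A \<longleftrightarrow> (\<theta> ! i, \<theta> ! j) \<in> AH))"
      using not_free_of[OF T TH th] free by blast
    have pf: "pat_free {..<n}"
      using nofree unfolding pat_free_def by (auto simp: pat_def h_def)
    \<comment> \<open>An embedding in the sense of \<open>placed\<close> would be an ordered copy of
      H; its vertices are distinct because any two of them are joined by an arc.\<close>
    have noemb: "\<not> (\<exists>\<psi>. (\<forall>p<h. \<psi> p \<in> {..<n}) \<and> (\<forall>p' p. p < p' \<longrightarrow> p' < h \<longrightarrow> placed c \<psi> p p'))"
    proof
      assume "\<exists>\<psi>. (\<forall>p<h. \<psi> p \<in> {..<n}) \<and> (\<forall>p' p. p < p' \<longrightarrow> p' < h \<longrightarrow> placed c \<psi> p p')"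
      then obtain \<psi> where \<psi>: "\<And>p. p < h \<Longrightarrow> \<psi> p \<in> {..<n}" "\<And>p p'. p < p' \<Longrightarrow> p' < h \<Longrightarrow> placed c \<psi> p p'" by blast
      have arc: "(\<psi> p, \<psi> p') \<in> A \<longleftrightarrow> (\<theta> ! p, \<theta> ! p') \<in> AH" and dist: "\<psi> p \<noteq> \<psi> p'" if pp: "p < p'" "p' < h" for p p'
      proof -
        have "p' < length \<theta>" using pp by (simp add: h_def)
        then have ne: "\<theta> ! p \<noteq> \<theta> ! p'" "\<theta> ! p \<in> VH" "\<theta> ! p' \<in> VH" using pp th by (auto simp: nth_eq_iff_index_eq)
        have "(\<theta> ! p, \<theta> ! p') \<in> AH \<longleftrightarrow> \<not> (c p = p' \<or> c p' = p)"
          using bk[OF pp(1)] pp(2) tournament_asym[OF TH] tournament_total[OF TH ne(2,3,1)] unfolding h_def by blast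
        then show "(\<psi> p, \<psi> p') \<in> A \<longleftrightarrow> (\<theta> ! p, \<theta> ! p') \<in> AH"
          using \<psi>(2)[OF pp] tournament_asym[OF T] unfolding placed_def by (auto split: if_splits)
        show "\<psi> p \<noteq> \<psi> p'" using \<psi>(2)[OF pp] tournament_asym[OF T] unfolding placed_def by (metis (full_types))
      qed
      let ?vs = "map \<psi> [0..<h]"
      have "distinct ?vs"
        unfolding distinct_conv_nth using dist by (auto) (metis nat_neq_iff)
      moreover have "length ?vs = length \<theta>" by (simp add: h_def)
      moreover have "set ?vs \<subseteq> {..<n}" using \<psi>(1) by auto
      moreover have "(?vs ! i, ?vs ! j) \<in> A \<longleftrightarrow> (\<theta> ! i, \<theta> ! j) \<in> AH" if "j < length \<theta>" "i < j" for i j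
        using arc[of i j] that by (simp add: h_def)
      ultimately show False using nofree by blast
    qed
    have lgpos: "n > 0 \<Longrightarrow> lg n > 0" by (simp add: lg.simps[of n])
    obtain t where t: "t \<le> N * (base ^ (lg n + 1) + N ^ 4) + N ^ 4"
      "computes (prog h pat) (enc_digraph n A) (enc_sets ?ps) t"
      using computes_color[OF tau_cost_power] by blast
    show "\<exists>ps Q t.
               computes (prog h pat) (enc_digraph n A) (enc_sets ps) t \<and>
               lists_sets ps Q \<and> partition_on {..<n} Q \<and>
               (\<forall>S\<in>Q. transitive_set A S) \<and>
               (n \<ge> 3 \<longrightarrow> real t \<le> exp (real (4 * e * b) * ln (real n) powr real (4 * e * b))) \<and>
               (n \<ge> 2 \<longrightarrow> real (card Q) \<le>
                  3 / a * (real n powr (1 - 1 / 328 / (real (card VH) ^ 5 * ln (real (card VH)))) * ln (real n)))"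
    proof (intro exI conjI impI)
      show "computes (prog h pat) (enc_digraph n A) (enc_sets ?ps) t" by (rule t(2))
      have part: "lists_sets ?ps (set ` set ?ps) \<and> partition_on {..<n} (set ` set ?ps) \<and>
         (\<forall>S\<in>set ` set ?ps. transitive_set A S)"
      proof (cases "n = 0")
        \<comment> \<open>Without vertices \<open>lg 0 = 0\<close> provides no fuel, but the empty
          family is the right partition.\<close>
        case True
        then show ?thesis by (simp add: lists_sets_def partition_on_def)
      next
        case False
        then show ?thesis
          using color_partition_on[OF T lgpos, of "[0..<n]" "[0..<n]"] by (simp add: atLeast_upt)
      qed
      then show "lists_sets ?ps (set ` set ?ps)" "partition_on {..<n} (set ` set ?ps)"
        "\<forall>S\<in>set ` set ?ps. transitive_set A S" by blast+
      show "real t \<le> exp (real (4 * e * b) * ln (real n) powr real (4 * e * b))" if n3: "n \<ge> 3"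
      proof (rule quasipolynomial_bound[OF n3])
        have "K0 + 1 < 2 ^ (K0 + 1)" by (rule less_exp)
        also have "\<dots> \<le> n ^ (K0 + 1)" using n3 by (intro power_mono) auto
        finally have "n * (K0 + 1) \<le> n * n ^ (K0 + 1)" by (intro mult_le_mono2) simp
        moreover have "n + K0 \<le> n * (K0 + 1)" using n3 by simp
        moreover have "n ^ b = n * n ^ (K0 + 1)" by (simp add: b_def)
        ultimately show "N \<le> n ^ b" unfolding N_def by linarith
        have N1: "N \<ge> 1" "4 \<le> N" using N_big(1) by auto
        have "N ^ 4 \<le> N ^ (2 * h + 13)" using N1 by (intro power_increasing) auto
        also have "\<dots> = base ^ 1" by (simp add: base_def)
        also have "\<dots> \<le> base ^ (lg n + 1)" using N1 unfolding base_def by (intro power_increasing) (auto intro: one_le_power)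
        finally have N4: "N ^ 4 \<le> base ^ (lg n + 1)" .
        have "1 * base ^ (lg n + 1) \<le> N * base ^ (lg n + 1)" using N1 by (intro mult_le_mono1)
        moreover have "N * N ^ 4 \<le> N * base ^ (lg n + 1)" by (intro mult_le_mono2 N4)
        moreover have "N * (base ^ (lg n + 1) + N ^ 4) = N * base ^ (lg n + 1) + N * N ^ 4" by (rule distrib_left)
        ultimately have "t \<le> 4 * (N * base ^ (lg n + 1))" using t(1) N4 by linarith
        also have "\<dots> \<le> N * (N * base ^ (lg n + 1))" using N1 by (intro mult_le_mono1)
        also have "\<dots> = N ^ (2 + (2 * h + 13) * (lg n + 1))"
        proof -
          have "N * (N * (N ^ M) ^ L) = N ^ (2 + M * L)" for M L
            by (simp add: power_add power_mult power2_eq_square)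
          then show ?thesis unfolding base_def .
        qed
        also have "\<dots> \<le> N ^ (e * (lg n + 1))"
          using N1 by (intro power_increasing) (simp_all add: e_def algebra_simps)
        finally show "t \<le> N ^ (e * (lg n + 1))" .
      qed (simp_all add: b_def e_def)
      show "real (card (set ` set ?ps)) \<le>
          3 / a * (real n powr (1 - 1 / 328 / (real (card VH) ^ 5 * ln (real (card VH)))) * ln (real n))" if n2: "n \<ge> 2"
      proof -
        have "card (set ` set ?ps) \<le> length ?ps"
          using card_image_le[of "set ?ps" set] card_length[of ?ps] by simp
        then have "real (card (set ` set ?ps)) \<le> real (length ?ps)" by simp
        also have "\<dots> \<le> (\<Sum>x=1..length [0..<n]. 1 / (a * real x powr \<epsilon>))"
        proof (rule color_count[OF T _ a eps(1)])
          show "lg n > 0" using n2 lgpos by simp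
          show "a * real (length X) powr \<epsilon> \<le> real (length (tau (lg n) X))"
            if "distinct X" "set X \<subseteq> {..<n}" "X \<noteq> []" for X
            unfolding a_def by (rule tau_growth_powr[OF T h_pos pat_len pf ch noemb eps(2) that])
        qed auto
        also have "\<dots> \<le> 3 / a * (real n powr (1 - \<epsilon>) * ln (real n))"
        proof -
          have "\<epsilon> \<le> 1"
          proof -
            have "ln 2 \<le> ln (real h)" using h2 by simp
            then have "1 / 2 \<le> ln (real h)" using ln_2_ge by linarith
            moreover have "1 \<le> real h ^ 5" using h2 by (intro one_le_power) simp
            ultimately have "1 * (1 / 2) \<le> real h ^ 5 * ln (real h)" by (intro mult_mono) auto
            then show ?thesis unfolding \<epsilon>_def by (subst pos_divide_le_eq) auto
          qed
          then show ?thesis using power_sum_le[OF n2 a eps(1)] by simp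
        qed
        finally show ?thesis unfolding \<epsilon>_def hc .
      qed
    qed
  qed
qed simp

end
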